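(* Let $n\ge2$, $Q=2n+2$, and let $u$ be a smooth positive solution of $$-\Delta_{\mathbb{H}^n}u = 2n^2\,u^{\frac{Q+2}{Q-2}}\quad\text{in }\mathbb{H}^n$$ such that, for some $C>0$, $$u(\xi)\le\frac{C}{1+|\xi|^{\frac{Q-2}{2}}}\qquad\forall\,\xi\in\mathbb{H}^n.$$ Then $u\equiv\mathcal{U}_{\lambda,\mu}$ for some $\lambda\in\mathbb{C}$, $\mu\in\mathbb{C}^n$ with $\mathrm{Im}(\lambda)>\frac{|\mu|^2}{4}$, where $$\mathcal{U}_{\lambda,\mu}(z,t)=\frac{C'}{|t+i|z|^2+z\cdot\mu+\lambda|^n}$$ and $C'=C'(n,\lambda)>0$ is the explicit constant for which $\mathcal{U}_{\lambda,\mu}$ solves the equation (Jerison–Lee bubbles).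
   Context: The Heisenberg group $\mathbb{H}^n=\mathbb{C}^n\times\mathbb{R}$ has coordinates $\xi=(z,t)=(z_1,\dots,z_n,t)$ and group law $(z,t)\circ(w,s)=(z+w,t+s+2\,\mathrm{Im}(z^\alpha\bar w^\alpha))$ (summation over repeated Greek indices). The norm is $|\xi|=(|z|^4+t^2)^{1/4}$. Define $Z_\alpha=\frac{\partial}{\partial z^\alpha}+i\bar z_\alpha\frac{\partial}{\partial t}$, $Z_{\bar\alpha}=\frac{\partial}{\partial\bar z^\alpha}-iz_\alpha\frac{\partial}{\partial t}$, and the sub-Laplacian $\Delta_{\mathbb{H}^n}f=\sum_{\alpha}(Z_{\bar\alpha}Z_\alpha f+Z_\alpha Z_{\bar\alpha}f)$. *)

theory Defs
  imports "HOL-Analysis.Analysis"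
begin

type_synonym 'n heis = "(complex ^ 'n) \<times> real"

definition ddir :: "'a::real_normed_vector \<Rightarrow> ('a \<Rightarrow> 'b::real_normed_vector) \<Rightarrow> 'a \<Rightarrow> 'b" where
  "ddir v f p = vector_derivative (\<lambda>s::real. f (p + s *\<^sub>R v)) (at 0)"

fun iter_ddir :: "'a::real_normed_vector list \<Rightarrow> ('a \<Rightarrow> 'b::real_normed_vector) \<Rightarrow> 'a \<Rightarrow> 'b" where
  "iter_ddir [] f = f"
| "iter_ddir (v # vs) f = ddir v (iter_ddir vs f)"

definition smooth :: "('a::real_normed_vector \<Rightarrow> 'b::real_normed_vector) \<Rightarrow> bool" where
  "smooth f \<longleftrightarrow> (\<forall>vs. iter_ddir vs f differentiable_on UNIV)"

definition dx :: "'n::finite \<Rightarrow> ('n heis \<Rightarrow> complex) \<Rightarrow> 'n heis \<Rightarrow> complex" where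
  "dx a f = ddir (axis a 1, 0) f"
definition dy :: "'n::finite \<Rightarrow> ('n heis \<Rightarrow> complex) \<Rightarrow> 'n heis \<Rightarrow> complex" where
  "dy a f = ddir (axis a \<i>, 0) f"
definition dt :: "('n::finite heis \<Rightarrow> complex) \<Rightarrow> 'n heis \<Rightarrow> complex" where
  "dt f = ddir (0, 1) f"

definition dz :: "'n::finite \<Rightarrow> ('n heis \<Rightarrow> complex) \<Rightarrow> 'n heis \<Rightarrow> complex" where
  "dz a f p = (dx a f p - \<i> * dy a f p) / 2"
definition dzbar :: "'n::finite \<Rightarrow> ('n heis \<Rightarrow> complex) \<Rightarrow> 'n heis \<Rightarrow> complex" where
  "dzbar a f p = (dx a f p + \<i> * dy a f p) / 2"

definition Zop :: "'n::finite \<Rightarrow> ('n heis \<Rightarrow> complex) \<Rightarrow> 'n heis \<Rightarrow> complex" where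
  "Zop a f p = dz a f p + \<i> * cnj (fst p $ a) * dt f p"
definition Zbarop :: "'n::finite \<Rightarrow> ('n heis \<Rightarrow> complex) \<Rightarrow> 'n heis \<Rightarrow> complex" where
  "Zbarop a f p = dzbar a f p - \<i> * (fst p $ a) * dt f p"

definition sublap :: "('n::finite heis \<Rightarrow> complex) \<Rightarrow> 'n heis \<Rightarrow> complex" where
  "sublap f p = (\<Sum>a\<in>UNIV. Zbarop a (Zop a f) p + Zop a (Zbarop a f) p)"

definition heis_norm :: "'n::finite heis \<Rightarrow> real" where
  "heis_norm p = (norm (fst p) ^ 4 + (snd p)\<^sup>2) powr (1/4)"

definition JL_bubble :: "real \<Rightarrow> complex \<Rightarrow> complex ^ 'n \<Rightarrow> 'n::finite heis \<Rightarrow> real" where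
  "JL_bubble C' lam mu p =
     C' / cmod (complex_of_real (snd p) + \<i> * complex_of_real ((norm (fst p))\<^sup>2)
                + (\<Sum>a\<in>UNIV. (fst p $ a) * (mu $ a)) + lam) ^ CARD('n)"

end

theory Submission
  imports Defs
begin

text \<open>
  Put $u = e^{nf}$. The divergence identity of Jerison and Lee expresses the divergence of
  $e^{2(n-1)f}\{(g + 3if_0)E_\alpha + (g - if_0)D_\alpha - 3if_0 G_\alpha\}$ as a sum of squares of the tensors
  $D$, $E$, $G$, which all vanish exactly for bubbles. Testing it with a cutoff at scale $R$, the error is
  bounded by $R^{-2}\int (|\partial f|^4 + f_0^2 + e^{4f})e^{2(n-1)f}$. For $n \ge 2$ two further divergences bound the integrals
  of $|\partial f|^4$ and $f_0^2$ by that of $e^{4f}$ plus multiples of $D$, $E$, $G$, which are absorbed. By the decay of $u$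
  what remains is of order $R^{-2}\log R$, so $D = E = G = 0$.
  Then $q = \bar g e^{-2f}$ is CR holomorphic, $qg$ is a positive constant, and all derivatives of $q$ of the relevant order
  are explicit; this gives $q = -ic_0(t + i|z|^2 + z\cdot\mu + \lambda)$ with $|q|^2 = c_0e^{-2f}$.
\<close>

section \<open>Smooth functions and directional derivatives\<close>

text \<open>No bound on derivatives of f is available, only the decay of u. The flux terms
  containing |df| and f_0 must therefore be dominated by quantities that are themselves divergences.
  For this reason one compactly supported combination, \<open>Phi\<close>, tests all fields at once,
  and the absorption is done pointwise, before integrating: after rescaling by the cutoff it is a
  chain of Young inequalities with numerical constants. What is left over is a multiple of
  e^{(2n+2)f}/R^2 and of e^{(2n-2)f}/R^6. Since e^f = O(1/(1+|xi|)), both are at most a multiple of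
  (1+|xi|)^{-Q}/R^2 on the ball. This power is borderline in homogeneous dimension Q: each doubling
  of the radius adds a bounded amount to its integral. Algebra is kept apart from analysis: smooth
  functions form a commutative ring \<open>smf\<close> with derivations, so every tensor identity
  follows from the product rule, a single commutator and ring normalisation.\<close>

lemma ddir_has_derivative:
  assumes "(f has_derivative f') (at p)"
  shows "ddir v f p = f' v"
proof -
  have "((\<lambda>s::real. p + s *\<^sub>R v) has_derivative (\<lambda>s. s *\<^sub>R v)) (at 0)"
    by (auto intro!: derivative_eq_intros)
  then have "((\<lambda>s. f (p + s *\<^sub>R v)) has_derivative (\<lambda>s. f' (s *\<^sub>R v))) (at 0)"
    by (rule has_derivative_compose) (use assms in simp)
  then have "((\<lambda>s. f (p + s *\<^sub>R v)) has_vector_derivative f' v) (at 0)"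
    using linear_scale[OF has_derivative_linear[OF assms]] by (simp add: has_vector_derivative_def)
  then show ?thesis
    unfolding ddir_def by (rule vector_derivative_at)
qed

lemma ddir_frechet: "f differentiable (at p) \<Longrightarrow> ddir v f p = frechet_derivative f (at p) v"
  by (simp add: ddir_has_derivative frechet_derivative_works)

lemma has_derivative_ddir: "f differentiable (at p) \<Longrightarrow> (f has_derivative (\<lambda>v. ddir v f p)) (at p)"
  by (simp add: ddir_frechet frechet_derivative_works eta_contract_eq)

lemma has_vector_derivative_ddir:
  assumes "f differentiable (at (p + s *\<^sub>R v))"
  shows "((\<lambda>s. f (p + s *\<^sub>R v)) has_vector_derivative ddir v f (p + s *\<^sub>R v)) (at s)"
proof -
  have "((\<lambda>s::real. p + s *\<^sub>R v) has_derivative (\<lambda>s. s *\<^sub>R v)) (at s)"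
    by (auto intro!: derivative_eq_intros)
  then have "((\<lambda>s. f (p + s *\<^sub>R v)) has_derivative (\<lambda>t. ddir (t *\<^sub>R v) f (p + s *\<^sub>R v))) (at s)"
    by (rule has_derivative_compose) (rule has_derivative_ddir[OF assms])
  then show ?thesis
    using linear_scale[OF has_derivative_linear[OF has_derivative_ddir[OF assms]]]
    by (simp add: has_vector_derivative_def)
qed

text \<open>This recursion strips off the derivative applied first, while \<open>iter_ddir\<close>
  strips off the one applied last. In this form the sum, product and chain rules can rewrite
  \<open>ddir v f\<close> before the induction hypothesis is used.\<close>

primrec diff_times :: "nat \<Rightarrow> ('a::real_normed_vector \<Rightarrow> 'b::real_normed_vector) \<Rightarrow> bool" where
  "diff_times 0 f \<longleftrightarrow> (\<forall>p. f differentiable (at p))"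
| "diff_times (Suc k) f \<longleftrightarrow> (\<forall>p. f differentiable (at p)) \<and> (\<forall>v. diff_times k (ddir v f))"

lemma iter_ddir_append: "iter_ddir (vs @ ws) f = iter_ddir vs (iter_ddir ws f)"
  by (induction vs) auto

lemma smooth_ddir: "smooth f \<Longrightarrow> smooth (ddir v f)"
  unfolding smooth_def by (metis iter_ddir_append iter_ddir.simps)

lemma smooth_differentiable: "smooth f \<Longrightarrow> f differentiable (at p)"
  unfolding smooth_def differentiable_on_def by (metis UNIV_I iter_ddir.simps(1))

lemma smooth_diff_times: "smooth f \<Longrightarrow> diff_times k f"
  by (induction k arbitrary: f) (auto simp: smooth_differentiable smooth_ddir)

lemma diff_times_iter_ddir:
  "diff_times (length vs) f \<Longrightarrow> iter_ddir vs f differentiable (at p)"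
proof (induction vs arbitrary: f rule: rev_induct)
  case (snoc v vs)
  then show ?case by (simp add: iter_ddir_append)
qed simp

lemma smooth_iff: "smooth f \<longleftrightarrow> (\<forall>k. diff_times k f)"
proof
  assume "\<forall>k. diff_times k f"
  then show "smooth f"
    unfolding smooth_def differentiable_on_def using diff_times_iter_ddir by auto
qed (simp add: smooth_diff_times)

lemma diff_times_mono: "diff_times (Suc k) f \<Longrightarrow> diff_times k f"
  by (induction k arbitrary: f) auto

lemma ddir_const: "ddir v (\<lambda>p. c) = (\<lambda>p. 0)"
  by (rule ext, rule ddir_has_derivative) simp

lemma ddir_add:
  assumes "f differentiable (at p)" "g differentiable (at p)"
  shows "ddir v (\<lambda>p. f p + g p) p = ddir v f p + ddir v g p"
  by (rule ddir_has_derivative)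
     (auto intro!: derivative_eq_intros has_derivative_ddir assms)

lemma ddir_mult:
  fixes f g :: "'a::real_normed_vector \<Rightarrow> 'b::real_normed_algebra"
  assumes "f differentiable (at p)" "g differentiable (at p)"
  shows "ddir v (\<lambda>p. f p * g p) p = f p * ddir v g p + ddir v f p * g p"
  by (rule ddir_has_derivative)
     (auto intro!: derivative_eq_intros has_derivative_ddir assms)

lemma ddir_linear:
  assumes "f differentiable (at p)" "bounded_linear L"
  shows "ddir v (\<lambda>p. L (f p)) p = L (ddir v f p)"
  by (rule ddir_has_derivative)
     (rule bounded_linear.has_derivative[OF assms(2) has_derivative_ddir[OF assms(1)]])

lemma ddir_compose_real:
  fixes f :: "'a::real_normed_vector \<Rightarrow> real"
  assumes "f differentiable (at p)" "(\<phi> has_real_derivative d) (at (f p))"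
  shows "ddir v (\<lambda>p. \<phi> (f p)) p = d * ddir v f p"
  by (rule ddir_has_derivative)
     (rule DERIV_compose_FDERIV[OF assms(2) has_derivative_ddir[OF assms(1)], THEN has_derivative_eq_rhs], simp add: mult.commute)

lemma diff_times_const: "diff_times k (\<lambda>p. c)"
  by (induction k arbitrary: c) (simp_all add: ddir_const)

lemma diff_times_add:
  "diff_times k f \<Longrightarrow> diff_times k g \<Longrightarrow> diff_times k (\<lambda>p. f p + g p)"
proof (induction k arbitrary: f g)
  case (Suc k)
  then have "ddir v (\<lambda>p. f p + g p) = (\<lambda>p. ddir v f p + ddir v g p)" for v
    by (auto intro!: ext ddir_add)
  with Suc show ?case by auto
qed simp

lemma diff_times_mult:
  fixes f g :: "'a::real_normed_vector \<Rightarrow> 'b::real_normed_algebra"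
  shows "diff_times k f \<Longrightarrow> diff_times k g \<Longrightarrow> diff_times k (\<lambda>p. f p * g p)"
proof (induction k arbitrary: f g)
  case (Suc k)
  then have "ddir v (\<lambda>p. f p * g p) = (\<lambda>p. f p * ddir v g p + ddir v f p * g p)" for v
    by (auto intro!: ext ddir_mult)
  \<comment> \<open>The product rule leaves one factor undifferentiated, so both factors are also
    needed at the lower order.\<close>
  moreover have "diff_times k f" "diff_times k g"
    using Suc.prems by (auto intro: diff_times_mono simp del: diff_times.simps)
  ultimately show ?case
    using Suc by (auto intro!: diff_times_add Suc.IH)
qed simp

lemma differentiable_linear:
  "bounded_linear L \<Longrightarrow> f differentiable (at p) \<Longrightarrow> (\<lambda>p. L (f p)) differentiable (at p)"
  unfolding differentiable_def using bounded_linear.has_derivative by blast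

lemma diff_times_linear:
  assumes "bounded_linear L"
  shows "diff_times k f \<Longrightarrow> diff_times k (\<lambda>p. L (f p))"
proof (induction k arbitrary: f)
  case 0
  then show ?case using differentiable_linear[OF assms] by auto
next
  case (Suc k)
  then have "ddir v (\<lambda>p. L (f p)) = (\<lambda>p. L (ddir v f p))" for v
    by (auto intro!: ext ddir_linear assms)
  with Suc show ?case using differentiable_linear[OF assms, of f] by simp
qed

lemma smooth_const: "smooth (\<lambda>p. c)"
  and smooth_add: "smooth f \<Longrightarrow> smooth g \<Longrightarrow> smooth (\<lambda>p. f p + g p)"
  by (simp_all add: smooth_iff diff_times_const diff_times_add)

lemma smooth_mult:
  fixes f g :: "'a::real_normed_vector \<Rightarrow> 'b::real_normed_algebra"
  shows "smooth f \<Longrightarrow> smooth g \<Longrightarrow> smooth (\<lambda>p. f p * g p)"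
  by (simp add: smooth_iff diff_times_mult)

lemma smooth_linear: "bounded_linear L \<Longrightarrow> smooth f \<Longrightarrow> smooth (\<lambda>p. L (f p))"
  by (simp add: smooth_iff diff_times_linear)

lemma ddir_bounded_linear: "bounded_linear L \<Longrightarrow> ddir v L = (\<lambda>p. L v)"
  by (rule ext, rule ddir_has_derivative) (rule bounded_linear_imp_has_derivative)

lemma smooth_bounded_linear:
  assumes "bounded_linear L"
  shows "smooth L"
  unfolding smooth_iff
proof
  fix k show "diff_times k L"
    using bounded_linear_imp_differentiable[OF assms]
    by (cases k) (auto simp: ddir_bounded_linear[OF assms] diff_times_const)
qed

text \<open>The derivative is the function itself times a smooth factor, so each order of
  differentiability gives the next.\<close>

lemma smooth_exp:
  fixes f :: "'a::real_normed_vector \<Rightarrow> real"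
  assumes "smooth f"
  shows "smooth (\<lambda>p. exp (f p))"
proof -
  have "ddir v (\<lambda>p. exp (f p)) = (\<lambda>p. exp (f p) * ddir v f p)" for v
    by (rule ext, rule ddir_compose_real) (auto intro: DERIV_exp smooth_differentiable assms)
  moreover have "(\<lambda>p. exp (f p)) differentiable (at p)" for p
    using DERIV_compose_FDERIV[OF DERIV_exp has_derivative_ddir[OF smooth_differentiable[OF assms]]]
    unfolding differentiable_def by blast
  ultimately have "diff_times k (\<lambda>p. exp (f p))" for k
    by (induction k) (simp_all add: diff_times_mult smooth_diff_times smooth_ddir assms)
  then show ?thesis by (simp add: smooth_iff)
qed

lemma smooth_inverse:
  fixes f :: "'a::real_normed_vector \<Rightarrow> real"
  assumes "smooth f" "\<And>p. f p > 0"
  shows "smooth (\<lambda>p. inverse (f p))"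
proof -
  have D: "(inverse has_real_derivative - (inverse (f p) * inverse (f p))) (at (f p))" for p
    using DERIV_inverse[of "f p" UNIV] assms(2)[of p] by (simp add: power2_eq_square)
  have "ddir v (\<lambda>p. inverse (f p)) = (\<lambda>p. inverse (f p) * inverse (f p) * (- 1 * ddir v f p))" for v
    by (rule ext) (subst ddir_compose_real[OF smooth_differentiable[OF assms(1)] D], simp)
  moreover have "(\<lambda>p. inverse (f p)) differentiable (at p)" for p
    using DERIV_compose_FDERIV[OF D has_derivative_ddir[OF smooth_differentiable[OF assms(1)]]]
    unfolding differentiable_def by blast
  ultimately have "diff_times k (\<lambda>p. inverse (f p))" for k
    by (induction k) (simp_all add: diff_times_mult diff_times_const smooth_diff_times smooth_ddir assms
        diff_times_linear[OF bounded_linear_minus[OF bounded_linear_ident]])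
  then show ?thesis by (simp add: smooth_iff)
qed

lemma smooth_ln:
  fixes f :: "'a::real_normed_vector \<Rightarrow> real"
  assumes "smooth f" "\<And>p. f p > 0"
  shows "smooth (\<lambda>p. ln (f p))"
proof -
  have D: "(ln has_real_derivative inverse (f p)) (at (f p))" for p
    using DERIV_ln[of "f p"] assms(2)[of p] by (simp add: inverse_eq_divide)
  have "ddir v (\<lambda>p. ln (f p)) = (\<lambda>p. inverse (f p) * ddir v f p)" for v
    by (rule ext) (subst ddir_compose_real[OF smooth_differentiable[OF assms(1)] D], simp)
  then have "smooth (ddir v (\<lambda>p. ln (f p)))" for v
    by (simp add: smooth_mult smooth_inverse smooth_ddir assms)
  moreover have "(\<lambda>p. ln (f p)) differentiable (at p)" for p
    using DERIV_compose_FDERIV[OF D has_derivative_ddir[OF smooth_differentiable[OF assms(1)]]]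
    unfolding differentiable_def by blast
  ultimately have "diff_times k (\<lambda>p. ln (f p))" for k
    by (cases k) (auto simp: smooth_iff)
  then show ?thesis by (simp add: smooth_iff)
qed

lemma smooth_continuous: "smooth f \<Longrightarrow> isCont f p"
  by (simp add: differentiable_imp_continuous_within smooth_differentiable)

lemma ddir_mvt:
  fixes f :: "'a::real_normed_vector \<Rightarrow> real"
  assumes "smooth f" "h > 0"
  obtains \<theta> where "0 < \<theta>" "\<theta> < h" "f (p + h *\<^sub>R v) - f p = h * ddir v f (p + \<theta> *\<^sub>R v)"
proof -
  have "((\<lambda>s. f (p + s *\<^sub>R v)) has_real_derivative ddir v f (p + s *\<^sub>R v)) (at s)" for s
    using has_vector_derivative_ddir[OF smooth_differentiable[OF assms(1)]]
    by (simp add: has_real_derivative_iff_has_vector_derivative)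
  from MVT2[OF assms(2) this] that show ?thesis by auto
qed

lemma ddir_shift: "ddir v (\<lambda>q. f (q + c)) p = ddir v f (p + c)"
  unfolding ddir_def by (simp add: algebra_simps)

lemma iter_ddir_shift: "iter_ddir vs (\<lambda>q. f (q + c)) = (\<lambda>q. iter_ddir vs f (q + c))"
  by (induction vs) (auto simp: ddir_shift)

lemma smooth_shift:
  fixes f :: "'a::real_normed_vector \<Rightarrow> 'b::real_normed_vector"
  assumes "smooth f" shows "smooth (\<lambda>q. f (q + c))"
  unfolding smooth_def differentiable_on_def
proof (intro allI ballI)
  fix vs and p :: 'a
  have "iter_ddir vs f differentiable (at (p + c))"
    using assms by (simp add: smooth_def differentiable_on_def)
  moreover have "(\<lambda>q. q + c) differentiable (at p)"
    by (intro differentiable_add differentiable_ident differentiable_const)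
  ultimately show "iter_ddir vs (\<lambda>q. f (q + c)) differentiable (at p)"
    unfolding iter_ddir_shift using differentiable_chain_at[of "\<lambda>q. q + c" p "iter_ddir vs f"]
    by (simp add: o_def)
qed

text \<open>The mean value theorem is used twice: along v for the increment in direction w, then
  along w for the derivative along v.\<close>

lemma ddir_second_difference:
  fixes f :: "'a::real_normed_vector \<Rightarrow> real"
  assumes "smooth f" "h > 0"
  obtains \<theta> \<eta> where "0 < \<theta>" "\<theta> < h" "0 < \<eta>" "\<eta> < h"
    "f (p + h *\<^sub>R v + h *\<^sub>R w) - f (p + h *\<^sub>R v) - f (p + h *\<^sub>R w) + f p
      = h\<^sup>2 * ddir w (ddir v f) (p + \<theta> *\<^sub>R v + \<eta> *\<^sub>R w)"
proof -
  define g where "g q = f (q + h *\<^sub>R w) + (-1) * f q" for q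
  have g: "smooth g"
    unfolding g_def by (intro smooth_add smooth_mult smooth_const smooth_shift assms)
  have dg: "ddir v g q = ddir v f (q + h *\<^sub>R w) - ddir v f q" for q
  proof -
    have "ddir v g q = ddir v (\<lambda>q. f (q + h *\<^sub>R w)) q + ddir v (\<lambda>q. (-1) * f q) q"
      unfolding g_def
      by (intro ddir_add smooth_differentiable smooth_mult smooth_const smooth_shift assms)
    also have "ddir v (\<lambda>q. (-1) * f q) q = - ddir v f q"
      by (subst ddir_mult) (auto intro: smooth_differentiable assms smooth_const simp: ddir_const)
    finally show ?thesis by (simp add: ddir_shift)
  qed
  obtain \<theta> where \<theta>: "0 < \<theta>" "\<theta> < h" "g (p + h *\<^sub>R v) - g p = h * ddir v g (p + \<theta> *\<^sub>R v)"
    using ddir_mvt[OF g assms(2)] .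
  obtain \<eta> where \<eta>: "0 < \<eta>" "\<eta> < h" "ddir v f (p + \<theta> *\<^sub>R v + h *\<^sub>R w) - ddir v f (p + \<theta> *\<^sub>R v)
      = h * ddir w (ddir v f) (p + \<theta> *\<^sub>R v + \<eta> *\<^sub>R w)"
    using ddir_mvt[OF smooth_ddir[OF assms(1)] assms(2)] .
  show ?thesis
    by (rule that[OF \<theta>(1,2) \<eta>(1,2)]) (use \<theta>(3) \<eta>(3) in \<open>simp add: dg g_def power2_eq_square\<close>)
qed

text \<open>The second difference is symmetric in v and w; divided by the square of the step it
  tends to either mixed derivative, because both are continuous.\<close>

lemma ddir_commute_real:
  fixes f :: "'a::real_normed_vector \<Rightarrow> real"
  assumes "smooth f"
  shows "ddir v (ddir w f) p = ddir w (ddir v f) p"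
proof -
  define h where "h k = inverse (real (Suc k))" for k
  have h0: "h k > 0" for k by (simp add: h_def)
  have h: "h \<longlonglongrightarrow> 0" unfolding h_def by (rule LIMSEQ_inverse_real_of_nat)
  have lim: "\<exists>X. (\<forall>k. f (p + h k *\<^sub>R v + h k *\<^sub>R w) - f (p + h k *\<^sub>R v) - f (p + h k *\<^sub>R w) + f p
      = (h k)\<^sup>2 * X k) \<and> X \<longlonglongrightarrow> ddir w (ddir v f) p" for v w
  proof -
    have "\<exists>\<theta> \<eta>. 0 < \<theta> \<and> \<theta> < h k \<and> 0 < \<eta> \<and> \<eta> < h k \<and>
      f (p + h k *\<^sub>R v + h k *\<^sub>R w) - f (p + h k *\<^sub>R v) - f (p + h k *\<^sub>R w) + f p
      = (h k)\<^sup>2 * ddir w (ddir v f) (p + \<theta> *\<^sub>R v + \<eta> *\<^sub>R w)" for k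
      using ddir_second_difference[OF assms h0] by metis
    then obtain \<theta> \<eta> where *: "\<And>k. 0 < \<theta> k" "\<And>k. \<theta> k < h k" "\<And>k. 0 < \<eta> k" "\<And>k. \<eta> k < h k"
      "\<And>k. f (p + h k *\<^sub>R v + h k *\<^sub>R w) - f (p + h k *\<^sub>R v) - f (p + h k *\<^sub>R w) + f p
      = (h k)\<^sup>2 * ddir w (ddir v f) (p + \<theta> k *\<^sub>R v + \<eta> k *\<^sub>R w)"
      by metis
    have t0: "\<theta> \<longlonglongrightarrow> 0" "\<eta> \<longlonglongrightarrow> 0"
      by (rule tendsto_sandwich[OF _ _ tendsto_const h], use * in \<open>auto intro!: always_eventually less_imp_le\<close>)+
    have "(\<lambda>k. p + \<theta> k *\<^sub>R v + \<eta> k *\<^sub>R w) \<longlonglongrightarrow> p"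
      by (rule tendsto_eq_intros t0 refl | simp)+
    then have "(\<lambda>k. ddir w (ddir v f) (p + \<theta> k *\<^sub>R v + \<eta> k *\<^sub>R w)) \<longlonglongrightarrow> ddir w (ddir v f) p"
      by (rule isCont_tendsto_compose[OF smooth_continuous[OF smooth_ddir[OF smooth_ddir[OF assms]]]])
    with *(5) show ?thesis
      by (intro exI[of _ "\<lambda>k. ddir w (ddir v f) (p + \<theta> k *\<^sub>R v + \<eta> k *\<^sub>R w)"]) simp
  qed
  obtain X where X: "\<And>k. f (p + h k *\<^sub>R v + h k *\<^sub>R w) - f (p + h k *\<^sub>R v) - f (p + h k *\<^sub>R w) + f p
      = (h k)\<^sup>2 * X k" "X \<longlonglongrightarrow> ddir w (ddir v f) p" using lim by blast
  obtain Y where Y: "\<And>k. f (p + h k *\<^sub>R w + h k *\<^sub>R v) - f (p + h k *\<^sub>R w) - f (p + h k *\<^sub>R v) + f p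
      = (h k)\<^sup>2 * Y k" "Y \<longlonglongrightarrow> ddir v (ddir w f) p" using lim by blast
  have "(h k)\<^sup>2 * X k = (h k)\<^sup>2 * Y k" for k
    using X(1)[of k] Y(1)[of k] by (simp add: algebra_simps)
  then have "X = Y" using h0 by (metis mult_cancel_left ext less_numeral_extra(3) zero_less_power)
  with X Y show ?thesis using LIMSEQ_unique by blast
qed

lemma ddir_commute:
  fixes f :: "'a::real_normed_vector \<Rightarrow> complex"
  assumes "smooth f"
  shows "ddir v (ddir w f) = ddir w (ddir v f)"
proof
  fix p
  have 1: "ddir v (ddir w (\<lambda>q. L (f q))) p = L (ddir v (ddir w f) p)" if "bounded_linear L" for L :: "complex \<Rightarrow> real" and v w
  proof -
    have "ddir w (\<lambda>q. L (f q)) = (\<lambda>q. L (ddir w f q))"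
      by (auto intro!: ext ddir_linear smooth_differentiable assms that)
    then show ?thesis
      by (simp add: ddir_linear smooth_differentiable smooth_ddir assms that)
  qed
  have "L (ddir v (ddir w f) p) = L (ddir w (ddir v f) p)" if "bounded_linear L" for L :: "complex \<Rightarrow> real"
    using 1[OF that] ddir_commute_real[OF smooth_linear[OF that assms], of v w p] by simp
  from this[OF bounded_linear_Re] this[OF bounded_linear_Im]
  show "ddir v (ddir w f) p = ddir w (ddir v f) p" by (simp add: complex_eq_iff)
qed

section \<open>The ring of smooth functions on the Heisenberg group\<close>

text \<open>With smoothness built into the type, derivations need no differentiability side
  conditions and long identities are left to ring normalisation.\<close>

typedef (overloaded) ('n::finite) smf = "{f :: 'n heis \<Rightarrow> complex. smooth f}"
  morphisms ev Smf
  by (rule exI[of _ "\<lambda>p. 0"]) (simp add: smooth_const)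

setup_lifting type_definition_smf

lemma smooth_ev: "smooth (ev F)"
  using ev by simp

lemma smf_eqI: "(\<And>p. ev F p = ev G p) \<Longrightarrow> F = G"
  by (simp add: ev_inject[symmetric] ext)

lemma smooth_minus: "smooth f \<Longrightarrow> smooth (\<lambda>p. - f p)"
  by (rule smooth_linear[OF bounded_linear_minus[OF bounded_linear_ident]])

lemma smooth_diff: "smooth f \<Longrightarrow> smooth g \<Longrightarrow> smooth (\<lambda>p. f p - g p)"
  using smooth_add[of f "\<lambda>p. - g p"] by (simp add: smooth_minus)

instantiation smf :: (finite) comm_ring_1
begin
lift_definition zero_smf :: "'a smf" is "\<lambda>p. 0" by (rule smooth_const)
lift_definition one_smf :: "'a smf" is "\<lambda>p. 1" by (rule smooth_const)
lift_definition plus_smf :: "'a smf \<Rightarrow> 'a smf \<Rightarrow> 'a smf" is "\<lambda>f g p. f p + g p" by (rule smooth_add)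
lift_definition minus_smf :: "'a smf \<Rightarrow> 'a smf \<Rightarrow> 'a smf" is "\<lambda>f g p. f p - g p" by (rule smooth_diff)
lift_definition uminus_smf :: "'a smf \<Rightarrow> 'a smf" is "\<lambda>f p. - f p" by (rule smooth_minus)
lift_definition times_smf :: "'a smf \<Rightarrow> 'a smf \<Rightarrow> 'a smf" is "\<lambda>f g p. f p * g p" by (rule smooth_mult)
instance
  by standard (transfer; simp add: fun_eq_iff algebra_simps)+
end

lift_definition cc :: "complex \<Rightarrow> 'n::finite smf" is "\<lambda>c p. c" by (rule smooth_const)
lift_definition cj :: "'n::finite smf \<Rightarrow> 'n smf" is "\<lambda>f p. cnj (f p)"
  by (rule smooth_linear[OF bounded_linear_cnj])
lift_definition dd :: "'n::finite heis \<Rightarrow> 'n smf \<Rightarrow> 'n smf" is ddir by (rule smooth_ddir)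

lemma bounded_linear_zz: "bounded_linear (\<lambda>p::'n::finite heis. fst p $ a)"
  using bounded_linear_compose[OF bounded_linear_vec_nth bounded_linear_fst] .

lemma bounded_linear_tt: "bounded_linear (\<lambda>p::'n::finite heis. complex_of_real (snd p))"
  using bounded_linear_compose[OF bounded_linear_of_real bounded_linear_snd] .

lift_definition zz :: "'n::finite \<Rightarrow> 'n smf" is "\<lambda>a p. fst p $ a"
  by (rule smooth_bounded_linear[OF bounded_linear_zz])
lift_definition tt :: "'n::finite smf" is "\<lambda>p. complex_of_real (snd p)"
  by (rule smooth_bounded_linear[OF bounded_linear_tt])

lemma ev_simps [simp]:
  "ev 0 p = 0" "ev 1 p = 1" "ev (F + G) p = ev F p + ev G p" "ev (F - G) p = ev F p - ev G p"
  "ev (- F) p = - ev F p" "ev (F * G) p = ev F p * ev G p" "ev (cc c) p = c"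
  "ev (cj F) p = cnj (ev F p)" "ev (zz a) p = fst p $ a" "ev tt p = complex_of_real (snd p)"
  by (transfer; simp)+

lemma ev_dd: "ev (dd v F) = ddir v (ev F)"
  by transfer simp

lemma ev_power [simp]: "ev (F ^ k) p = ev F p ^ k"
  by (induction k) auto

lemma ev_of_nat [simp]: "ev (of_nat k) p = of_nat k"
  by (induction k) auto

lemma ev_numeral [simp]: "ev (numeral k) p = numeral k"
  by (metis ev_of_nat of_nat_numeral)

lemma ev_sum [simp]: "ev (\<Sum>a\<in>A. F a) p = (\<Sum>a\<in>A. ev (F a) p)"
  by (induction A rule: infinite_finite_induct) auto

lemma cj_simps [simp]:
  "cj 0 = 0" "cj 1 = 1" "cj (F + G) = cj F + cj G" "cj (F - G) = cj F - cj G" "cj (- F) = - cj F"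
  "cj (F * G) = cj F * cj G" "cj (cc c) = cc (cnj c)" "cj (cj F) = F" "cj tt = tt"
  "cj (F ^ k) = cj F ^ k" "cj (of_nat k) = of_nat k" "cj (numeral l) = numeral l"
  by (rule smf_eqI, simp)+

lemma cj_sum [simp]: "cj (\<Sum>a\<in>A. F a) = (\<Sum>a\<in>A. cj (F a))"
  by (rule smf_eqI) simp

lemma dd_add: "dd v (F + G) = dd v F + dd v G"
  by (rule smf_eqI) (simp add: ev_dd plus_smf.rep_eq ddir_add smooth_differentiable smooth_ev)

lemma dd_mult: "dd v (F * G) = F * dd v G + dd v F * G"
  by (rule smf_eqI) (simp add: ev_dd times_smf.rep_eq ddir_mult smooth_differentiable smooth_ev)

lemma dd_cc [simp]: "dd v (cc c) = 0"
  by (rule smf_eqI) (simp add: ev_dd cc.rep_eq ddir_const)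

lemma dd_cj: "dd v (cj F) = cj (dd v F)"
  by (rule smf_eqI)
    (simp add: ev_dd cj.rep_eq ddir_linear[OF _ bounded_linear_cnj] smooth_differentiable smooth_ev)

lemma dd_commute: "dd v (dd w F) = dd w (dd v F)"
  by (rule smf_eqI) (simp add: ev_dd ddir_commute smooth_ev)

lemma dd_zz [simp]: "dd v (zz a) = cc (fst v $ a)"
  by (rule smf_eqI) (simp add: ev_dd zz.rep_eq ddir_bounded_linear[OF bounded_linear_zz])

lemma dd_tt [simp]: "dd v tt = cc (complex_of_real (snd v))"
  by (rule smf_eqI) (simp add: ev_dd tt.rep_eq ddir_bounded_linear[OF bounded_linear_tt])

section \<open>Left-invariant vector fields and their commutators\<close>

definition dT :: "'n::finite smf \<Rightarrow> 'n smf" where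
  "dT F = dd (0, 1) F"

definition dZ :: "'n::finite \<Rightarrow> 'n smf \<Rightarrow> 'n smf" where
  "dZ a F = cc (1/2) * dd (axis a 1, 0) F - cc (\<i>/2) * dd (axis a \<i>, 0) F + cc \<i> * cj (zz a) * dd (0, 1) F"

definition dZbar :: "'n::finite \<Rightarrow> 'n smf \<Rightarrow> 'n smf" where
  "dZbar a F = cc (1/2) * dd (axis a 1, 0) F + cc (\<i>/2) * dd (axis a \<i>, 0) F - cc \<i> * zz a * dd (0, 1) F"

lemma ev_dZ: "ev (dZ a F) = Zop a (ev F)"
  by (rule ext) (simp add: dZ_def Zop_def dz_def dx_def dy_def dt_def ev_dd field_simps)

lemma ev_dZbar: "ev (dZbar a F) = Zbarop a (ev F)"
  by (rule ext) (simp add: dZbar_def Zbarop_def dzbar_def dx_def dy_def dt_def ev_dd field_simps)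

lemma dd_minus: "dd v (- F) = - dd v F"
  using dd_mult[of v "cc (-1)" F] by (metis (no_types, lifting) dd_cc ev_simps(5,6,7) mult_minus1 mult_zero_left add_0_right smf_eqI)

lemma dd_diff: "dd v (F - G) = dd v F - dd v G"
  using dd_add[of v F "- G"] by (simp add: dd_minus)

lemmas D_defs = dT_def dZ_def dZbar_def

lemma D_add: "dT (F + G) = dT F + dT G" "dZ a (F + G) = dZ a F + dZ a G" "dZbar a (F + G) = dZbar a F + dZbar a G"
  by (simp_all add: D_defs dd_add algebra_simps)

lemma D_minus: "dT (- F) = - dT F" "dZ a (- F) = - dZ a F" "dZbar a (- F) = - dZbar a F"
  by (simp_all add: D_defs dd_minus algebra_simps)

lemma D_diff: "dT (F - G) = dT F - dT G" "dZ a (F - G) = dZ a F - dZ a G" "dZbar a (F - G) = dZbar a F - dZbar a G"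
  by (simp_all add: D_defs dd_diff algebra_simps)

lemma D_mult: "dT (F * G) = F * dT G + dT F * G" "dZ a (F * G) = F * dZ a G + dZ a F * G"
  "dZbar a (F * G) = F * dZbar a G + dZbar a F * G"
  by (simp_all add: D_defs dd_mult algebra_simps)

lemma D_cc [simp]: "dT (cc c) = 0" "dZ a (cc c) = 0" "dZbar a (cc c) = 0"
  by (simp_all add: D_defs)

lemma cc_of_nat: "cc (of_nat k) = of_nat k" "cc (numeral l) = numeral l" "cc 1 = 1" "cc 0 = 0"
  by (rule smf_eqI, simp)+

lemma D_of_nat [simp]: "dT (of_nat k) = 0" "dZ a (of_nat k) = 0" "dZbar a (of_nat k) = 0"
  "dT (numeral l) = 0" "dZ a (numeral l) = 0" "dZbar a (numeral l) = 0"
  "dT 1 = 0" "dZ a 1 = 0" "dZbar a 1 = 0" "dT 0 = 0" "dZ a 0 = 0" "dZbar a 0 = 0"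
  by (simp_all flip: cc_of_nat)

lemma D_sum: "dT (\<Sum>b\<in>A. F b) = (\<Sum>b\<in>A. dT (F b))" "dZ a (\<Sum>b\<in>A. F b) = (\<Sum>b\<in>A. dZ a (F b))"
  "dZbar a (\<Sum>b\<in>A. F b) = (\<Sum>b\<in>A. dZbar a (F b))"
  by (induction A rule: infinite_finite_induct; simp add: D_add)+

lemma cj_D: "cj (dT F) = dT (cj F)" "cj (dZ a F) = dZbar a (cj F)" "cj (dZbar a F) = dZ a (cj F)"
  by (rule smf_eqI, simp add: D_defs dd_cj)+

text \<open>The coefficients of Z and Zbar depend on z alone.\<close>

lemma dT_dZ: "dT (dZ a F) = dZ a (dT F)"
  and dT_dZbar: "dT (dZbar a F) = dZbar a (dT F)"
  by (simp_all add: D_defs dd_mult dd_add dd_diff dd_cj dd_commute cc_of_nat)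

lemma axis_component: "axis a x $ b = (if a = b then x else 0)"
  by (simp add: axis_def)

lemma dZ_zz: "dZ a (zz b) = (if a = b then 1 else 0)" and dZbar_zz: "dZbar a (zz b) = 0"
  and dZ_tt: "dZ a tt = cc \<i> * cj (zz a)" and dZbar_tt: "dZbar a tt = - (cc \<i> * zz a)"
  and dT_zz: "dT (zz a) = 0" and dT_tt: "dT tt = 1"
  by (rule smf_eqI, simp add: D_defs axis_component)+

text \<open>The coefficients of the t-derivative in Z and Zbar are each differentiated once, and
  each contributes -i T on the diagonal. No other pair among T, Z, Zbar fails to commute.\<close>

lemma dZ_dZbar: "dZ a (dZbar b F) = dZbar b (dZ a F) - (if a = b then 2 * cc \<i> * dT F else 0)"
  and dZ_dZ: "dZ a (dZ b F) = dZ b (dZ a F)"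
  by (rule smf_eqI; simp add: dd_mult dd_add dd_diff dd_cj dd_commute axis_component D_defs;
      simp add: algebra_simps add_divide_distrib diff_divide_distrib)+

lemma dZbar_dZbar: "dZbar a (dZbar b F) = dZbar b (dZbar a F)"
  using arg_cong[OF dZ_dZ[of a b "cj F"], of cj] by (simp add: cj_D)

section \<open>The Jerison--Lee divergence identity\<close>

text \<open>Using $i\partial_t$ as the basic operator keeps the imaginary unit out of the commutation relation
  and of every identity below.\<close>

definition dJ :: "'n::finite smf \<Rightarrow> 'n smf" where
  "dJ F = cc \<i> * dT F"

lemma dJ_simps: "dJ (F + G) = dJ F + dJ G" "dJ (F - G) = dJ F - dJ G" "dJ (- F) = - dJ F"
  "dJ (F * G) = F * dJ G + dJ F * G" "dJ (\<Sum>b\<in>A. H b) = (\<Sum>b\<in>A. dJ (H b))" "dJ (of_nat k) = 0"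
  "dJ (dZ a F) = dZ a (dJ F)" "dJ (dZbar a F) = dZbar a (dJ F)"
  by (simp_all add: dJ_def D_add D_diff D_minus D_mult D_sum dT_dZ dT_dZbar sum_distrib_left algebra_simps)

lemma cj_dJ: "cj (dJ F) = - dJ (cj F)"
  by (rule smf_eqI) (simp add: dJ_def cj_D)

lemma dZ_dZbar_J: "dZ a (dZbar b F) = dZbar b (dZ a F) - (if a = b then 2 * dJ F else 0)"
  by (simp add: dZ_dZbar dJ_def mult.assoc)

text \<open>Here $f = \frac{1}{n}\log u$, while $Y$ and $w$ stand for $e^{2f}$ and $e^{2(n-1)f}$; the last assumption is the
  equation for $u$ rewritten in terms of $f$.\<close>

locale jerison_lee =
  fixes f Y w :: "'n::finite smf"
  assumes cj_f: "cj f = f" and cj_Y: "cj Y = Y" and dZ_Y: "dZ a Y = 2 * Y * dZ a f"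
    and dT_Y: "dT Y = 2 * Y * dT f"
    and cj_w: "cj w = w" and dZ_w: "dZ a w = 2 * (of_nat CARD('n) - 1) * w * dZ a f"
    and yamabe: "(\<Sum>a\<in>UNIV. dZbar a (dZ a f)) =
      - of_nat CARD('n) * ((\<Sum>a\<in>UNIV. dZ a f * dZbar a f) + Y - cc \<i> * dT f)"
begin

definition N :: "'n smf" where "N = of_nat CARD('n)"
definition P where "P a = dZ a f"
definition Q where "Q a = dZbar a f"
definition X where "X = (\<Sum>a\<in>UNIV. P a * Q a)"
definition h where "h = X + Y"
text \<open>In the notation of Jerison and Lee, $t = i f_0$ and $g = |\partial f|^2 + e^{2f} - i f_0$; below, $DM$, $EM$, $GV$ are the
  tensors $D_{\alpha\beta}$, $E_{\alpha\bar\beta}$, $G_\alpha$, and $DV$, $EV$ are their contractions with $\partial f$.\<close>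

definition t where "t = dJ f"
definition g where "g = h - t"
definition DM where "DM a b = dZ a (P b) - 2 * P a * P b"
definition EM where "EM a b = dZbar b (P a) + (if a = b then g else 0)"
definition GV where "GV a = dZ a t + g * P a"
definition DV where "DV a = (\<Sum>b\<in>UNIV. DM a b * Q b)"
definition EV where "EV a = (\<Sum>b\<in>UNIV. EM a b * P b)"

lemma cj_N: "cj N = N" and cj_P: "cj (P a) = Q a" and cj_Q: "cj (Q a) = P a" and cj_t: "cj t = - t"
  by (simp_all add: N_def P_def Q_def t_def cj_D cj_dJ cj_f)

lemma cj_X: "cj X = X"
  by (simp add: X_def cj_P cj_Q mult.commute)

lemma cj_h: "cj h = h"
  by (simp add: h_def cj_X cj_Y)

lemma cj_g: "cj g = h + t"
  by (simp add: g_def cj_h cj_t)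

lemmas cj_rules = cj_N cj_P cj_Q cj_t cj_X cj_h cj_g cj_Y cj_w

lemma dZbar_Y: "dZbar a Y = 2 * Y * Q a"
  using arg_cong[OF dZ_Y[of a], of cj] by (simp add: cj_D cj_rules Q_def cj_f)

lemma dZbar_w: "dZbar a w = 2 * (N - 1) * w * Q a"
  using arg_cong[OF dZ_w[of a], of cj] by (simp add: cj_D cj_rules Q_def cj_f N_def)

lemma dJ_Y: "dJ Y = 2 * Y * t"
  by (simp add: dJ_def t_def dT_Y)

lemma trace: "(\<Sum>a\<in>UNIV. dZbar a (P a)) = - N * g"
  using yamabe by (simp add: P_def Q_def N_def g_def h_def X_def t_def dJ_def)

section \<open>Structure equations: derivatives of P, Q, t, h, g expressed by the tensors\<close>

lemma dZbar_P: "dZbar b (P a) = EM a b - (if a = b then g else 0)"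
  by (simp add: EM_def)

text \<open>Exchanging the derivatives costs 2t on the diagonal and turns g into g + 2t = h + t, its
  conjugate. This is what makes \<open>EM\<close> Hermitian.\<close>

lemma dZ_Q: "dZ b (Q a) = EM b a - (if a = b then h + t else 0)"
  by (auto simp: EM_def Q_def dZ_dZbar_J P_def t_def g_def)

lemma dZ_P: "dZ a (P b) = DM a b + 2 * P a * P b"
  by (simp add: DM_def)

lemma dZbar_Q: "dZbar a (Q b) = cj (DM a b) + 2 * Q a * Q b"
  by (simp add: DM_def cj_D cj_rules)

lemma EM_herm: "cj (EM a b) = EM b a"
proof -
  have "cj (EM a b) = dZ b (Q a) + (if a = b then h + t else 0)"
    by (simp add: EM_def cj_D cj_rules)
  then show ?thesis by (simp add: dZ_Q)
qed

text \<open>This is the equation for u: the diagonal term g in \<open>EM\<close> is exactly what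
  removes the trace.\<close>

lemma sum_EM_diag: "(\<Sum>a\<in>UNIV. EM a a) = 0"
  by (simp add: EM_def sum.distrib trace N_def)

lemma dZ_t: "dZ a t = GV a - g * P a"
  by (simp add: GV_def)

lemma dZbar_t: "dZbar a t = - cj (GV a) + (h + t) * Q a"
  by (simp add: GV_def cj_D cj_rules D_minus)

lemma dJ_P: "dJ (P a) = GV a - g * P a" and dJ_Q: "dJ (Q a) = - cj (GV a) + (h + t) * Q a"
  using dZ_t dZbar_t by (simp_all add: P_def Q_def dJ_simps t_def)

lemma sum_delta: "(\<Sum>b\<in>UNIV. F b * (if a = b then c else 0)) = F (a::'n) * (c :: 'n smf)"
  "(\<Sum>b\<in>UNIV. F b * (if b = a then c else 0)) = F a * c"
  "(\<Sum>b\<in>UNIV. (if a = b then c else 0) * F b) = c * F a"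
  "(\<Sum>b\<in>UNIV. (if b = a then c else 0) * F b) = c * F a"
  by (simp_all add: if_distrib[of "\<lambda>x. _ * x"] if_distrib[of "\<lambda>x. x * _"] cong: if_cong)

lemma dZ_X: "dZ b X = EV b - (h + t) * P b + DV b + 2 * P b * X"
proof -
  have "dZ b X = (\<Sum>c\<in>UNIV. EM b c * P c - P c * (if c = b then h + t else 0) + DM b c * Q c + 2 * P b * (P c * Q c))"
    unfolding X_def D_sum by (rule sum.cong[OF refl]) (simp add: D_mult dZ_Q dZ_P algebra_simps)
  then show ?thesis
    by (simp add: sum.distrib sum_subtractf sum_delta EV_def DV_def X_def sum_distrib_left mult_ac)
qed

lemma dZ_h: "dZ b h = DV b + EV b + g * P b"
  by (simp add: h_def D_add dZ_X dZ_Y flip: P_def) (simp add: h_def g_def algebra_simps)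

lemma dZ_g: "dZ b g = DV b + EV b - GV b + 2 * g * P b"
proof -
  have "dZ b g = dZ b h - dZ b t" by (simp add: g_def D_diff)
  then show ?thesis by (simp add: dZ_h dZ_t algebra_simps)
qed

lemma dZbar_h: "dZbar b h = cj (DV b) + cj (EV b) + (h + t) * Q b"
  using arg_cong[OF dZ_h[of b], of cj] by (simp add: cj_D cj_rules)

text \<open>The multiples of Q in the derivatives of h and t cancel, so g becomes CR holomorphic
  once the tensors vanish.\<close>

lemma dZbar_g: "dZbar b g = cj (DV b) + cj (EV b) + cj (GV b)"
  by (simp add: g_def D_diff dZbar_h dZbar_t)

text \<open>A Bianchi-type identity: after exchanging the indices of the symmetric second derivative
  and commuting, the divergence falls on the trace of the second derivatives, which the equation
  expresses by g.\<close>

lemma sum_dZbar_DM: "(\<Sum>a\<in>UNIV. dZbar a (DM a b)) = - N * DV b - (N + 2) * EV b + (N + 2) * GV b"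
proof -
  have 1: "dZbar a (dZ a (P b)) = dZ b (dZbar a (P a)) + (if a = b then 2 * dJ (P b) else 0)" for a
  proof -
    have "dZ a (P b) = dZ b (P a)" by (simp add: P_def dZ_dZ[of a b])
    then show ?thesis using dZ_dZbar_J[of b a "P a"] by (auto simp: algebra_simps)
  qed
  have "(\<Sum>a\<in>UNIV. dZbar a (DM a b)) = dZ b (\<Sum>a\<in>UNIV. dZbar a (P a)) + 2 * dJ (P b)
     - 2 * (\<Sum>a\<in>UNIV. P a * dZbar a (P b)) - 2 * (\<Sum>a\<in>UNIV. dZbar a (P a)) * P b"
    unfolding D_sum sum_distrib_left sum_distrib_right
    by (simp add: DM_def D_diff D_mult 1 sum.distrib sum_subtractf algebra_simps)
  also have "(\<Sum>a\<in>UNIV. P a * dZbar a (P b)) = EV b - g * P b"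
    by (simp add: dZbar_P right_diff_distrib sum_subtractf sum_delta EV_def mult.commute)
  finally show ?thesis
    unfolding trace by (simp add: D_mult D_minus dZ_g dJ_P N_def) (simp add: algebra_simps)
qed

text \<open>Here the two Zbar derivatives commute, so no T-term appears; the trace gives -N g and
  the diagonal part of \<open>EM\<close> gives back one g.\<close>

lemma sum_dZbar_EM: "(\<Sum>a\<in>UNIV. dZbar a (EM a b)) = - (N - 1) * (cj (DV b) + cj (EV b) + cj (GV b))"
proof -
  have "(\<Sum>a\<in>UNIV. dZbar a (EM a b)) = (\<Sum>a\<in>UNIV. dZbar b (dZbar a (P a)) + (if a = b then dZbar b g else 0))"
    by (rule sum.cong[OF refl]) (simp add: EM_def D_add dZbar_dZbar[of _ b])
  also have "\<dots> = dZbar b (- N * g) + dZbar b g"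
    by (simp add: sum.distrib D_sum trace flip: D_sum)
  finally show ?thesis
    by (simp add: D_mult D_minus N_def dZbar_g algebra_simps)
qed

section \<open>Divergences of the contracted tensors\<close>

definition d where "d = (\<Sum>a\<in>UNIV. DV a * Q a)"
definition e where "e = (\<Sum>a\<in>UNIV. EV a * Q a)"
definition c where "c = (\<Sum>a\<in>UNIV. GV a * Q a)"

lemma cj_e: "cj e = e"
proof -
  have "cj e = (\<Sum>a\<in>UNIV. \<Sum>b\<in>UNIV. EM b a * Q b * P a)"
    by (simp add: e_def EV_def sum_distrib_right cj_rules EM_herm)
  also have "\<dots> = (\<Sum>b\<in>UNIV. \<Sum>a\<in>UNIV. EM b a * Q b * P a)" by (rule sum.swap)
  also have "\<dots> = e"
    unfolding e_def EV_def sum_distrib_right by (intro sum.cong refl) (simp add: mult_ac)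
  finally show ?thesis .
qed

lemma cj_dc: "cj d = (\<Sum>a\<in>UNIV. cj (DV a) * P a)" "cj c = (\<Sum>a\<in>UNIV. cj (GV a) * P a)"
  "e = (\<Sum>a\<in>UNIV. cj (EV a) * P a)"
proof -
  show "cj d = (\<Sum>a\<in>UNIV. cj (DV a) * P a)" "cj c = (\<Sum>a\<in>UNIV. cj (GV a) * P a)"
    unfolding d_def c_def cj_sum cj_simps cj_Q by (rule refl)+
  have "cj e = (\<Sum>a\<in>UNIV. cj (EV a) * P a)" by (simp add: e_def cj_Q)
  then show "e = (\<Sum>a\<in>UNIV. cj (EV a) * P a)" by (simp add: cj_e)
qed

definition DD where "DD = (\<Sum>a\<in>UNIV. \<Sum>b\<in>UNIV. DM a b * cj (DM a b))"
definition EE where "EE = (\<Sum>a\<in>UNIV. \<Sum>b\<in>UNIV. EM a b * cj (EM a b))"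

lemma div_DV: "(\<Sum>a\<in>UNIV. dZbar a (DV a)) = DD - (N - 2) * d - (N + 2) * e + (N + 2) * c"
proof -
  have "(\<Sum>a\<in>UNIV. dZbar a (DV a)) = (\<Sum>a\<in>UNIV. \<Sum>b\<in>UNIV. DM a b * cj (DM a b) + 2 * (DM a b * Q b * Q a)
       + dZbar a (DM a b) * Q b)"
    by (simp add: DV_def D_sum D_mult dZbar_Q algebra_simps)
  also have "\<dots> = DD + 2 * d + (\<Sum>a\<in>UNIV. \<Sum>b\<in>UNIV. dZbar a (DM a b) * Q b)"
    by (simp add: sum.distrib DD_def d_def DV_def sum_distrib_left sum_distrib_right)
  also have "(\<Sum>a\<in>UNIV. \<Sum>b\<in>UNIV. dZbar a (DM a b) * Q b) = (\<Sum>b\<in>UNIV. (\<Sum>a\<in>UNIV. dZbar a (DM a b)) * Q b)"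
    unfolding sum_distrib_right by (rule sum.swap)
  also have "\<dots> = - N * d - (N + 2) * e + (N + 2) * c"
    by (simp add: sum_dZbar_DM d_def e_def c_def sum_distrib_left sum.distrib sum_subtractf sum_negf algebra_simps)
  finally show ?thesis by (simp add: algebra_simps)
qed

lemma div_EV: "(\<Sum>a\<in>UNIV. dZbar a (EV a)) = EE - (N - 1) * (cj d + e + cj c)"
proof -
  have "(\<Sum>a\<in>UNIV. dZbar a (EV a)) = (\<Sum>a\<in>UNIV. \<Sum>b\<in>UNIV. EM a b * cj (EM a b) - EM a b * (if b = a then g else 0)
       + dZbar a (EM a b) * P b)"
    by (simp add: EV_def D_sum D_mult dZbar_P EM_herm algebra_simps)
  also have "\<dots> = EE - (\<Sum>a\<in>UNIV. EM a a) * g + (\<Sum>a\<in>UNIV. \<Sum>b\<in>UNIV. dZbar a (EM a b) * P b)"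
    by (simp add: sum.distrib sum_subtractf EE_def sum_delta sum_distrib_right)
  also have "(\<Sum>a\<in>UNIV. \<Sum>b\<in>UNIV. dZbar a (EM a b) * P b) = (\<Sum>b\<in>UNIV. (\<Sum>a\<in>UNIV. dZbar a (EM a b)) * P b)"
    unfolding sum_distrib_right by (rule sum.swap)
  also have "\<dots> = - (N - 1) * (cj d + e + cj c)"
    by (simp add: sum_dZbar_EM cj_dc sum_distrib_left sum.distrib sum_subtractf sum_negf algebra_simps)
  finally show ?thesis by (simp add: sum_EM_diag algebra_simps)
qed

lemma dJ_h: "dJ h = c - cj c + 2 * t * h"
proof -
  have "dJ X = (\<Sum>a\<in>UNIV. GV a * Q a - cj (GV a) * P a + 2 * t * (P a * Q a))"
    unfolding X_def dJ_simps
    by (rule sum.cong[OF refl]) (simp add: dJ_P dJ_Q g_def algebra_simps)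
  also have "\<dots> = c - cj c + 2 * t * X"
    unfolding cj_dc by (simp add: c_def X_def sum.distrib sum_subtractf sum_distrib_left)
  finally show ?thesis by (simp add: h_def dJ_simps dJ_Y algebra_simps)
qed

text \<open>Only the imaginary part is computed: G enters the final field with the imaginary factor
  t, and in this difference the second T-derivative of f cancels, leaving
  \<open>dJ h\<close>.\<close>

lemma div_GV: "(\<Sum>a\<in>UNIV. dZbar a (GV a)) - cj (\<Sum>a\<in>UNIV. dZbar a (GV a))
    = - (2 * N + 1) * (c - cj c) - (d - cj d)"
proof -
  have "(\<Sum>a\<in>UNIV. dZbar a (dZ a t)) = dJ (\<Sum>a\<in>UNIV. dZbar a (P a))"
    by (simp add: dJ_simps P_def t_def)
  then have 1: "(\<Sum>a\<in>UNIV. dZbar a (dZ a t)) = - N * dJ g"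
    by (simp add: trace dJ_simps N_def)
  have "(\<Sum>a\<in>UNIV. dZbar a (GV a)) = - N * dJ g + (\<Sum>a\<in>UNIV. dZbar a g * P a) + g * (\<Sum>a\<in>UNIV. dZbar a (P a))"
    by (simp add: GV_def D_add D_mult sum.distrib 1 sum_distrib_left)
  also have "(\<Sum>a\<in>UNIV. dZbar a g * P a) = cj d + e + cj c"
    by (simp add: dZbar_g cj_dc algebra_simps sum.distrib)
  finally have S: "(\<Sum>a\<in>UNIV. dZbar a (GV a)) = - N * dJ g + (cj d + e + cj c) - N * g * g"
    by (simp add: trace mult_ac)
  have "dJ g - cj (dJ g) = 2 * dJ h"
    by (simp add: cj_dJ cj_rules g_def dJ_simps)
  then have J: "cj (dJ g) = dJ g - 2 * (c - cj c + 2 * t * h)"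
    by (simp add: dJ_h algebra_simps)
  show ?thesis
    unfolding S by (simp add: cj_rules cj_e J) (simp add: g_def algebra_simps)
qed

text \<open>Since g = h - t, the coefficients are g + 3t and g - t. They are written in h and t
  because conjugation fixes h and negates t.\<close>

definition VF where "VF a = w * ((h + 2 * t) * EV a + (h - 2 * t) * DV a - 3 * t * GV a)"

text \<open>Each summand is a product with its own conjugate, so M is visibly nonnegative. In h = X
  + Y the part X pays for the mixed terms of D and E through the triple sum, and the part Y remains
  to control D and E separately.\<close>

definition M where "M = Y * (EE + DD) + (\<Sum>a\<in>UNIV. GV a * cj (GV a))
  + (\<Sum>a\<in>UNIV. (GV a + DV a) * cj (GV a + DV a)) + (\<Sum>a\<in>UNIV. (GV a - EV a) * cj (GV a - EV a))
  + (\<Sum>a\<in>UNIV. \<Sum>b\<in>UNIV. \<Sum>k\<in>UNIV. (DM a b * Q k + EM a k * P b) * cj (DM a b * Q k + EM a k * P b))"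

text \<open>After expanding, the indices b and k separate: the squares produce the factor X, the
  mixed terms the contractions \<open>DV\<close> and \<open>EV\<close>.\<close>

lemma triple_sum: "(\<Sum>a\<in>UNIV. \<Sum>b\<in>UNIV. \<Sum>k\<in>UNIV. (DM a b * Q k + EM a k * P b) * cj (DM a b * Q k + EM a k * P b))
   = X * (DD + EE) + (\<Sum>a\<in>UNIV. DV a * cj (EV a)) + (\<Sum>a\<in>UNIV. EV a * cj (DV a))"
proof -
  have "(\<Sum>b\<in>UNIV. \<Sum>k\<in>UNIV. (DM a b * Q k + EM a k * P b) * cj (DM a b * Q k + EM a k * P b))
    = X * (\<Sum>b\<in>UNIV. DM a b * cj (DM a b)) + X * (\<Sum>k\<in>UNIV. EM a k * cj (EM a k)) + DV a * cj (EV a) + EV a * cj (DV a)" for a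
  proof -
    have "(\<Sum>b\<in>UNIV. \<Sum>k\<in>UNIV. (DM a b * Q k + EM a k * P b) * cj (DM a b * Q k + EM a k * P b))
      = (\<Sum>b\<in>UNIV. \<Sum>k\<in>UNIV. (DM a b * cj (DM a b)) * (P k * Q k) + (P b * Q b) * (EM a k * cj (EM a k))
         + (DM a b * Q b) * (cj (EM a k) * Q k) + (cj (DM a b) * P b) * (EM a k * P k))"
      by (simp add: cj_rules algebra_simps)
    also have "\<dots> = (\<Sum>b\<in>UNIV. DM a b * cj (DM a b)) * X + X * (\<Sum>k\<in>UNIV. EM a k * cj (EM a k))
       + DV a * cj (EV a) + cj (DV a) * EV a"
      by (simp add: sum.distrib X_def DV_def EV_def cj_rules flip: sum_product)
    finally show ?thesis by (simp add: mult_ac)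
  qed
  then show ?thesis
    by (simp add: sum.distrib DD_def EE_def sum_distrib_left distrib_left)
qed

theorem jerison_lee_identity:
  "(\<Sum>a\<in>UNIV. dZbar a (VF a)) + cj (\<Sum>a\<in>UNIV. dZbar a (VF a)) = 2 * w * M"
proof -
  \<comment> \<open>Naming all contractions reduces the claim to a polynomial identity in commuting
    atoms.\<close>
  define sEE sDD sGG where "sEE = (\<Sum>a\<in>UNIV. EV a * cj (EV a))" and "sDD = (\<Sum>a\<in>UNIV. DV a * cj (DV a))"
    and "sGG = (\<Sum>a\<in>UNIV. GV a * cj (GV a))"
  define sED sGE sGD where "sED = (\<Sum>a\<in>UNIV. EV a * cj (DV a))" and "sGE = (\<Sum>a\<in>UNIV. GV a * cj (EV a))"
    and "sGD = (\<Sum>a\<in>UNIV. GV a * cj (DV a))"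
  define S where "S = (\<Sum>a\<in>UNIV. dZbar a (GV a))"
  have cj_s: "cj sEE = sEE" "cj sDD = sDD" "cj sGG = sGG" "cj DD = DD" "cj EE = EE"
    by (simp_all add: sEE_def sDD_def sGG_def DD_def EE_def mult.commute)
  have cj_x: "cj sED = (\<Sum>a\<in>UNIV. DV a * cj (EV a))" "cj sGE = (\<Sum>a\<in>UNIV. EV a * cj (GV a))"
    "cj sGD = (\<Sum>a\<in>UNIV. DV a * cj (GV a))"
    by (simp_all add: sED_def sGE_def sGD_def mult.commute)
  have M: "M = h * (EE + DD) + 3 * sGG + sDD + sEE + sED + cj sED + sGD + cj sGD - sGE - cj sGE"
    unfolding M_def triple_sum
    by (simp add: cj_x, simp add: h_def sEE_def sDD_def sGG_def sED_def sGE_def sGD_def sum.distrib sum_subtractf algebra_simps)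
  have "(\<Sum>a\<in>UNIV. dZbar a (VF a)) = (\<Sum>a\<in>UNIV. w * (
      2 * (N - 1) * ((h + 2 * t) * (EV a * Q a) + (h - 2 * t) * (DV a * Q a) - 3 * t * (GV a * Q a))
      + (EV a * cj (DV a) + EV a * cj (EV a) - 2 * (EV a * cj (GV a)) + 3 * (h + t) * (EV a * Q a))
      + (DV a * cj (DV a) + DV a * cj (EV a) + 2 * (DV a * cj (GV a)) - (h + t) * (DV a * Q a))
      + 3 * (GV a * cj (GV a)) - 3 * (h + t) * (GV a * Q a)
      + (h + 2 * t) * dZbar a (EV a) + (h - 2 * t) * dZbar a (DV a) - 3 * t * dZbar a (GV a)))"
    by (rule sum.cong[OF refl])
      (simp add: VF_def D_mult D_add D_diff dZbar_w dZbar_h dZbar_t, simp add: algebra_simps)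
  also have "\<dots> = w * (
      2 * (N - 1) * ((h + 2 * t) * e + (h - 2 * t) * d - 3 * t * c)
      + (sED + sEE - 2 * cj sGE + 3 * (h + t) * e)
      + (sDD + cj sED + 2 * cj sGD - (h + t) * d)
      + 3 * sGG - 3 * (h + t) * c
      + (h + 2 * t) * (\<Sum>a\<in>UNIV. dZbar a (EV a)) + (h - 2 * t) * (\<Sum>a\<in>UNIV. dZbar a (DV a)) - 3 * t * S)"
    unfolding cj_x by (simp add: S_def sED_def sEE_def sDD_def sGG_def e_def d_def c_def sum.distrib sum_subtractf
        flip: sum_distrib_left)
  finally have V: "(\<Sum>a\<in>UNIV. dZbar a (VF a)) = w * (
      2 * (N - 1) * ((h + 2 * t) * e + (h - 2 * t) * d - 3 * t * c)
      + (sED + sEE - 2 * cj sGE + 3 * (h + t) * e)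
      + (sDD + cj sED + 2 * cj sGD - (h + t) * d)
      + 3 * sGG - 3 * (h + t) * c
      + (h + 2 * t) * (EE - (N - 1) * (cj d + e + cj c))
      + (h - 2 * t) * (DD - (N - 2) * d - (N + 2) * e + (N + 2) * c) - 3 * t * S)"
    unfolding div_EV div_DV .
  \<comment> \<open>As t is imaginary, S survives in the sum with the conjugate only as t times S
    minus its conjugate, which \<open>div_GV\<close> gives.\<close>
  have "cj S = S + (2 * N + 1) * (c - cj c) + (d - cj d)"
    using div_GV by (simp add: S_def algebra_simps)
  then show ?thesis
    unfolding V M by (simp add: cj_rules cj_s cj_e) (simp add: algebra_simps)
qed

text \<open>The divergences of these two fields control $|\partial f|^4$ (this is where $n \ge 2$ enters) and $f_0^2$.\<close>

definition UX where "UX a = w * X * P a"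
definition UY where "UY a = - (w * t * P a)"

text \<open>The coefficient of X^2 collects 2(N-1) from the weight, -N from the trace, and 2 - 1
  from the derivative of X, before doubling. The terms in t X are imaginary and cancel against their
  conjugates.\<close>

lemma div_UX: "(\<Sum>a\<in>UNIV. dZbar a (UX a)) + cj (\<Sum>a\<in>UNIV. dZbar a (UX a))
  = w * (2 * (N - 1) * X * X - 2 * (N + 1) * Y * X + 2 * e + d + cj d)"
proof -
  have dZbar_X: "dZbar a X = cj (EV a) + cj (DV a) - (h - t) * Q a + 2 * Q a * X" for a
    using arg_cong[OF dZ_X[of a], of cj] by (simp add: cj_D cj_rules)
  have "(\<Sum>a\<in>UNIV. dZbar a (UX a)) = (\<Sum>a\<in>UNIV. w * (2 * (N - 1) * X * (P a * Q a) + X * dZbar a (P a)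
     + cj (EV a) * P a + cj (DV a) * P a - (h - t) * (P a * Q a) + 2 * X * (P a * Q a)))"
    by (rule sum.cong[OF refl]) (simp add: UX_def D_mult dZbar_w dZbar_X, simp add: algebra_simps)
  also have "\<dots> = w * (2 * (N - 1) * X * X + X * (- N * g) + e + cj d - (h - t) * X + 2 * X * X)"
    by (simp add: X_def cj_dc trace sum.distrib sum_subtractf flip: sum_distrib_left)
  finally show ?thesis
    by (simp add: cj_rules cj_e) (simp add: h_def g_def algebra_simps)
qed

text \<open>As t is imaginary, -t^2 is the square of f_0, so the first term is positive. Its price
  is -2hX, which contains -2X^2.\<close>

lemma div_UY: "(\<Sum>a\<in>UNIV. dZbar a (UY a)) + cj (\<Sum>a\<in>UNIV. dZbar a (UY a))
  = w * (- 2 * N * t * t + c + cj c - 2 * h * X)"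
proof -
  have "(\<Sum>a\<in>UNIV. dZbar a (UY a)) = (\<Sum>a\<in>UNIV. w * (- (2 * (N - 1) * t) * (P a * Q a) - t * dZbar a (P a)
     + cj (GV a) * P a - (h + t) * (P a * Q a)))"
    by (rule sum.cong[OF refl]) (simp add: UY_def D_minus D_mult dZbar_w dZbar_t, simp add: algebra_simps)
  also have "\<dots> = w * (- (2 * (N - 1) * t) * X - t * (- N * g) + cj c - (h + t) * X)"
    by (simp add: X_def cj_dc trace sum.distrib sum_subtractf sum_negf flip: sum_distrib_left)
  finally show ?thesis
    by (simp add: cj_rules cj_e) (simp add: h_def g_def algebra_simps)
qed

end

section \<open>Integration by parts against a cutoff\<close>

lemma integrable_compact_support:
  fixes g :: "'a::euclidean_space \<Rightarrow> real"
  assumes "compact K" "continuous_on UNIV g" "\<And>p. p \<notin> K \<Longrightarrow> g p = 0"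
  shows "integrable lborel g"
proof -
  have "integrable lborel (\<lambda>x. indicator K x *\<^sub>R g x)"
    by (rule borel_integrable_compact[OF assms(1)]) (use assms(2) continuous_on_subset in blast)
  also have "(\<lambda>x. indicator K x *\<^sub>R g x) = g"
    using assms(3) by (auto simp: indicator_def fun_eq_iff)
  finally show ?thesis .
qed

lemma integral_translate:
  fixes g :: "'a::euclidean_space \<Rightarrow> real"
  assumes "g \<in> borel_measurable borel"
  shows "(\<integral>p. g (c + p) \<partial>lborel) = (\<integral>p. g p \<partial>lborel)"
proof -
  have "(\<integral>p. g p \<partial>lborel) = (\<integral>p. g p \<partial>distr lborel borel ((+) c))"
    by (simp add: lborel_distr_plus)
  also have "\<dots> = (\<integral>p. g (c + p) \<partial>lborel)"
    by (rule integral_distr) (use assms in auto)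
  finally show ?thesis by simp
qed

text \<open>Difference quotients integrate to 0 by translation invariance, and they converge
  dominatedly to the derivative.\<close>

lemma integral_directional_derivative_eq_0:
  fixes g g' :: "'a::euclidean_space \<Rightarrow> real"
  assumes K: "compact K" and g: "continuous_on UNIV g" and g': "continuous_on UNIV g'"
    and zero: "\<And>p. p \<notin> K \<Longrightarrow> g p = 0" "\<And>p. p \<notin> K \<Longrightarrow> g' p = 0"
    and deriv: "\<And>p s. ((\<lambda>s. g (p + s *\<^sub>R v)) has_real_derivative g' (p + s *\<^sub>R v)) (at s)"
  shows "integrable lborel g'" "(\<integral>p. g' p \<partial>lborel) = 0"
proof -
  show "integrable lborel g'" by (rule integrable_compact_support[OF K g' zero(2)])
  have gi: "integrable lborel g" by (rule integrable_compact_support[OF K g zero(1)])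
  obtain B where B: "\<And>p. p \<in> K \<Longrightarrow> \<bar>g' p\<bar> \<le> B"
    using compact_imp_bounded[OF compact_continuous_image[OF continuous_on_subset[OF g'] K]]
    unfolding bounded_iff by auto
  have B': "\<bar>g' p\<bar> \<le> max B 0" for p
    using B[of p] zero(2)[of p] by (cases "p \<in> K") auto
  \<comment> \<open>The mean value point lies at most one unit along v from p, so this sweep of K
    contains the support of all quotients and carries the dominating function.\<close>
  define K' where "K' = (\<lambda>(p, s::real). p - s *\<^sub>R v) ` (K \<times> {0..1})"
  have K': "compact K'"
    unfolding K'_def by (intro compact_continuous_image compact_Times K compact_Icc)
      (auto intro!: continuous_intros simp: case_prod_unfold)
  define s where "s k = inverse (real (Suc k))" for k
  have s0: "s k > 0" "s k \<le> 1" for k by (auto simp: s_def field_simps)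
  have s: "s \<longlonglongrightarrow> 0" unfolding s_def by (rule LIMSEQ_inverse_real_of_nat)
  define q where "q k p = (g (s k *\<^sub>R v + p) - g p) / s k" for k p
  have mvt: "\<exists>\<theta>>0. \<theta> < s k \<and> q k p = g' (p + \<theta> *\<^sub>R v)" for k p
  proof -
    obtain \<theta> where "\<theta> > 0" "\<theta> < s k" "g (p + s k *\<^sub>R v) - g (p + 0 *\<^sub>R v) = (s k - 0) * g' (p + \<theta> *\<^sub>R v)"
      using MVT2[of 0 "s k" "\<lambda>s. g (p + s *\<^sub>R v)" "\<lambda>s. g' (p + s *\<^sub>R v)"] deriv s0(1) by blast
    then show ?thesis using s0(1)[of k] by (intro exI[of _ \<theta>]) (auto simp: q_def field_simps)
  qed
  have q_int: "(\<integral>p. q k p \<partial>lborel) = 0" for k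
  proof -
    have 1: "integrable lborel (\<lambda>p. g (s k *\<^sub>R v + p))"
      by (rule integrable_distr[of "(+) (s k *\<^sub>R v)" lborel borel]) (simp_all add: lborel_distr_plus gi)
    have "(\<integral>p. q k p \<partial>lborel) = ((\<integral>p. g (s k *\<^sub>R v + p) \<partial>lborel) - (\<integral>p. g p \<partial>lborel)) / s k"
      unfolding q_def by (simp add: 1 gi)
    then show ?thesis
      using integral_translate[of g] borel_measurable_continuous_onI[OF g] by simp
  qed
  have meas: "g \<in> borel_measurable borel" "g' \<in> borel_measurable borel"
    by (intro borel_measurable_continuous_onI g g')+
  have "(\<lambda>k. \<integral>p. q k p \<partial>lborel) \<longlonglongrightarrow> (\<integral>p. g' p \<partial>lborel)"
  proof (rule integral_dominated_convergence[where w = "\<lambda>p. max B 0 * indicator K' p"])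
    show "g' \<in> borel_measurable lborel" using meas by simp
    show "q k \<in> borel_measurable lborel" for k
      unfolding q_def using meas by measurable
    show "integrable lborel (\<lambda>p. max B 0 * indicator K' p)"
      using emeasure_compact_finite[OF K'] compact_imp_closed[OF K']
      by (intro integrable_mult_right integrable_real_indicator) auto
    show "AE p in lborel. (\<lambda>k. q k p) \<longlonglongrightarrow> g' p"
    proof (rule AE_I2)
      fix p
      obtain \<theta> where \<theta>: "\<And>k. \<theta> k > 0" "\<And>k. \<theta> k < s k" "\<And>k. q k p = g' (p + \<theta> k *\<^sub>R v)"
        using mvt[of _ p] by metis
      have "\<theta> \<longlonglongrightarrow> 0"
        by (rule tendsto_sandwich[OF _ _ tendsto_const s])
          (use \<theta> in \<open>auto intro!: always_eventually less_imp_le\<close>)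
      then have "(\<lambda>k. p + \<theta> k *\<^sub>R v) \<longlonglongrightarrow> p"
        by (auto intro!: tendsto_eq_intros)
      then have "(\<lambda>k. g' (p + \<theta> k *\<^sub>R v)) \<longlonglongrightarrow> g' p"
        using continuous_on_eq_continuous_at[of UNIV g'] g' by (auto intro: isCont_tendsto_compose)
      then show "(\<lambda>k. q k p) \<longlonglongrightarrow> g' p" by (simp add: \<theta>(3))
    qed
    show "AE p in lborel. norm (q k p) \<le> max B 0 * indicator K' p" for k
    proof (rule AE_I2)
      fix p
      obtain \<theta> where \<theta>: "\<theta> > 0" "\<theta> < s k" "q k p = g' (p + \<theta> *\<^sub>R v)"
        using mvt by blast
      show "norm (q k p) \<le> max B 0 * indicator K' p"
      proof (cases "p + \<theta> *\<^sub>R v \<in> K")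
        case True
        then have "p \<in> K'" unfolding K'_def using \<theta> s0(2)[of k]
          by (intro image_eqI[of _ _ "(p + \<theta> *\<^sub>R v, \<theta>)"]) auto
        then show ?thesis using B' \<theta>(3) by simp
      qed (use zero(2) \<theta>(3) in simp)
    qed
  qed
  then show "(\<integral>p. g' p \<partial>lborel) = 0"
    by (simp add: q_int LIMSEQ_const_iff)
qed

text \<open>A power of at least two makes the positive part differentiable across its kink; this
  permits an explicit cutoff instead of a smooth bump.\<close>

lemma has_derivative_pos_part_power:
  assumes "k \<ge> 1"
  shows "((\<lambda>x::real. max 0 x ^ Suc k) has_real_derivative real (Suc k) * max 0 x ^ k) (at x)"
proof (cases x "0::real" rule: linorder_cases)
  case less
  have "((\<lambda>x::real. 0) has_real_derivative real (Suc k) * max 0 x ^ k) (at x)"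
    using less assms by (simp add: power_0_left)
  then show ?thesis
    by (rule has_field_derivative_transform_within_open[where S = "{..<0}"]) (use less in auto)
next
  case greater
  have "((\<lambda>x::real. x ^ Suc k) has_real_derivative real (Suc k) * max 0 x ^ k) (at x)"
    using greater DERIV_pow[of "Suc k" x] by simp
  then show ?thesis
    by (rule has_field_derivative_transform_within_open[where S = "{0<..}"]) (use greater in auto)
next
  case equal
  have "((\<lambda>h::real. max 0 h ^ Suc k / h) \<longlongrightarrow> 0) (at 0)"
  proof (rule Lim_null_comparison)
    have "norm (max 0 h ^ Suc k / h) \<le> \<bar>h\<bar> ^ k" for h :: real
      by (cases "h > 0") (auto simp: max_def)
    then show "\<forall>\<^sub>F h in at 0. norm (max 0 h ^ Suc k / h) \<le> \<bar>h::real\<bar> ^ k" by simp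
    show "((\<lambda>h::real. \<bar>h\<bar> ^ k) \<longlongrightarrow> 0) (at 0)"
      using assms by (auto intro!: tendsto_eq_intros)
  qed
  then show ?thesis using equal assms by (simp add: DERIV_def power_0_left)
qed

definition heis4 :: "'n::finite heis \<Rightarrow> real" where
  "heis4 p = norm (fst p) ^ 4 + (snd p)\<^sup>2"

definition heis4_smf :: "'n::finite smf" where
  "heis4_smf = (\<Sum>a\<in>UNIV. zz a * cj (zz a)) ^ 2 + tt ^ 2"

lemma norm_sq_vec: "(norm (z :: complex ^ 'n::finite))\<^sup>2 = (\<Sum>a\<in>UNIV. (cmod (z $ a))\<^sup>2)"
  by (simp add: norm_vec_def L2_set_def sum_nonneg)

lemma ev_sum_zz: "ev (\<Sum>a\<in>UNIV. zz a * cj (zz a)) p = complex_of_real ((norm (fst p))\<^sup>2)"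
  by (simp add: norm_sq_vec complex_norm_square del: of_real_power)

lemma ev_heis4_smf: "ev heis4_smf p = complex_of_real (heis4 p)"
  unfolding heis4_smf_def ev_simps ev_power ev_sum_zz by (simp add: heis4_def flip: power_mult)

lemma heis4_nonneg: "heis4 p \<ge> 0" by (simp add: heis4_def)

lemma continuous_on_ev: "continuous_on S (ev F)"
  by (meson continuous_at_imp_continuous_on smooth_continuous smooth_ev)

lemma continuous_on_heis4: "continuous_on S heis4"
  unfolding heis4_def by (intro continuous_intros)

definition heis_ball :: "real \<Rightarrow> 'n::finite heis set" where
  "heis_ball R = {p. heis4 p \<le> R ^ 4}"

text \<open>Built from the polynomial |xi|^4, so its horizontal gradient is explicit. It has a kink
  on the sphere and is therefore differentiated only in powers of at least two.\<close>

definition cutoff :: "real \<Rightarrow> 'n::finite heis \<Rightarrow> real" where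
  "cutoff R p = max 0 (1 - heis4 p / R ^ 4)"

lemma heis_ball_bounds:
  assumes "R > 0" "p \<in> heis_ball R"
  shows "norm (fst p) \<le> R" "\<bar>snd p\<bar> \<le> R\<^sup>2"
proof -
  have *: "norm (fst p) ^ 4 + (snd p)\<^sup>2 \<le> R ^ 4" using assms by (simp add: heis_ball_def heis4_def)
  have "norm (fst p) ^ 4 \<le> R ^ 4" using * zero_le_power2[of "snd p"] by linarith
  then show "norm (fst p) \<le> R" using assms by (simp add: power_mono_iff)
  have "(snd p)\<^sup>2 \<le> R ^ 4" using * zero_le_power[OF norm_ge_zero, of "fst p" 4] by linarith
  then have "(snd p)\<^sup>2 \<le> (R\<^sup>2)\<^sup>2" by (simp flip: power_mult)
  then have "\<bar>snd p\<bar>\<^sup>2 \<le> (R\<^sup>2)\<^sup>2" by (simp only: power2_abs)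
  then show "\<bar>snd p\<bar> \<le> R\<^sup>2" by (rule power2_le_imp_le) (rule zero_le_power2)
qed

lemma compact_heis_ball: "R > 0 \<Longrightarrow> compact (heis_ball R :: 'n::finite heis set)"
proof -
  assume R: "R > 0"
  have "closed (heis_ball R :: 'n heis set)"
    unfolding heis_ball_def by (intro closed_Collect_le continuous_on_heis4 continuous_on_const)
  moreover have "heis_ball R \<subseteq> cball (0 :: complex ^ 'n) R \<times> cball 0 (R\<^sup>2)"
    using heis_ball_bounds[OF R] by (auto simp: dist_norm mem_Times_iff)
  then have "bounded (heis_ball R :: 'n heis set)"
    by (rule bounded_subset[rotated]) (intro bounded_Times bounded_cball)
  ultimately show ?thesis by (simp add: compact_eq_bounded_closed)
qed

lemma cutoff_outside: "R > 0 \<Longrightarrow> p \<notin> heis_ball R \<Longrightarrow> cutoff R p = 0"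
  by (auto simp: heis_ball_def cutoff_def max_def field_simps)

lemma cutoff_range: "R > 0 \<Longrightarrow> cutoff R p \<ge> 0" "R > 0 \<Longrightarrow> cutoff R p \<le> 1"
  using heis4_nonneg[of p] by (auto simp: cutoff_def)

lemma continuous_on_cutoff: "continuous_on S (cutoff R)"
  unfolding cutoff_def by (cases "R = 0") (auto intro!: continuous_intros continuous_on_heis4)

text \<open>G is the derivative along v of L applied to the cutoff power times F. Taking L to be
  \<open>Re\<close> or \<open>Im\<close> keeps every integrand real.\<close>

lemma parts_directional:
  fixes L :: "complex \<Rightarrow> real" and F :: "'n::finite smf" and v :: "'n heis"
  assumes L: "bounded_linear L" and k: "k \<ge> 1" and R: "R > 0"
  defines "G \<equiv> \<lambda>p. L (complex_of_real (cutoff R p ^ Suc k) * ev (dd v F) p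
      - complex_of_real (real (Suc k) / R ^ 4 * cutoff R p ^ k) * ev (dd v heis4_smf) p * ev F p)"
  shows "integrable lborel G" "(\<integral>p. G p \<partial>lborel) = 0"
proof -
  note cont_L = continuous_on_compose2[OF linear_continuous_on[OF L, of UNIV]]
  have deriv: "((\<lambda>s. L (complex_of_real (cutoff R (p + s *\<^sub>R v) ^ Suc k) * ev F (p + s *\<^sub>R v)))
      has_real_derivative G (p + s *\<^sub>R v)) (at s)" for p s
  proof -
    have Fd: "((\<lambda>s. ev F (p + s *\<^sub>R v)) has_vector_derivative ev (dd v F) (p + s *\<^sub>R v)) (at s)" for F
      unfolding ev_dd by (rule has_vector_derivative_ddir[OF smooth_differentiable[OF smooth_ev]])
    have Re: "Re \<circ> (\<lambda>s. ev heis4_smf (p + s *\<^sub>R v)) = (\<lambda>s. heis4 (p + s *\<^sub>R v))"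
      by (auto simp: ev_heis4_smf)
    have "((\<lambda>s. Re (ev heis4_smf (p + s *\<^sub>R v))) has_vector_derivative Re (ev (dd v heis4_smf) (p + s *\<^sub>R v))) (at s)"
      by (rule bounded_linear.has_vector_derivative[OF bounded_linear_Re Fd])
    then have N: "((\<lambda>s. heis4 (p + s *\<^sub>R v)) has_real_derivative Re (ev (dd v heis4_smf) (p + s *\<^sub>R v))) (at s)"
      by (simp add: ev_heis4_smf has_real_derivative_iff_has_vector_derivative)
    have "((\<lambda>s. Im (ev heis4_smf (p + s *\<^sub>R v))) has_vector_derivative Im (ev (dd v heis4_smf) (p + s *\<^sub>R v))) (at s)"
      by (rule bounded_linear.has_vector_derivative[OF bounded_linear_Im Fd])
    then have "Im (ev (dd v heis4_smf) (p + s *\<^sub>R v)) = 0"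
      by (simp add: ev_heis4_smf) (metis has_vector_derivative_const vector_derivative_unique_at)
    then have Re_heis4_smf: "complex_of_real (Re (ev (dd v heis4_smf) (p + s *\<^sub>R v))) = ev (dd v heis4_smf) (p + s *\<^sub>R v)"
      by (simp add: complex_eq_iff)
    have "((\<lambda>s. 1 - heis4 (p + s *\<^sub>R v) / R ^ 4) has_real_derivative
        - Re (ev (dd v heis4_smf) (p + s *\<^sub>R v)) / R ^ 4) (at s)"
      by (rule DERIV_diff[OF DERIV_const DERIV_cdivide[OF N], THEN DERIV_cong]) simp
    from DERIV_chain2[OF has_derivative_pos_part_power[OF k] this]
    have "((\<lambda>s. cutoff R (p + s *\<^sub>R v) ^ Suc k) has_real_derivative
       real (Suc k) * cutoff R (p + s *\<^sub>R v) ^ k * (- Re (ev (dd v heis4_smf) (p + s *\<^sub>R v)) / R ^ 4)) (at s)"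
      unfolding cutoff_def .
    then have "((\<lambda>s. complex_of_real (cutoff R (p + s *\<^sub>R v) ^ Suc k)) has_vector_derivative
       complex_of_real (real (Suc k) * cutoff R (p + s *\<^sub>R v) ^ k * (- Re (ev (dd v heis4_smf) (p + s *\<^sub>R v)) / R ^ 4))) (at s)"
      unfolding has_real_derivative_iff_has_vector_derivative
      by (rule bounded_linear.has_vector_derivative[OF bounded_linear_of_real])
    from bounded_linear.has_vector_derivative[OF L has_vector_derivative_mult[OF this Fd[of F]]]
    show ?thesis
      unfolding has_real_derivative_iff_has_vector_derivative
    proof (rule has_vector_derivative_eq_rhs)
      define \<nu> where "\<nu> = Re (ev (dd v heis4_smf) (p + s *\<^sub>R v))"
      have "ev (dd v heis4_smf) (p + s *\<^sub>R v) = complex_of_real \<nu>" by (simp only: \<nu>_def Re_heis4_smf)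
      then show "L (complex_of_real (cutoff R (p + s *\<^sub>R v) ^ Suc k) * ev (dd v F) (p + s *\<^sub>R v) +
          complex_of_real (real (Suc k) * cutoff R (p + s *\<^sub>R v) ^ k * (- Re (ev (dd v heis4_smf) (p + s *\<^sub>R v)) / R ^ 4))
            * ev F (p + s *\<^sub>R v)) = G (p + s *\<^sub>R v)"
        unfolding G_def by (simp add: algebra_simps add_divide_distrib)
    qed
  qed
  have G0: "L 0 = 0" using L by (simp add: linear_0 bounded_linear.linear)
  note * = integral_directional_derivative_eq_0[OF compact_heis_ball[OF R], where v = v and g' = G
    and g = "\<lambda>p. L (complex_of_real (cutoff R p ^ Suc k) * ev F p)"]
  have c1: "continuous_on UNIV (\<lambda>p. L (complex_of_real (cutoff R p ^ Suc k) * ev F p))"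
    by (rule cont_L) (auto intro!: continuous_intros continuous_on_cutoff continuous_on_ev)
  have c2: "continuous_on UNIV G"
    unfolding G_def by (rule cont_L) (use R in \<open>auto intro!: continuous_intros continuous_on_cutoff continuous_on_ev\<close>)
  have z: "G p = 0" "L (complex_of_real (cutoff R p ^ Suc k) * ev F p) = 0" if "p \<notin> heis_ball R" for p
    unfolding G_def using that k by (simp_all add: cutoff_outside[OF R] G0 power_0_left)
  show "integrable lborel G" "(\<integral>p. G p \<partial>lborel) = 0"
    using *[OF c1 c2 z(2) z(1) deriv] by auto
qed

lemma Re_split:
  "Re (complex_of_real c1 * (A / 2 + \<i> * B / 2 - \<i> * T) - complex_of_real c2 * (A' / 2 + \<i> * B' / 2 - \<i> * T') * \<phi>)
    = 1/2 * Re (complex_of_real c1 * A - complex_of_real c2 * A' * \<phi>) - 1/2 * Im (complex_of_real c1 * B - complex_of_real c2 * B' * \<phi>)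
      + Im (complex_of_real c1 * T - complex_of_real c2 * T' * \<phi>)"
proof -
  define \<alpha> \<beta> \<gamma> where "\<alpha> = complex_of_real c1 * A - complex_of_real c2 * A' * \<phi>"
    and "\<beta> = complex_of_real c1 * B - complex_of_real c2 * B' * \<phi>"
    and "\<gamma> = complex_of_real c1 * T - complex_of_real c2 * T' * \<phi>"
  have "complex_of_real c1 * (A / 2 + \<i> * B / 2 - \<i> * T) - complex_of_real c2 * (A' / 2 + \<i> * B' / 2 - \<i> * T') * \<phi>
    = \<alpha> / 2 + \<i> * \<beta> / 2 - \<i> * \<gamma>"
    unfolding \<alpha>_def \<beta>_def \<gamma>_def by algebra
  then show ?thesis unfolding \<alpha>_def[symmetric] \<beta>_def[symmetric] \<gamma>_def[symmetric] by simp
qed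

text \<open>The vector fields are divergence free: the coefficient z of the t-derivative does not
  depend on t, so it can be moved inside, onto F.\<close>

lemma parts_dZbar:
  fixes F :: "'n::finite smf" and a :: 'n
  assumes k: "k \<ge> 1" and R: "R > 0"
  defines "G \<equiv> \<lambda>p. Re (complex_of_real (cutoff R p ^ Suc k) * ev (dZbar a F) p
      - complex_of_real (real (Suc k) / R ^ 4 * cutoff R p ^ k) * ev (dZbar a heis4_smf) p * ev F p)"
  shows "integrable lborel G" "(\<integral>p. G p \<partial>lborel) = 0"
proof -
  define H where "H L v F = (\<lambda>p. L (complex_of_real (cutoff R p ^ Suc k) * ev (dd v F) p
      - complex_of_real (real (Suc k) / R ^ 4 * cutoff R p ^ k) * ev (dd v heis4_smf) p * ev F p) :: real)" for L and v :: "'n heis" and F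
  have H: "integrable lborel (H L v F)" "(\<integral>p. H L v F p \<partial>lborel) = 0" if "bounded_linear L" for L v F
    unfolding H_def by (rule parts_directional[OF that k R])+
  note HR = H[OF bounded_linear_Re] and HI = H[OF bounded_linear_Im]
  have G: "G = (\<lambda>p. 1/2 * H Re (axis a 1, 0) F p - 1/2 * H Im (axis a \<i>, 0) F p + H Im (0, 1) (zz a * F) p)"
  proof
    fix p :: "'n heis"
    define c1 where "c1 = cutoff R p ^ Suc k"
    define c2 where "c2 = real (Suc k) / R ^ 4 * cutoff R p ^ k"
    have W: "ev (dZbar a F) p = ev (dd (axis a 1, 0) F) p / 2 + \<i> * ev (dd (axis a \<i>, 0) F) p / 2
        - \<i> * (fst p $ a * ev (dd (0, 1) F) p)" for F
      by (simp add: dZbar_def)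
    have Z: "ev (dd (0, 1) (zz a * F)) p = fst p $ a * ev (dd (0, 1) F) p"
      by (simp add: dd_mult cc_of_nat)
    show "G p = 1/2 * H Re (axis a 1, 0) F p - 1/2 * H Im (axis a \<i>, 0) F p + H Im (0, 1) (zz a * F) p"
      unfolding G_def H_def c1_def[symmetric] c2_def[symmetric]
      unfolding W Z Re_split by (simp only: ev_simps mult_ac)
  qed
  show "integrable lborel G"
    unfolding G by (intro Bochner_Integration.integrable_add Bochner_Integration.integrable_diff
       integrable_mult_right HR HI)
  show "(\<integral>p. G p \<partial>lborel) = 0"
    unfolding G by (simp add: HR HI)
qed

section \<open>Volume growth of Heisenberg balls\<close>

text \<open>The ball lies in a box with 2n real coordinates bounded by R and one bounded by R^2;
  hence the exponent is the homogeneous dimension Q = 2n+2.\<close>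

lemma measure_heis_ball:
  assumes R: "R > 0"
  shows "measure lborel (heis_ball R :: 'n::finite heis set) \<le> 2 ^ (2 * CARD('n) + 1) * R ^ (2 * CARD('n) + 2)"
proof -
  define b :: "'n heis" where "b = ((\<chi> j. Complex R R), R\<^sup>2)"
  have inner_b: "b \<bullet> (axis j x, 0) = R" if "x \<in> Basis" for j and x :: complex
    using that by (auto simp: b_def inner_axis Basis_complex_def inner_complex_def)
  have Basis: "(Basis :: 'n heis set) = (\<Union>j. \<Union>x\<in>Basis. {(axis j x, 0)}) \<union> {(0, 1)}"
    by (auto simp: Basis_prod_def Basis_vec_def)
  have sub: "(heis_ball R :: 'n heis set) \<subseteq> cbox (- b) b"
  proof
    fix p :: "'n heis"
    assume p: "p \<in> heis_ball R"
    have "\<bar>p \<bullet> i\<bar> \<le> b \<bullet> i" if i: "i \<in> Basis" for i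
    proof -
      consider j x where "x \<in> Basis" "i = (axis j x, 0)" | "i = (0, 1)"
        using i unfolding Basis by auto
      then show ?thesis
      proof cases
        case 1
        have "\<bar>p \<bullet> i\<bar> = \<bar>fst p \<bullet> axis j x\<bar>" using 1 by (cases p) simp
        also have "\<dots> \<le> norm (fst p)"
          using Cauchy_Schwarz_ineq2[of "fst p" "axis j x"] 1 norm_Basis[of "axis j x"]
            Basis_vec_def[where 'a = complex and 'b = 'n]
          by (metis (no_types, lifting) UN_iff UNIV_I insertI1 mult.right_neutral)
        also have "\<dots> \<le> R" by (rule heis_ball_bounds[OF R p])
        finally show ?thesis using inner_b 1 by simp
      next
        case 2
        then show ?thesis using heis_ball_bounds[OF R p] by (cases p) (simp add: b_def)
      qed
    qed
    then show "p \<in> cbox (- b) b"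
      unfolding mem_box by (auto simp: abs_le_iff) (metis abs_le_iff minus_le_iff)
  qed
  have b_nonneg: "b \<bullet> i \<ge> 0" if "i \<in> Basis" for i
    using that R inner_b unfolding Basis by (auto simp: b_def)
  have "measure lborel (heis_ball R :: 'n heis set) \<le> measure lborel (cbox (- b) b)"
    by (rule measure_mono_fmeasurable[OF sub]) (use borel_compact[OF compact_heis_ball[OF R]] in auto)
  also have "\<dots> = (\<Prod>i\<in>Basis. 2 * (b \<bullet> i))"
    by (subst measure_lborel_cbox_eq) (use b_nonneg in \<open>auto intro!: prod.cong simp: inner_diff_left inner_add_left\<close>)
  also have "\<dots> = (\<Prod>i\<in>(Basis :: 'n heis set). if i = (0, 1) then 2 * R\<^sup>2 else 2 * R)"
  proof (rule prod.cong[OF refl])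
    fix i :: "'n heis"
    assume "i \<in> Basis"
    then show "2 * (b \<bullet> i) = (if i = (0, 1) then 2 * R\<^sup>2 else 2 * R)"
      unfolding Basis using inner_b by (auto simp: b_def)
  qed
  also have "\<dots> = (2 * R\<^sup>2) * (2 * R) ^ (2 * CARD('n))"
  proof -
    have "(\<Prod>i\<in>(Basis :: 'n heis set). if i = (0, 1) then 2 * R\<^sup>2 else 2 * R)
        = (2 * R\<^sup>2) * (\<Prod>i\<in>Basis - {(0, 1) :: 'n heis}. if i = (0, 1) then 2 * R\<^sup>2 else 2 * R)"
      by (subst prod.remove[of _ "(0, 1)"]) (auto simp: Basis)
    also have "(\<Prod>i\<in>Basis - {(0, 1) :: 'n heis}. if i = (0, 1) then 2 * R\<^sup>2 else 2 * R)
        = (\<Prod>i\<in>Basis - {(0, 1) :: 'n heis}. 2 * R)"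
      by (rule prod.cong) auto
    also have "\<dots> = (2 * R) ^ (2 * CARD('n))"
      by (simp add: card_Diff_singleton Basis[THEN equalityD2, THEN subsetD] mult.commute)
    finally show ?thesis .
  qed
  also have "\<dots> = 2 ^ (2 * CARD('n) + 1) * R ^ (2 * CARD('n) + 2)"
    by (simp add: power_mult_distrib power_add power2_eq_square)
  finally show ?thesis .
qed

lemma heis_norm_sqrt: "heis_norm p = sqrt (sqrt (heis4 p))"
proof -
  have "heis_norm p = heis4 p powr (1/2 * (1/2))" by (simp add: heis_norm_def heis4_def)
  also have "\<dots> = sqrt (sqrt (heis4 p))"
    unfolding powr_powr[symmetric] by (simp add: powr_half_sqrt heis4_nonneg)
  finally show ?thesis .
qed

lemma heis_norm_nonneg: "heis_norm p \<ge> 0" by (simp add: heis_norm_def)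

lemma heis_norm_power4: "heis_norm p ^ 4 = heis4 p"
proof -
  have "heis_norm p ^ 4 = ((sqrt (sqrt (heis4 p)))\<^sup>2)\<^sup>2" by (simp add: heis_norm_sqrt flip: power_mult)
  then show ?thesis by (simp add: heis4_nonneg)
qed

lemma heis_ball_iff: "R > 0 \<Longrightarrow> p \<in> heis_ball R \<longleftrightarrow> heis_norm p \<le> R"
  unfolding heis_ball_def mem_Collect_eq heis_norm_power4[symmetric]
  by (rule power_mono_iff) (auto simp: heis_norm_nonneg)

lemma continuous_on_heis_norm: "continuous_on S heis_norm"
  unfolding heis_norm_sqrt by (intro continuous_intros continuous_on_heis4)

text \<open>The power -Q of the norm, which is what the decay of u gives for e^{4f} times the weight
  e^{2(n-1)f}.\<close>

definition decay :: "'n::finite heis \<Rightarrow> real" where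
  "decay p = 1 / (1 + heis_norm p) ^ (2 * CARD('n) + 2)"

lemma continuous_on_decay: "continuous_on (S :: 'n::finite heis set) decay"
proof -
  have "1 + heis_norm p \<noteq> 0" for p :: "'n heis"
    using heis_norm_nonneg[of p] by linarith
  then show ?thesis
    unfolding decay_def by (intro continuous_intros continuous_on_heis_norm) simp
qed

lemma decay_nonneg: "decay p \<ge> 0"
  by (simp add: decay_def heis_norm_nonneg)

lemma set_integrable_heis_ball:
  fixes g :: "'n::finite heis \<Rightarrow> real"
  assumes "R > 0" "continuous_on UNIV g"
  shows "set_integrable lborel (heis_ball R) g"
  unfolding set_integrable_def
  by (rule borel_integrable_compact[OF compact_heis_ball[OF assms(1)]]) (use assms(2) continuous_on_subset in blast)

lemma heis_ball_mono: "0 < R \<Longrightarrow> R \<le> S \<Longrightarrow> heis_ball R \<subseteq> heis_ball S"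
  by (auto simp: heis_ball_iff)

text \<open>On a dyadic shell the integrand is at most R^{-Q}, and the volume of the larger ball is
  at most 2^{2n+1} (2R)^Q; the powers of R cancel.\<close>

lemma decay_integral_step:
  assumes R: "R > 0"
  shows "(LINT p:heis_ball (2 * R)|lborel. decay (p :: 'n::finite heis))
    \<le> (LINT p:heis_ball R|lborel. decay (p :: 'n heis)) + 2 ^ (4 * CARD('n) + 3)"
proof -
  let ?A = "heis_ball (2 * R) - heis_ball R :: 'n heis set"
  have s: "set_integrable lborel (heis_ball (2 * R)) (decay :: 'n heis \<Rightarrow> real)"
    using R by (intro set_integrable_heis_ball continuous_on_decay) auto
  have b: "heis_ball R \<in> sets lborel" "heis_ball (2 * R) \<in> sets (lborel :: 'n heis measure)"
    using compact_heis_ball[of R] compact_heis_ball[of "2 * R"] R by (auto intro: borel_compact)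
  have "heis_ball (2 * R) = heis_ball R \<union> ?A" using heis_ball_mono[of R "2 * R"] R by auto
  then have "(LINT p:heis_ball (2 * R)|lborel. decay (p :: 'n heis)) = (LINT p:heis_ball R \<union> ?A|lborel. decay p)" by simp
  also have "\<dots> = (LINT p:heis_ball R|lborel. decay (p :: 'n heis)) + (LINT p:?A|lborel. decay p)"
    by (rule set_integral_Un) (use b R heis_ball_mono[of R "2 * R"] in \<open>auto intro!: set_integrable_subset[OF s]\<close>)
  also have "(LINT p:?A|lborel. decay p) \<le> (LINT p:(heis_ball (2 * R) :: 'n heis set)|lborel. 1 / R ^ (2 * CARD('n) + 2))"
    unfolding set_lebesgue_integral_def
  proof (rule integral_mono)
    have "set_integrable lborel ?A (decay :: 'n heis \<Rightarrow> real)"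
      by (rule set_integrable_subset[OF s]) (use b in auto)
    then show "integrable lborel (\<lambda>p. indicat_real ?A p *\<^sub>R decay p)"
      unfolding set_integrable_def .
    have "set_integrable lborel (heis_ball (2 * R) :: 'n heis set) (\<lambda>p. 1 / R ^ (2 * CARD('n) + 2))"
      using R by (intro set_integrable_heis_ball) auto
    then show "integrable lborel (\<lambda>p. indicat_real (heis_ball (2 * R) :: 'n heis set) p *\<^sub>R (1 / R ^ (2 * CARD('n) + 2)))"
      unfolding set_integrable_def .
    fix p :: "'n heis"
    have "decay p \<le> 1 / R ^ (2 * CARD('n) + 2)" if "p \<notin> heis_ball R"
      unfolding decay_def using that R heis_norm_nonneg[of p]
      by (intro divide_left_mono power_mono mult_pos_pos zero_less_power) (auto simp: heis_ball_iff)
    then show "indicat_real ?A p *\<^sub>R decay p \<le> indicat_real (heis_ball (2 * R)) p *\<^sub>R (1 / R ^ (2 * CARD('n) + 2))"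
      using R by (auto simp: indicator_def)
  qed
  also have "(LINT p:(heis_ball (2 * R) :: 'n heis set)|lborel. 1 / R ^ (2 * CARD('n) + 2))
     = measure lborel (heis_ball (2 * R) :: 'n heis set) * (1 / R ^ (2 * CARD('n) + 2))"
    unfolding set_lebesgue_integral_def by simp
  also have "\<dots> \<le> 2 ^ (2 * CARD('n) + 1) * (2 * R) ^ (2 * CARD('n) + 2) * (1 / R ^ (2 * CARD('n) + 2))"
    using R by (intro mult_right_mono measure_heis_ball) auto
  also have "\<dots> = 2 ^ (2 * CARD('n) + 1) * 2 ^ (2 * CARD('n) + 2)"
    using R by (simp add: power_mult_distrib)
  also have "\<dots> = 2 ^ (4 * CARD('n) + 3)"
    unfolding power_add[symmetric] by (rule arg_cong[of _ _ "(^) 2"]) simp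
  finally show ?thesis by simp
qed

lemma decay_integral_growth:
  "(LINT p:heis_ball (2 ^ k)|lborel. decay (p :: 'n::finite heis))
    \<le> (LINT p:heis_ball 1|lborel. decay (p :: 'n heis)) + real k * 2 ^ (4 * CARD('n) + 3)"
proof (induction k)
  case (Suc k)
  have "(LINT p:heis_ball (2 * 2 ^ k)|lborel. decay (p :: 'n heis))
      \<le> (LINT p:heis_ball (2 ^ k)|lborel. decay (p :: 'n heis)) + 2 ^ (4 * CARD('n) + 3)"
    by (rule decay_integral_step) simp
  then show ?case using Suc by (simp add: algebra_simps)
qed simp

section \<open>Absorbing the error terms\<close>

lemma young_sq: "a * b \<le> \<epsilon> * a\<^sup>2 + b\<^sup>2 / (4 * \<epsilon>)" if "\<epsilon> > 0" for a b \<epsilon> :: real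
proof -
  have "0 \<le> (2 * \<epsilon> * a - b)\<^sup>2 / (4 * \<epsilon>)" using that by simp
  also have "\<dots> = \<epsilon> * a\<^sup>2 + b\<^sup>2 / (4 * \<epsilon>) - a * b"
    using that by (simp add: power2_eq_square field_simps)
  finally show ?thesis by simp
qed

lemma square_sum3_le: "(a + b + c)\<^sup>2 \<le> 3 * (a\<^sup>2 + b\<^sup>2 + c\<^sup>2)" for a b c :: real
proof -
  have "3 * (a\<^sup>2 + b\<^sup>2 + c\<^sup>2) - (a + b + c)\<^sup>2 = (a - b)\<^sup>2 + (b - c)\<^sup>2 + (a - c)\<^sup>2"
    by (simp add: power2_eq_square algebra_simps)
  then show ?thesis using zero_le_power2[of "a - b"] zero_le_power2[of "b - c"] zero_le_power2[of "a - c"] by linarith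
qed

text \<open>The budget of the Young estimates, with V, A, T for \<nu>^2, x^4, \<tau>^2. The factor
  60000 is merely large enough: A is charged 6912 + 7500 + 7500 + 3750 + 15000, below 60000, T is
  charged 52272 + 30000, below 120000, and V exactly one half.\<close>

lemma absorb_linear:
  fixes V A B Y T L z :: real
  assumes "n1 \<le> V / 4 + 6912 * A + 6912 * Y + 52272 * T" "n2 \<le> V / 4 + 291600000000 * z"
    and "291600000000 * z \<le> 7500 * A + 3000000000000000000 * B" "n4 \<le> A / 8 + 2 * L"
    and "n5 \<le> A / 16 + 1024 * z" "n6 \<le> T / 2 + 32 * z" "1056 * z \<le> A / 4 + 1115136 * B"
    and "0 \<le> A" "0 \<le> T" "0 \<le> B"
  shows "V / 2 - 6912 * Y - 120000 * L - 10000000000000000000 * B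
    \<le> V - n1 + 60000 * (A + 2 * T - n4) - n2 - 60000 * (n5 + n6)"
  using assms by argo

text \<open>The absorption inequality with the cutoff scaled out. The constants come from Young's
  inequality: 6912 = 144 * 3 * 16, 52272 = 144 * 3 * 121, 540000 = 9 * 60000 and 291600000000 is its
  square.\<close>

lemma absorb_normalized:
  fixes \<nu> k x y \<tau> K :: real
  shows "\<nu>\<^sup>2 / 2 - 6912 * y\<^sup>2 - 120000 * (K\<^sup>2 * y\<^sup>2) - 10000000000000000000 * k ^ 4
    \<le> \<nu>\<^sup>2 - \<nu> * (12 * (4 * x\<^sup>2 + 4 * y + 11 * \<tau>)) + 60000 * (x ^ 4 + 2 * \<tau>\<^sup>2 - x\<^sup>2 * (K * y)) - \<nu> * (540000 * (k * x))
      - 60000 * (x\<^sup>2 * (16 * (k * x)) + \<tau> * (8 * (k * x)))"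
proof (rule absorb_linear[where z = "x\<^sup>2 * k\<^sup>2"])
  have x4: "x ^ 4 = (x\<^sup>2)\<^sup>2" and k4: "k ^ 4 = (k\<^sup>2)\<^sup>2" by (simp_all flip: power_mult)
  have sq: "(c * a)\<^sup>2 = c\<^sup>2 * a\<^sup>2" for c a :: real by (rule power_mult_distrib)
  show "\<nu> * (12 * (4 * x\<^sup>2 + 4 * y + 11 * \<tau>)) \<le> \<nu>\<^sup>2 / 4 + 6912 * x ^ 4 + 6912 * y\<^sup>2 + 52272 * \<tau>\<^sup>2"
  proof -
    define b where "b = 4 * x\<^sup>2 + 4 * y + 11 * \<tau>"
    have "(4 * x\<^sup>2)\<^sup>2 = 16 * x ^ 4" "(4 * y)\<^sup>2 = 16 * y\<^sup>2" "(11 * \<tau>)\<^sup>2 = 121 * \<tau>\<^sup>2"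
      unfolding x4 sq by simp_all
    then have b: "b\<^sup>2 \<le> 3 * (16 * x ^ 4 + 16 * y\<^sup>2 + 121 * \<tau>\<^sup>2)"
      using square_sum3_le[of "4 * x\<^sup>2" "4 * y" "11 * \<tau>"] unfolding b_def by simp
    have "\<nu> * (12 * b) \<le> 1/4 * \<nu>\<^sup>2 + (12 * b)\<^sup>2 / (4 * (1/4))"
      by (rule young_sq) simp
    also have "\<dots> = \<nu>\<^sup>2 / 4 + 144 * b\<^sup>2"
      unfolding sq by simp
    also have "\<dots> \<le> \<nu>\<^sup>2 / 4 + 6912 * x ^ 4 + 6912 * y\<^sup>2 + 52272 * \<tau>\<^sup>2"
      using b by simp
    finally show ?thesis unfolding b_def .
  qed
  show "\<nu> * (540000 * (k * x)) \<le> \<nu>\<^sup>2 / 4 + 291600000000 * (x\<^sup>2 * k\<^sup>2)"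
    using young_sq[of "1/4" \<nu> "540000 * (k * x)"] unfolding sq by (simp add: mult.commute)
  show "291600000000 * (x\<^sup>2 * k\<^sup>2) \<le> 7500 * x ^ 4 + 3000000000000000000 * k ^ 4"
  proof -
    have "x\<^sup>2 * (291600000000 * k\<^sup>2) \<le> 7500 * (x\<^sup>2)\<^sup>2 + (291600000000 * k\<^sup>2)\<^sup>2 / (4 * 7500)"
      by (rule young_sq) simp
    then have "291600000000 * (x\<^sup>2 * k\<^sup>2) \<le> 7500 * x ^ 4 + 2834352000000000000 * k ^ 4"
      unfolding sq x4 k4 by (simp add: mult_ac)
    also have "\<dots> \<le> 7500 * x ^ 4 + 3000000000000000000 * k ^ 4" by simp
    finally show ?thesis .
  qed
  show "x\<^sup>2 * (K * y) \<le> x ^ 4 / 8 + 2 * (K\<^sup>2 * y\<^sup>2)"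
    using young_sq[of "1/8" "x\<^sup>2" "K * y"] unfolding sq x4 by simp
  show "x\<^sup>2 * (16 * (k * x)) \<le> x ^ 4 / 16 + 1024 * (x\<^sup>2 * k\<^sup>2)"
    using young_sq[of "1/16" "x\<^sup>2" "16 * (k * x)"] unfolding sq x4 by (simp add: mult.commute)
  show "\<tau> * (8 * (k * x)) \<le> \<tau>\<^sup>2 / 2 + 32 * (x\<^sup>2 * k\<^sup>2)"
    using young_sq[of "1/2" \<tau> "8 * (k * x)"] unfolding sq by (simp add: mult.commute)
  show "1056 * (x\<^sup>2 * k\<^sup>2) \<le> x ^ 4 / 4 + 1115136 * k ^ 4"
  proof -
    have "x\<^sup>2 * (1056 * k\<^sup>2) \<le> 1/4 * (x\<^sup>2)\<^sup>2 + (1056 * k\<^sup>2)\<^sup>2 / (4 * (1/4))"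
      by (rule young_sq) simp
    then show ?thesis unfolding sq x4 k4 by (simp add: mult_ac)
  qed
qed simp_all

definition absorb_const :: "real \<Rightarrow> real" where
  "absorb_const K = 6912 + 120000 * K\<^sup>2 + 10000000000000000000"

text \<open>Later $\psi$ is the cutoff at scale $R = 1/r$, $\mu^2$ is the sum of squares $M$, and
  $x$, $y$, $\tau$ are $|\partial f|$, $e^{2f}$, $|f_0|$.\<close>

lemma absorb:
  fixes \<psi> r \<mu> x y \<tau> K :: real
  assumes "0 \<le> \<psi>" "\<psi> \<le> 1" "0 < r"
  shows "\<psi> ^ 6 * \<mu>\<^sup>2 / 2 - absorb_const K * (r\<^sup>2 * y\<^sup>2 + r ^ 6)
    \<le> \<psi> ^ 6 * \<mu>\<^sup>2 - 12 * r * \<psi> ^ 5 * (\<mu> * (4 * x\<^sup>2 + 4 * y + 11 * \<tau>))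
      + 60000 * r\<^sup>2 * (\<psi> ^ 4 * (x ^ 4 + 2 * \<tau>\<^sup>2 - K * y * x\<^sup>2 - 9 * \<mu> * x))
      - 60000 * r\<^sup>2 * (8 * r * \<psi> ^ 3 * (2 * x ^ 3 + \<tau> * x))"
proof (cases "\<psi> = 0")
  case True
  then show ?thesis by (simp add: absorb_const_def)
next
  case False
  with assms have \<psi>: "\<psi> > 0" by simp
  \<comment> \<open>With these variables every term to be estimated carries the common factor
    \<open>r\<^sup>2 * \<psi> ^ 4\<close>. The cutoff powers are chosen so that this factor times
    k^4 is r^6, where no negative power of \<psi> is left.\<close>
  define \<nu> k where "\<nu> = \<psi> * \<mu> / r" and "k = r / \<psi>"
  have e3: "\<mu> = \<nu> * k" using \<psi> assms(3) by (simp add: \<nu>_def k_def)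
  have rk: "r = k * \<psi>" using \<psi> by (simp add: k_def)
  have e: "\<psi> ^ 6 * \<mu>\<^sup>2 = r\<^sup>2 * \<psi> ^ 4 * \<nu>\<^sup>2" "12 * r * \<psi> ^ 5 * (\<mu> * z) = r\<^sup>2 * \<psi> ^ 4 * (12 * \<nu> * z)"
    "\<mu> = \<nu> * k" "60000 * r\<^sup>2 * (8 * r * \<psi> ^ 3 * z) = r\<^sup>2 * \<psi> ^ 4 * (8 * 60000 * k * z)"
    "r ^ 6 = r\<^sup>2 * \<psi> ^ 4 * k ^ 4" for z
    unfolding e3 rk by (simp_all add: eval_nat_numeral mult_ac)
  have c4: "\<psi> ^ 4 \<le> 1" using assms by (simp add: power_le_one)
  have *: "r\<^sup>2 * \<psi> ^ 4 * (\<nu>\<^sup>2 / 2 - 6912 * y\<^sup>2 - 120000 * (K\<^sup>2 * y\<^sup>2) - 10000000000000000000 * k ^ 4)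
    \<le> r\<^sup>2 * \<psi> ^ 4 * (\<nu>\<^sup>2 - \<nu> * (12 * (4 * x\<^sup>2 + 4 * y + 11 * \<tau>)) + 60000 * (x ^ 4 + 2 * \<tau>\<^sup>2 - x\<^sup>2 * (K * y)) - \<nu> * (540000 * (k * x))
      - 60000 * (x\<^sup>2 * (16 * (k * x)) + \<tau> * (8 * (k * x))))"
    by (rule mult_left_mono[OF absorb_normalized]) (use assms in auto)
  have r: "r\<^sup>2 * \<psi> ^ 4 * (\<nu>\<^sup>2 - \<nu> * (12 * (4 * x\<^sup>2 + 4 * y + 11 * \<tau>)) + 60000 * (x ^ 4 + 2 * \<tau>\<^sup>2 - x\<^sup>2 * (K * y)) - \<nu> * (540000 * (k * x))
      - 60000 * (x\<^sup>2 * (16 * (k * x)) + \<tau> * (8 * (k * x)))) = r\<^sup>2 * \<psi> ^ 4 * \<nu>\<^sup>2 - r\<^sup>2 * \<psi> ^ 4 * (12 * \<nu> * (4 * x\<^sup>2 + 4 * y + 11 * \<tau>))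
      + 60000 * r\<^sup>2 * (\<psi> ^ 4 * (x ^ 4 + 2 * \<tau>\<^sup>2 - K * y * x\<^sup>2 - 9 * (\<nu> * k) * x))
      - r\<^sup>2 * \<psi> ^ 4 * (8 * 60000 * k * (2 * x ^ 3 + \<tau> * x))"
    by (simp add: algebra_simps power2_eq_square power3_eq_cube)
  have "r\<^sup>2 * \<psi> ^ 4 * (\<nu>\<^sup>2 / 2 - 6912 * y\<^sup>2 - 120000 * (K\<^sup>2 * y\<^sup>2) - 10000000000000000000 * k ^ 4)
    = \<psi> ^ 6 * \<mu>\<^sup>2 / 2 - (6912 + 120000 * K\<^sup>2) * ((r\<^sup>2 * y\<^sup>2) * \<psi> ^ 4) - 10000000000000000000 * r ^ 6"
    unfolding e(1,5) by (simp add: algebra_simps)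
  moreover have "(6912 + 120000 * K\<^sup>2) * ((r\<^sup>2 * y\<^sup>2) * \<psi> ^ 4) \<le> (6912 + 120000 * K\<^sup>2) * (r\<^sup>2 * y\<^sup>2)"
    using c4 by (intro mult_left_mono mult_left_le) auto
  moreover have "(6912 + 120000 * K\<^sup>2) * (r\<^sup>2 * y\<^sup>2) + 10000000000000000000 * r ^ 6
     \<le> absorb_const K * (r\<^sup>2 * y\<^sup>2 + r ^ 6)"
    using assms by (simp add: absorb_const_def distrib_left distrib_right)
  ultimately have "\<psi> ^ 6 * \<mu>\<^sup>2 / 2 - absorb_const K * (r\<^sup>2 * y\<^sup>2 + r ^ 6)
    \<le> r\<^sup>2 * \<psi> ^ 4 * (\<nu>\<^sup>2 / 2 - 6912 * y\<^sup>2 - 120000 * (K\<^sup>2 * y\<^sup>2) - 10000000000000000000 * k ^ 4)" by linarith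
  also note *
  finally show ?thesis unfolding r e(2)[symmetric] e(4)[symmetric] e(3)[symmetric] e(1)[symmetric] .
qed

section \<open>Pointwise bounds for the fields and their divergences\<close>

definition vnorm :: "('n \<Rightarrow> 'n::finite smf) \<Rightarrow> 'n heis \<Rightarrow> real" where
  "vnorm F p = L2_set (\<lambda>a. cmod (ev (F a) p)) UNIV"

lemma vnorm_nonneg: "vnorm F p \<ge> 0"
  by (simp add: vnorm_def)

lemma vnorm_sq: "(vnorm F p)\<^sup>2 = (\<Sum>a\<in>UNIV. (cmod (ev (F a) p))\<^sup>2)"
  by (simp add: vnorm_def L2_set_def sum_nonneg)

lemma vnorm_scale: "vnorm (\<lambda>a. c * F a) p = cmod (ev c p) * vnorm F p"
  by (simp add: vnorm_def L2_set_right_distrib norm_mult)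

lemma vnorm_add: "vnorm (\<lambda>a. F a + G a) p \<le> vnorm F p + vnorm G p"
proof -
  have "vnorm (\<lambda>a. F a + G a) p \<le> L2_set (\<lambda>a. cmod (ev (F a) p) + cmod (ev (G a) p)) UNIV"
    unfolding vnorm_def by (rule L2_set_mono) (auto intro: norm_triangle_ineq)
  also have "\<dots> \<le> vnorm F p + vnorm G p"
    unfolding vnorm_def by (rule L2_set_triangle_ineq)
  finally show ?thesis .
qed

lemma vnorm_uminus: "vnorm (\<lambda>a. - F a) p = vnorm F p"
  by (simp add: vnorm_def)

lemma vnorm_diff: "vnorm (\<lambda>a. F a - G a) p \<le> vnorm F p + vnorm G p"
  using vnorm_add[of F "\<lambda>a. - G a" p] by (simp add: vnorm_uminus)

lemma vnorm_cauchy_schwarz: "cmod (\<Sum>a\<in>UNIV. ev (F a) p * ev (G a) p) \<le> vnorm F p * vnorm G p"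
proof -
  have "cmod (\<Sum>a\<in>UNIV. ev (F a) p * ev (G a) p) \<le> (\<Sum>a\<in>UNIV. \<bar>cmod (ev (F a) p)\<bar> * \<bar>cmod (ev (G a) p)\<bar>)"
    by (rule order.trans[OF norm_sum]) (simp add: norm_mult)
  also have "\<dots> \<le> vnorm F p * vnorm G p"
    unfolding vnorm_def by (rule L2_set_mult_ineq)
  finally show ?thesis .
qed

lemma mult_cnj_cmod: "z * cnj z = complex_of_real ((cmod z)\<^sup>2)"
  by (rule complex_norm_square[symmetric])

text \<open>The scalar factor |z|^2 - it has modulus |xi|^2, so the gradient of |xi|^4 has length
  2|xi|^2 |z|, at most 2R^3 on the ball.\<close>

lemma dZbar_heis4_smf: "dZbar a heis4_smf = 2 * ((\<Sum>b\<in>UNIV. zz b * cj (zz b)) - cc \<i> * tt) * zz a"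
proof -
  have "dZbar a (\<Sum>b\<in>UNIV. zz b * cj (zz b)) = (\<Sum>b\<in>UNIV. if a = b then zz b else 0)"
    unfolding D_sum D_mult dZbar_zz cj_D(2)[symmetric] dZ_zz by (rule sum.cong) auto
  then show ?thesis
    unfolding heis4_smf_def power2_eq_square D_add D_mult dZbar_tt by (simp add: algebra_simps)
qed

lemma vnorm_grad_heis4_smf:
  assumes R: "R > 0" and p: "p \<in> heis_ball R"
  shows "vnorm (\<lambda>a. dZbar a heis4_smf) p \<le> 2 * R ^ 3"
proof -
  let ?S = "2 * ((\<Sum>b\<in>UNIV. zz b * cj (zz b)) - cc \<i> * tt)"
  have "cmod (ev ?S p) = 2 * cmod (complex_of_real ((norm (fst p))\<^sup>2) - \<i> * complex_of_real (snd p))"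
    unfolding ev_simps(6)[of 2] ev_simps(4) ev_sum_zz ev_numeral norm_mult by simp
  also have "\<dots> = 2 * sqrt (heis4 p)"
    by (simp add: cmod_def heis4_def flip: power_mult)
  also have "\<dots> \<le> 2 * R\<^sup>2"
  proof -
    have "heis4 p \<le> (R\<^sup>2)\<^sup>2" using p by (simp add: heis_ball_def flip: power_mult)
    then show ?thesis using real_le_lsqrt[of "R\<^sup>2" "heis4 p"] by simp
  qed
  finally have S: "cmod (ev ?S p) \<le> 2 * R\<^sup>2" .
  have z: "vnorm zz p \<le> R"
    using heis_ball_bounds(1)[OF R p] by (simp add: vnorm_def norm_vec_def)
  have "vnorm (\<lambda>a. dZbar a heis4_smf) p = cmod (ev ?S p) * vnorm zz p"
    unfolding dZbar_heis4_smf by (rule vnorm_scale)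
  also have "\<dots> \<le> (2 * R\<^sup>2) * R"
    using S z vnorm_nonneg[of zz p] by (intro mult_mono) auto
  finally show ?thesis by (simp add: power2_eq_square power3_eq_cube)
qed

text \<open>Here y is e^f, the n-th root of u, so the decay hypothesis on u takes the scale-one form
  \<open>y_le\<close>.\<close>

locale jerison_lee_decay = jerison_lee f Y w for f Y w :: "'n::finite smf" +
  fixes y :: "'n heis \<Rightarrow> real" and c1 :: real
  assumes ev_Y: "ev Y p = complex_of_real ((y p)\<^sup>2)"
    and ev_w: "ev w p = complex_of_real (y p ^ (2 * (CARD('n) - 1)))"
    and y_pos: "y p > 0" and y_le: "y p * (1 + heis_norm p) \<le> c1"
    and card2: "CARD('n) \<ge> 2"
begin

definition wv where "wv p = y p ^ (2 * (CARD('n) - 1))"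
definition xv where "xv p = vnorm P p"
definition tv where "tv p = Im (ev t p)"
definition m where "m p = (y p)\<^sup>2 * ((\<Sum>a\<in>UNIV. \<Sum>b\<in>UNIV. (cmod (ev (EM a b) p))\<^sup>2) + (\<Sum>a\<in>UNIV. \<Sum>b\<in>UNIV. (cmod (ev (DM a b) p))\<^sup>2))
  + (vnorm GV p)\<^sup>2 + (vnorm (\<lambda>a. GV a + DV a) p)\<^sup>2 + (vnorm (\<lambda>a. GV a - EV a) p)\<^sup>2
  + (\<Sum>a\<in>UNIV. \<Sum>b\<in>UNIV. \<Sum>k\<in>UNIV. (cmod (ev (DM a b * Q k + EM a k * P b) p))\<^sup>2)"

lemma wv_pos: "wv p > 0" by (simp add: wv_def y_pos)

lemma cmod_w: "cmod (ev w p) = wv p"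
  by (simp add: ev_w wv_def norm_power less_imp_le[OF y_pos])

lemma ev_M: "ev M p = complex_of_real (m p)"
proof -
  have *: "ev (F * cj F) p = complex_of_real ((cmod (ev F p))\<^sup>2)" for F
    by (simp only: ev_simps mult_cnj_cmod)
  have s: "ev (F + G) p = ev F p + ev G p" "ev (\<Sum>a\<in>A. H a) p = (\<Sum>a\<in>A. ev (H a) p)" for F G and H :: "'n \<Rightarrow> 'n smf" and A
    by simp_all
  show ?thesis
    unfolding M_def m_def EE_def DD_def vnorm_sq s ev_simps(6)[of Y] * ev_Y
    by (simp only: of_real_add of_real_mult of_real_sum)
qed

lemma m_ge: "(vnorm GV p)\<^sup>2 \<le> m p" "(vnorm (\<lambda>a. GV a + DV a) p)\<^sup>2 \<le> m p" "(vnorm (\<lambda>a. GV a - EV a) p)\<^sup>2 \<le> m p"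
  and m_nonneg: "0 \<le> m p"
proof -
  have "0 \<le> (y p)\<^sup>2 * ((\<Sum>a\<in>UNIV. \<Sum>b\<in>UNIV. (cmod (ev (EM a b) p))\<^sup>2) + (\<Sum>a\<in>UNIV. \<Sum>b\<in>UNIV. (cmod (ev (DM a b) p))\<^sup>2))"
    by (intro mult_nonneg_nonneg add_nonneg_nonneg sum_nonneg) auto
  moreover have "0 \<le> (\<Sum>a\<in>UNIV. \<Sum>b\<in>UNIV. \<Sum>k\<in>UNIV. (cmod (ev (DM a b * Q k + EM a k * P b) p))\<^sup>2)"
    by (intro sum_nonneg) auto
  moreover have "0 \<le> (vnorm GV p)\<^sup>2" "0 \<le> (vnorm (\<lambda>a. GV a + DV a) p)\<^sup>2" "0 \<le> (vnorm (\<lambda>a. GV a - EV a) p)\<^sup>2"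
    by simp_all
  ultimately show "(vnorm GV p)\<^sup>2 \<le> m p" "(vnorm (\<lambda>a. GV a + DV a) p)\<^sup>2 \<le> m p" "(vnorm (\<lambda>a. GV a - EV a) p)\<^sup>2 \<le> m p"
    "0 \<le> m p"
    unfolding m_def by linarith+
qed

lemma vnorm_GV: "vnorm GV p \<le> sqrt (m p)"
  using m_ge(1) by (intro real_le_rsqrt)

text \<open>M contains the squares of G and G + D, not that of the vector D; the triangle inequality
  costs the factor 2. The bound for E is obtained alike from G - E.\<close>

lemma vnorm_DV: "vnorm DV p \<le> 2 * sqrt (m p)"
proof -
  have "vnorm DV p \<le> vnorm (\<lambda>a. GV a + DV a) p + vnorm GV p"
    using vnorm_diff[of "\<lambda>a. GV a + DV a" GV p] by simp
  then show ?thesis using vnorm_GV[of p] real_le_rsqrt[OF m_ge(2), of p] by simp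
qed

lemma vnorm_EV: "vnorm EV p \<le> 2 * sqrt (m p)"
proof -
  have "vnorm EV p \<le> vnorm GV p + vnorm (\<lambda>a. GV a - EV a) p"
    using vnorm_diff[of GV "\<lambda>a. GV a - EV a" p] by simp
  then show ?thesis using vnorm_GV[of p] real_le_rsqrt[OF m_ge(3), of p] by simp
qed

lemma vnorm_Q: "vnorm Q p = xv p"
  by (simp add: xv_def vnorm_def flip: cj_P)

lemma ev_t: "ev t p = \<i> * complex_of_real (tv p)"
  using arg_cong[OF cj_t, of "\<lambda>F. ev F p"] by (simp add: tv_def complex_eq_iff)

lemma ev_X: "ev X p = complex_of_real ((xv p)\<^sup>2)"
  unfolding X_def xv_def vnorm_sq ev_sum cj_P[symmetric]
  by (simp only: ev_simps mult_cnj_cmod of_real_sum)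

lemma ev_h: "ev h p = complex_of_real ((xv p)\<^sup>2 + (y p)\<^sup>2)"
  unfolding h_def ev_simps ev_X ev_Y by simp

lemma ev_N: "ev N p = complex_of_real (real CARD('n))"
  by (simp add: N_def)

lemma xv_nonneg: "xv p \<ge> 0" by (simp add: xv_def vnorm_nonneg)

lemma vnorm_VF: "vnorm VF p \<le> wv p * (sqrt (m p) * (4 * (xv p)\<^sup>2 + 4 * (y p)\<^sup>2 + 11 * \<bar>tv p\<bar>))"
proof -
  let ?h = "(xv p)\<^sup>2 + (y p)\<^sup>2"
  have h: "cmod (ev (h + 2 * t) p) \<le> ?h + 2 * \<bar>tv p\<bar>" "cmod (ev (h - 2 * t) p) \<le> ?h + 2 * \<bar>tv p\<bar>"
  proof -
    have "cmod (complex_of_real ?h + z) \<le> ?h + cmod z" for z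
      using norm_triangle_ineq[of "complex_of_real ?h" z] unfolding norm_of_real by simp
    from this[of "2 * ev t p"] this[of "- (2 * ev t p)"]
    show "cmod (ev (h + 2 * t) p) \<le> ?h + 2 * \<bar>tv p\<bar>" "cmod (ev (h - 2 * t) p) \<le> ?h + 2 * \<bar>tv p\<bar>"
      unfolding ev_simps ev_h ev_t ev_numeral by (simp_all add: norm_mult)
  qed
  have t: "cmod (ev (3 * t) p) = 3 * \<bar>tv p\<bar>"
    by (simp add: ev_t norm_mult)
  have "vnorm VF p = wv p * vnorm (\<lambda>a. (h + 2 * t) * EV a + (h - 2 * t) * DV a - 3 * t * GV a) p"
    unfolding VF_def[abs_def] vnorm_scale cmod_w ..
  also have "\<dots> \<le> wv p * (vnorm (\<lambda>a. (h + 2 * t) * EV a) p + vnorm (\<lambda>a. (h - 2 * t) * DV a) p + vnorm (\<lambda>a. 3 * t * GV a) p)"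
    by (intro mult_left_mono order.trans[OF vnorm_diff] add_right_mono vnorm_add)
      (use wv_pos[of p] in auto)
  \<comment> \<open>Two coefficients of size h + 2|t| against vectors of size twice the root of M,
    plus 3|t| for G: this gives 4h and 8 + 3 = 11.\<close>
  also have "\<dots> \<le> wv p * ((?h + 2 * \<bar>tv p\<bar>) * (2 * sqrt (m p)) + (?h + 2 * \<bar>tv p\<bar>) * (2 * sqrt (m p)) + 3 * \<bar>tv p\<bar> * sqrt (m p))"
    unfolding vnorm_scale t
    by (intro mult_left_mono add_mono mult_mono h vnorm_EV vnorm_DV vnorm_GV vnorm_nonneg order.refl)
      (use wv_pos[of p] in auto)
  finally show ?thesis by (simp add: algebra_simps)
qed

text \<open>The factor 2 makes the gain from \<open>UX\<close> outweigh the loss -X^2 from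
  \<open>UY\<close>: the coefficient of |df|^4 is 2(n-1) - 1, at least 1 exactly when n is at least
  2.\<close>

definition UU where "UU a = 2 * UX a + UY a"

lemma vnorm_UU: "vnorm UU p \<le> wv p * (2 * xv p ^ 3 + \<bar>tv p\<bar> * xv p)"
proof -
  have "UU = (\<lambda>a. w * ((2 * X - t) * P a))"
    by (auto simp: UU_def UX_def UY_def algebra_simps)
  then have "vnorm UU p = wv p * (cmod (ev (2 * X - t) p) * xv p)"
    by (simp add: vnorm_scale cmod_w xv_def)
  also have "\<dots> \<le> wv p * ((2 * (xv p)\<^sup>2 + \<bar>tv p\<bar>) * xv p)"
  proof -
    have "cmod (ev (2 * X - t) p) \<le> cmod (ev (2 * X) p) + cmod (ev t p)"
      using norm_triangle_ineq4[of "ev (2 * X) p" "ev t p"] by simp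
    also have "\<dots> = 2 * (xv p)\<^sup>2 + \<bar>tv p\<bar>"
      by (simp add: ev_X ev_t norm_mult norm_power)
    finally show ?thesis using wv_pos[of p] xv_nonneg[of p] by (intro mult_left_mono mult_right_mono) auto
  qed
  finally show ?thesis by (simp add: algebra_simps power2_eq_square power3_eq_cube)
qed

lemma Re_of_sum_cnj: "z + cnj z = complex_of_real (2 * r) \<Longrightarrow> Re z = r"
  by (simp add: complex_eq_iff)

lemma div_VF: "Re (\<Sum>a\<in>UNIV. ev (dZbar a (VF a)) p) = wv p * m p"
proof (rule Re_of_sum_cnj)
  show "(\<Sum>a\<in>UNIV. ev (dZbar a (VF a)) p) + cnj (\<Sum>a\<in>UNIV. ev (dZbar a (VF a)) p) = complex_of_real (2 * (wv p * m p))"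
    using arg_cong[OF jerison_lee_identity, of "\<lambda>F. ev F p"]
    by (simp add: ev_M ev_w wv_def)
qed

text \<open>The constant 9 is 2 * (2 + 2) + 1, from the bounds on e, d and c; 2n + 3 is 2(n+1) +
  1.\<close>

lemma div_UU: "Re (\<Sum>a\<in>UNIV. ev (dZbar a (UU a)) p)
  \<ge> wv p * (xv p ^ 4 + 2 * \<bar>tv p\<bar>\<^sup>2 - (2 * real CARD('n) + 3) * (y p)\<^sup>2 * (xv p)\<^sup>2 - 9 * sqrt (m p) * xv p)"
proof -
  let ?n = "real CARD('n)"
  have ce: "\<bar>Re (ev e p)\<bar> \<le> 2 * sqrt (m p) * xv p" "\<bar>Re (ev d p)\<bar> \<le> 2 * sqrt (m p) * xv p"
    "\<bar>Re (ev c p)\<bar> \<le> sqrt (m p) * xv p"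
  proof -
    have 1: "\<bar>Re (ev (\<Sum>a\<in>UNIV. F a * Q a) p)\<bar> \<le> vnorm F p * xv p" for F
      using abs_Re_le_cmod[of "ev (\<Sum>a\<in>UNIV. F a * Q a) p"] vnorm_cauchy_schwarz[of F p Q]
      by (simp add: vnorm_Q)
    show "\<bar>Re (ev e p)\<bar> \<le> 2 * sqrt (m p) * xv p" "\<bar>Re (ev d p)\<bar> \<le> 2 * sqrt (m p) * xv p"
      "\<bar>Re (ev c p)\<bar> \<le> sqrt (m p) * xv p"
      unfolding e_def d_def c_def
      by (rule order.trans[OF 1 mult_right_mono], intro vnorm_EV vnorm_DV vnorm_GV, rule xv_nonneg)+
  qed
  have cj_re: "ev F p + ev (cj F) p = complex_of_real (2 * Re (ev F p))" for F
    by (simp add: complex_eq_iff)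
  have e2: "2 * ev e p = complex_of_real (2 * Re (ev e p))"
    using cj_re[of e] unfolding cj_e by simp
  have X: "Re (\<Sum>a\<in>UNIV. ev (dZbar a (UX a)) p)
     = wv p * ((?n - 1) * xv p ^ 4 - (?n + 1) * (y p)\<^sup>2 * (xv p)\<^sup>2 + Re (ev e p) + Re (ev d p))"
  proof (rule Re_of_sum_cnj)
    have "(\<Sum>a\<in>UNIV. ev (dZbar a (UX a)) p) + cnj (\<Sum>a\<in>UNIV. ev (dZbar a (UX a)) p)
      = ev w p * (2 * (ev N p - 1) * ev X p * ev X p - 2 * (ev N p + 1) * ev Y p * ev X p + 2 * ev e p + (ev d p + ev (cj d) p))"
      using arg_cong[OF div_UX, of "\<lambda>F. ev F p"] by (simp add: algebra_simps)
    also have "\<dots> = complex_of_real (2 * (wv p * ((?n - 1) * xv p ^ 4 - (?n + 1) * (y p)\<^sup>2 * (xv p)\<^sup>2 + Re (ev e p) + Re (ev d p))))"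
      unfolding cj_re e2 ev_w ev_N ev_X ev_Y wv_def[symmetric]
      by (simp add: power4_eq_xxxx power2_eq_square algebra_simps)
    finally show "(\<Sum>a\<in>UNIV. ev (dZbar a (UX a)) p) + cnj (\<Sum>a\<in>UNIV. ev (dZbar a (UX a)) p) = \<dots>" .
  qed
  have U: "Re (\<Sum>a\<in>UNIV. ev (dZbar a (UY a)) p)
     = wv p * (?n * (tv p)\<^sup>2 + Re (ev c p) - ((xv p)\<^sup>2 + (y p)\<^sup>2) * (xv p)\<^sup>2)"
  proof (rule Re_of_sum_cnj)
    have "(\<Sum>a\<in>UNIV. ev (dZbar a (UY a)) p) + cnj (\<Sum>a\<in>UNIV. ev (dZbar a (UY a)) p)
      = ev w p * (- 2 * ev N p * ev t p * ev t p + (ev c p + ev (cj c) p) - 2 * ev h p * ev X p)"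
      using arg_cong[OF div_UY, of "\<lambda>F. ev F p"] by (simp add: algebra_simps)
    also have "\<dots> = complex_of_real (2 * (wv p * (?n * (tv p)\<^sup>2 + Re (ev c p) - ((xv p)\<^sup>2 + (y p)\<^sup>2) * (xv p)\<^sup>2)))"
      unfolding cj_re ev_w ev_N ev_X ev_h ev_t wv_def[symmetric]
      by (simp add: power2_eq_square algebra_simps)
    finally show "(\<Sum>a\<in>UNIV. ev (dZbar a (UY a)) p) + cnj (\<Sum>a\<in>UNIV. ev (dZbar a (UY a)) p) = \<dots>" .
  qed
  have "Re (\<Sum>a\<in>UNIV. ev (dZbar a (UU a)) p) = 2 * Re (\<Sum>a\<in>UNIV. ev (dZbar a (UX a)) p) + Re (\<Sum>a\<in>UNIV. ev (dZbar a (UY a)) p)"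
    unfolding UU_def D_add D_mult D_of_nat by (simp add: sum.distrib sum_distrib_left)
  also have "\<dots> = wv p * (2 * ((?n - 1) * xv p ^ 4 - (?n + 1) * (y p)\<^sup>2 * (xv p)\<^sup>2 + Re (ev e p) + Re (ev d p))
    + (?n * (tv p)\<^sup>2 + Re (ev c p) - ((xv p)\<^sup>2 + (y p)\<^sup>2) * (xv p)\<^sup>2))"
    unfolding X U by (simp add: algebra_simps)
  also have "\<dots> \<ge> wv p * (xv p ^ 4 + 2 * \<bar>tv p\<bar>\<^sup>2 - (2 * ?n + 3) * (y p)\<^sup>2 * (xv p)\<^sup>2 - 9 * sqrt (m p) * xv p)"
  proof (rule mult_left_mono)
    have n: "?n \<ge> 2" using card2 by simp
    \<comment> \<open>The surplus over the coefficients 1 and 2 kept in the claim.\<close>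
    have "(2 * ?n - 4) * xv p ^ 4 \<ge> 0" "(?n - 2) * (tv p)\<^sup>2 \<ge> 0" using n by simp_all
    then show "xv p ^ 4 + 2 * \<bar>tv p\<bar>\<^sup>2 - (2 * ?n + 3) * (y p)\<^sup>2 * (xv p)\<^sup>2 - 9 * sqrt (m p) * xv p
      \<le> 2 * ((?n - 1) * xv p ^ 4 - (?n + 1) * (y p)\<^sup>2 * (xv p)\<^sup>2 + Re (ev e p) + Re (ev d p))
    + (?n * (tv p)\<^sup>2 + Re (ev c p) - ((xv p)\<^sup>2 + (y p)\<^sup>2) * (xv p)\<^sup>2)"
      using ce by (simp add: power4_eq_xxxx power2_eq_square algebra_simps)
  qed (use wv_pos[of p] in simp)
  finally show ?thesis .
qed

end

section \<open>Vanishing of the Jerison--Lee tensors\<close>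

text \<open>The set where g is positive is open and null, hence empty.\<close>

lemma continuous_nonneg_integral_le_0:
  fixes g :: "'a::euclidean_space \<Rightarrow> real"
  assumes g: "continuous_on UNIV g" "integrable lborel g" "\<And>p. g p \<ge> 0" and int: "(\<integral>p. g p \<partial>lborel) \<le> 0"
  shows "g p = 0"
proof -
  have "(\<integral>p. g p \<partial>lborel) = 0"
    using int Bochner_Integration.integral_nonneg[of lborel g] g(3) by (simp add: antisym)
  then have "AE p in lborel. g p = 0"
    using integral_nonneg_eq_0_iff_AE[OF g(2)] g(3) by simp
  moreover have op: "open {p. g p > 0}"
    using g(1) by (intro open_Collect_less continuous_on_const)
  ultimately have "{p. g p > 0} \<in> null_sets lborel"
    using g(3) by (intro AE_iff_null_sets[THEN iffD2]) (auto elim!: eventually_mono)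
  then have "negligible {p. g p > 0}"
    by (simp add: negligible_iff_null_sets null_sets_completionI)
  then have "{p. g p > 0} = {}"
    using open_not_negligible[OF op] by blast
  then show ?thesis using g(3)[of p] by (metis (mono_tags) empty_iff mem_Collect_eq order_le_less)
qed

text \<open>The real part of Zbar applied to the power k + 1 of the cutoff times F, written out by
  the product rule.\<close>

definition flux :: "nat \<Rightarrow> real \<Rightarrow> 'n::finite smf \<Rightarrow> 'n \<Rightarrow> 'n heis \<Rightarrow> real" where
  "flux k R F a p = Re (complex_of_real (cutoff R p ^ Suc k) * ev (dZbar a F) p
      - complex_of_real (real (Suc k) / R ^ 4 * cutoff R p ^ k) * ev (dZbar a heis4_smf) p * ev F p)"

lemma flux_integral:
  assumes "k \<ge> 1" "R > 0"
  shows "integrable lborel (flux k R F a)" "(\<integral>p. flux k R F a p \<partial>lborel) = 0"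
  using parts_dZbar[OF assms] by (simp_all add: flux_def[abs_def])

lemma flux_outside: "k \<ge> 1 \<Longrightarrow> R > 0 \<Longrightarrow> p \<notin> heis_ball R \<Longrightarrow> flux k R F a p = 0"
  by (simp add: flux_def cutoff_outside power_0_left)

text \<open>Cauchy-Schwarz with the gradient bound 2R^3 against R^4 leaves 2(k+1)/R: this is 12/R
  for k = 5 and 8/R for k = 3, the numbers used in \<open>absorb\<close>.\<close>

lemma sum_flux_ge:
  assumes R: "R > 0" and p: "p \<in> heis_ball R"
  shows "(\<Sum>a\<in>UNIV. flux k R (F a) a p)
    \<ge> cutoff R p ^ Suc k * Re (\<Sum>a\<in>UNIV. ev (dZbar a (F a)) p) - 2 * real (Suc k) / R * cutoff R p ^ k * vnorm F p"
proof -
  let ?c = "real (Suc k) / R ^ 4 * cutoff R p ^ k"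
  have c: "?c \<ge> 0" using R cutoff_range(1)[OF R, of p] by simp
  have "(\<Sum>a\<in>UNIV. flux k R (F a) a p)
    = cutoff R p ^ Suc k * Re (\<Sum>a\<in>UNIV. ev (dZbar a (F a)) p) - ?c * Re (\<Sum>a\<in>UNIV. ev (dZbar a heis4_smf) p * ev (F a) p)"
  proof -
    have "(\<Sum>a\<in>UNIV. flux k R (F a) a p) = Re (\<Sum>a\<in>UNIV. complex_of_real (cutoff R p ^ Suc k) * ev (dZbar a (F a)) p
      - complex_of_real ?c * (ev (dZbar a heis4_smf) p * ev (F a) p))"
      unfolding flux_def by (simp only: Re_sum mult.assoc)
    also have "\<dots> = Re (complex_of_real (cutoff R p ^ Suc k) * (\<Sum>a\<in>UNIV. ev (dZbar a (F a)) p)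
       - complex_of_real ?c * (\<Sum>a\<in>UNIV. ev (dZbar a heis4_smf) p * ev (F a) p))"
      by (simp only: sum_subtractf sum_distrib_left)
    finally show ?thesis by (simp only: minus_complex.simps Re_complex_of_real times_complex.simps Im_complex_of_real mult_zero_left diff_zero)
  qed
  moreover have "?c * Re (\<Sum>a\<in>UNIV. ev (dZbar a heis4_smf) p * ev (F a) p) \<le> ?c * (2 * R ^ 3 * vnorm F p)"
  proof (rule mult_left_mono[OF _ c])
    have "Re (\<Sum>a\<in>UNIV. ev (dZbar a heis4_smf) p * ev (F a) p) \<le> vnorm (\<lambda>a. dZbar a heis4_smf) p * vnorm F p"
      using vnorm_cauchy_schwarz[of "\<lambda>a. dZbar a heis4_smf" p F] complex_Re_le_cmod order_trans by blast
    also have "\<dots> \<le> 2 * R ^ 3 * vnorm F p"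
      by (rule mult_right_mono[OF vnorm_grad_heis4_smf[OF R p] vnorm_nonneg])
    finally show "Re (\<Sum>a\<in>UNIV. ev (dZbar a heis4_smf) p * ev (F a) p) \<le> 2 * R ^ 3 * vnorm F p" .
  qed
  moreover have "?c * (2 * R ^ 3 * vnorm F p) = 2 * real (Suc k) / R * cutoff R p ^ k * vnorm F p"
    using R by (simp add: field_simps eval_nat_numeral)
  ultimately show ?thesis by linarith
qed

lemma cutoff_mono: "0 < R \<Longrightarrow> R \<le> S \<Longrightarrow> cutoff R p \<le> cutoff S p"
  unfolding cutoff_def using heis4_nonneg[of p]
  by (intro max.mono order.refl diff_left_mono divide_left_mono power_mono mult_pos_pos zero_less_power) auto

lemma cutoff_pos: "heis4 p < R ^ 4 \<Longrightarrow> cutoff R p > 0"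
  using heis4_nonneg[of p] by (simp add: cutoff_def less_max_iff_disj divide_less_eq)

context jerison_lee_decay
begin

text \<open>The cutoff powers are 6 and 4; their gap of two matches the weight 1/R^2, so that both
  parts scale alike in \<open>absorb\<close>.\<close>

definition Phi where "Phi R p = (\<Sum>a\<in>UNIV. flux 5 R (VF a) a p) + 60000 * (1 / R)\<^sup>2 * (\<Sum>a\<in>UNIV. flux 3 R (UU a) a p)"

lemma Phi_integral:
  assumes "R > 0"
  shows "integrable lborel (Phi R)" "(\<integral>p. Phi R p \<partial>lborel) = 0"
proof -
  have i: "integrable lborel (\<lambda>p. \<Sum>a\<in>UNIV. flux k R (F a) a p)" "(\<integral>p. (\<Sum>a\<in>UNIV. flux k R (F a) a p) \<partial>lborel) = 0"
    if "k \<ge> 1" for k and F :: "'n \<Rightarrow> 'n smf"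
  proof -
    show "integrable lborel (\<lambda>p. \<Sum>a\<in>UNIV. flux k R (F a) a p)"
      by (intro Bochner_Integration.integrable_sum flux_integral(1)[OF that assms])
    have "(\<integral>p. (\<Sum>a\<in>UNIV. flux k R (F a) a p) \<partial>lborel) = (\<Sum>a\<in>UNIV. \<integral>p. flux k R (F a) a p \<partial>lborel)"
      by (rule Bochner_Integration.integral_sum) (rule flux_integral(1)[OF that assms])
    then show "(\<integral>p. (\<Sum>a\<in>UNIV. flux k R (F a) a p) \<partial>lborel) = 0"
      by (simp add: flux_integral(2)[OF that assms])
  qed
  have i5: "integrable lborel (\<lambda>p. \<Sum>a\<in>UNIV. flux 5 R (VF a) a p)" "(\<integral>p. (\<Sum>a\<in>UNIV. flux 5 R (VF a) a p) \<partial>lborel) = 0"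
    and i3: "integrable lborel (\<lambda>p. 60000 * (1 / R)\<^sup>2 * (\<Sum>a\<in>UNIV. flux 3 R (UU a) a p))"
      "(\<integral>p. 60000 * (1 / R)\<^sup>2 * (\<Sum>a\<in>UNIV. flux 3 R (UU a) a p) \<partial>lborel) = 0"
    using i[of 5 VF] i[of 3 UU] by (simp_all del: Bochner_Integration.integral_sum)
  show "integrable lborel (Phi R)" "(\<integral>p. Phi R p \<partial>lborel) = 0"
    unfolding Phi_def[abs_def] using Bochner_Integration.integrable_add[OF i5(1) i3(1)]
      Bochner_Integration.integral_add[OF i5(1) i3(1)] i5(2) i3(2) by simp_all
qed

definition KK where "KK = absorb_const (2 * real CARD('n) + 3)"

lemma KK_nonneg: "KK \<ge> 0" by (simp add: KK_def absorb_const_def)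

text \<open>The gradient terms disappear pointwise, so only the single fact that \<open>Phi\<close>
  integrates to 0 is needed afterwards.\<close>

lemma Phi_ge:
  assumes R: "R > 0" and p: "p \<in> heis_ball R"
  shows "Phi R p \<ge> wv p * (cutoff R p ^ 6 * m p / 2 - KK * ((1 / R)\<^sup>2 * ((y p)\<^sup>2)\<^sup>2 + (1 / R) ^ 6))"
proof -
  let ?\<psi> = "cutoff R p" and ?r = "1 / R" and ?\<mu> = "sqrt (m p)" and ?x = "xv p" and ?y = "(y p)\<^sup>2" and ?t = "\<bar>tv p\<bar>"
  have \<psi>: "?\<psi> \<ge> 0" "?\<psi> \<le> 1" using cutoff_range[OF R, of p] by auto
  have r: "?r > 0" using R by simp
  have w: "wv p \<ge> 0" using wv_pos[of p] by simp
  have 1: "(\<Sum>a\<in>UNIV. flux 5 R (VF a) a p) \<ge> wv p * (?\<psi> ^ 6 * ?\<mu>\<^sup>2 - 12 * ?r * ?\<psi> ^ 5 * (?\<mu> * (4 * ?x\<^sup>2 + 4 * ?y + 11 * ?t)))"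
  proof -
    have "2 * real (Suc 5) / R * ?\<psi> ^ 5 * vnorm VF p
       \<le> 2 * real (Suc 5) / R * ?\<psi> ^ 5 * (wv p * (?\<mu> * (4 * ?x\<^sup>2 + 4 * ?y + 11 * ?t)))"
      using R \<psi> by (intro mult_left_mono vnorm_VF) auto
    then show ?thesis
      using sum_flux_ge[OF R p, where k = 5 and F = VF] m_nonneg[of p] unfolding div_VF by (simp add: algebra_simps)
  qed
  have 2: "(\<Sum>a\<in>UNIV. flux 3 R (UU a) a p) \<ge> wv p * (?\<psi> ^ 4 * (?x ^ 4 + 2 * ?t\<^sup>2 - (2 * real CARD('n) + 3) * ?y * ?x\<^sup>2 - 9 * ?\<mu> * ?x)
      - 8 * ?r * ?\<psi> ^ 3 * (2 * ?x ^ 3 + ?t * ?x))"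
  proof -
    have "2 * real (Suc 3) / R * ?\<psi> ^ 3 * vnorm UU p \<le> 2 * real (Suc 3) / R * ?\<psi> ^ 3 * (wv p * (2 * ?x ^ 3 + ?t * ?x))"
      using R \<psi> by (intro mult_left_mono vnorm_UU) auto
    moreover have "?\<psi> ^ Suc 3 * (wv p * (?x ^ 4 + 2 * ?t\<^sup>2 - (2 * real CARD('n) + 3) * ?y * ?x\<^sup>2 - 9 * ?\<mu> * ?x))
       \<le> ?\<psi> ^ Suc 3 * Re (\<Sum>a\<in>UNIV. ev (dZbar a (UU a)) p)"
      using \<psi> by (intro mult_left_mono div_UU) auto
    moreover have "wv p * (?\<psi> ^ 4 * z - 8 * ?r * ?\<psi> ^ 3 * z') = ?\<psi> ^ Suc 3 * (wv p * z) - 2 * real (Suc 3) / R * ?\<psi> ^ 3 * (wv p * z')" for z z'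
      by (simp add: algebra_simps)
    ultimately show ?thesis
      using sum_flux_ge[OF R p, where k = 3 and F = UU] by simp
  qed
  have "wv p * (?\<psi> ^ 6 * ?\<mu>\<^sup>2 / 2 - KK * (?r\<^sup>2 * ?y\<^sup>2 + ?r ^ 6))
    \<le> wv p * (?\<psi> ^ 6 * ?\<mu>\<^sup>2 - 12 * ?r * ?\<psi> ^ 5 * (?\<mu> * (4 * ?x\<^sup>2 + 4 * ?y + 11 * ?t))
      + 60000 * ?r\<^sup>2 * (?\<psi> ^ 4 * (?x ^ 4 + 2 * ?t\<^sup>2 - (2 * real CARD('n) + 3) * ?y * ?x\<^sup>2 - 9 * ?\<mu> * ?x))
      - 60000 * ?r\<^sup>2 * (8 * ?r * ?\<psi> ^ 3 * (2 * ?x ^ 3 + ?t * ?x)))"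
    unfolding KK_def by (rule mult_left_mono[OF absorb[OF \<psi> r] w])
  also have "\<dots> = wv p * (?\<psi> ^ 6 * ?\<mu>\<^sup>2 - 12 * ?r * ?\<psi> ^ 5 * (?\<mu> * (4 * ?x\<^sup>2 + 4 * ?y + 11 * ?t)))
      + 60000 * ?r\<^sup>2 * (wv p * (?\<psi> ^ 4 * (?x ^ 4 + 2 * ?t\<^sup>2 - (2 * real CARD('n) + 3) * ?y * ?x\<^sup>2 - 9 * ?\<mu> * ?x)
      - 8 * ?r * ?\<psi> ^ 3 * (2 * ?x ^ 3 + ?t * ?x)))"
    by (simp only: algebra_simps)
  also have "\<dots> \<le> Phi R p"
    unfolding Phi_def by (intro add_mono 1 mult_left_mono 2) simp
  finally show ?thesis using m_nonneg[of p] by simp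
qed

definition C0 where "C0 = KK * (c1 ^ (2 * CARD('n) + 2) + 16 * c1 ^ (2 * (CARD('n) - 1)))"

lemma c1_pos: "c1 > 0"
proof -
  have "0 < y 0 * (1 + heis_norm (0 :: 'n heis))"
    using y_pos[of 0] heis_norm_nonneg[of "0 :: 'n heis"] by (intro mult_pos_pos) auto
  then show ?thesis using y_le[of 0] by linarith
qed

lemma C0_nonneg: "C0 \<ge> 0"
  using KK_nonneg c1_pos by (simp add: C0_def)

text \<open>The first term is y^{2n+2}, already of order \<open>decay\<close>. The weight alone
  lacks four powers of 1 + |xi|, which is at most 2R on the ball; the resulting 16 R^4 turns R^{-6}
  into R^{-2}.\<close>

lemma weight_decay:
  assumes R: "R \<ge> 1" and p: "p \<in> heis_ball R"
  shows "wv p * (KK * ((1 / R)\<^sup>2 * ((y p)\<^sup>2)\<^sup>2 + (1 / R) ^ 6)) \<le> C0 * (1 / R)\<^sup>2 * decay p"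
proof -
  let ?s = "1 + heis_norm p"
  have s: "?s \<ge> 1" "?s \<le> 2 * R" "?s > 0" using heis_norm_nonneg[of p] R p by (auto simp: heis_ball_iff)
  have y: "y p \<le> c1 / ?s" using y_le[of p] s by (simp add: field_simps)
  have yk: "y p ^ k \<le> c1 ^ k / ?s ^ k" for k
    using power_mono[OF y, of k] y_pos[of p] by (simp add: power_divide)
  have n: "2 * (CARD('n) - 1) + 4 = 2 * CARD('n) + 2" using card2 by simp
  have a: "wv p * ((y p)\<^sup>2)\<^sup>2 \<le> c1 ^ (2 * CARD('n) + 2) * decay p"
  proof -
    have "wv p * ((y p)\<^sup>2)\<^sup>2 = y p ^ (2 * CARD('n) + 2)"
      unfolding wv_def n[symmetric] power_add by (simp flip: power_mult)
    then show ?thesis using yk[of "2 * CARD('n) + 2"] by (simp add: decay_def)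
  qed
  have b: "wv p \<le> 16 * c1 ^ (2 * (CARD('n) - 1)) * R ^ 4 * decay p"
  proof -
    have "wv p \<le> c1 ^ (2 * (CARD('n) - 1)) / ?s ^ (2 * (CARD('n) - 1))"
      unfolding wv_def by (rule yk)
    also have "\<dots> = c1 ^ (2 * (CARD('n) - 1)) * ?s ^ 4 * decay p"
      unfolding decay_def n[symmetric] power_add using s by simp
    also have "\<dots> \<le> c1 ^ (2 * (CARD('n) - 1)) * (2 * R) ^ 4 * decay p"
      using s c1_pos decay_nonneg[of p] by (intro mult_right_mono mult_left_mono power_mono) auto
    finally show ?thesis by (simp add: mult_ac)
  qed
  have "wv p * (KK * ((1 / R)\<^sup>2 * ((y p)\<^sup>2)\<^sup>2 + (1 / R) ^ 6))
    = KK * ((1 / R)\<^sup>2 * (wv p * ((y p)\<^sup>2)\<^sup>2) + (1 / R) ^ 6 * wv p)"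
    by (simp only: algebra_simps)
  also have "\<dots> \<le> KK * ((1 / R)\<^sup>2 * (c1 ^ (2 * CARD('n) + 2) * decay p) + (1 / R) ^ 6 * (16 * c1 ^ (2 * (CARD('n) - 1)) * R ^ 4 * decay p))"
    using a b KK_nonneg R by (intro mult_left_mono add_mono) auto
  also have "\<dots> = KK * ((1 / R)\<^sup>2 * (c1 ^ (2 * CARD('n) + 2) * decay p) + (1 / R)\<^sup>2 * (16 * c1 ^ (2 * (CARD('n) - 1)) * decay p))"
  proof -
    have "(1 / R) ^ 6 * (16 * z * R ^ 4 * z') = (1 / R)\<^sup>2 * (16 * z * z')" for z z'
      using R by (simp add: field_simps eval_nat_numeral)
    then show ?thesis by (simp only:)
  qed
  also have "\<dots> = C0 * (1 / R)\<^sup>2 * decay p"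
    by (simp only: C0_def algebra_simps)
  finally show ?thesis .
qed

definition Psi where "Psi R p = wv p * (cutoff R p ^ 6 * m p)"

lemma Psi_nonneg: "R > 0 \<Longrightarrow> Psi R p \<ge> 0"
  using wv_pos[of p] m_nonneg[of p] cutoff_range(1)[of R p] by (simp add: Psi_def)

text \<open>Recognising the pointwise sum of squares as the value of the ring element
  \<open>w * M\<close> gives continuity at once.\<close>

lemma Psi_eq: "Psi R p = cutoff R p ^ 6 * Re (ev (w * M) p)"
  unfolding ev_simps ev_w ev_M wv_def[symmetric] by (simp add: Psi_def)

lemma continuous_on_Psi: "continuous_on S (Psi R)"
  unfolding Psi_eq[abs_def] by (intro continuous_intros continuous_on_cutoff continuous_on_ev)

lemma integrable_Psi: "R > 0 \<Longrightarrow> integrable lborel (Psi R)"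
  by (rule integrable_compact_support[OF compact_heis_ball continuous_on_Psi]) (auto simp: Psi_def cutoff_outside)

lemma integral_Psi_le:
  assumes R: "R \<ge> 1"
  shows "(\<integral>p. Psi R p \<partial>lborel) \<le> 2 * C0 * (1 / R)\<^sup>2 * (LINT p:heis_ball R|lborel. decay (p :: 'n heis))"
proof -
  have R0: "R > 0" using R by simp
  let ?D = "\<lambda>p :: 'n heis. C0 * (1 / R)\<^sup>2 * (indicat_real (heis_ball R) p *\<^sub>R decay p)"
  have D: "integrable lborel (\<lambda>p :: 'n heis. indicat_real (heis_ball R) p *\<^sub>R decay p)"
    using set_integrable_heis_ball[OF R0 continuous_on_decay] unfolding set_integrable_def .
  have le: "Psi R p / 2 \<le> Phi R p + ?D p" for p
  proof (cases "p \<in> heis_ball R")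
    case True
    have "Psi R p / 2 - wv p * (KK * ((1 / R)\<^sup>2 * ((y p)\<^sup>2)\<^sup>2 + (1 / R) ^ 6)) \<le> Phi R p"
      using Phi_ge[OF R0 True] by (simp add: Psi_def right_diff_distrib)
    then show ?thesis using weight_decay[OF R True] True by simp
  next
    case False
    then show ?thesis by (simp add: Psi_def Phi_def cutoff_outside[OF R0] flux_outside[OF _ R0])
  qed
  have "(\<integral>p. Psi R p / 2 \<partial>lborel) \<le> (\<integral>p. Phi R p + ?D p \<partial>lborel)"
    by (rule integral_mono[OF _ _ le]) (use integrable_Psi[OF R0] Phi_integral[OF R0] D in auto)
  also have "\<dots> = C0 * (1 / R)\<^sup>2 * (LINT p:heis_ball R|lborel. decay (p :: 'n heis))"
    using Phi_integral[OF R0] D by (subst Bochner_Integration.integral_add) (auto simp: set_lebesgue_integral_def)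
  finally show ?thesis by simp
qed

text \<open>For fixed S the integral of \<open>Psi S\<close> increases when S is replaced by 2^k,
  and there it is at most a multiple of (J + kB)/4^k, which tends to 0.\<close>

theorem m_eq_0: "m p = 0"
proof -
  \<comment> \<open>A power of two, so that S is one of the radii 2^k, and large enough for the
    cutoff at scale S to be positive at p.\<close>
  obtain j where j: "(1 + heis4 p) < 2 ^ j"
    using real_arch_pow[of 2 "1 + heis4 p"] by auto
  define S :: real where "S = 2 ^ j"
  have S: "S \<ge> 1" by (simp add: S_def)
  have "heis4 p < S" using j by (simp add: S_def)
  also have "S \<le> S ^ 4" using S self_le_power[of S 4] by simp
  finally have cp: "cutoff S p > 0" by (rule cutoff_pos)
  define J where "J = (LINT p:heis_ball 1|lborel. decay (p :: 'n heis))"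
  define B :: real where "B = 2 ^ (4 * CARD('n) + 3)"
  have bound: "(\<integral>p. Psi S p \<partial>lborel) \<le> 2 * C0 * (J * (1/4) ^ k + B * (real k * (1/4) ^ k))" if "k \<ge> j" for k
  proof -
    let ?R = "2 ^ k :: real"
    have SR: "S \<le> ?R" using that by (simp add: S_def power_increasing)
    have "(\<integral>p. Psi S p \<partial>lborel) \<le> (\<integral>p. Psi ?R p \<partial>lborel)"
    proof (rule integral_mono)
      show "integrable lborel (Psi S)" "integrable lborel (Psi ?R)"
        using S by (auto intro: integrable_Psi)
      show "Psi S q \<le> Psi ?R q" for q
        unfolding Psi_def using S SR wv_pos[of q] m_nonneg[of q] cutoff_range(1)[of S q]
        by (intro mult_left_mono mult_right_mono power_mono cutoff_mono) auto
    qed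
    also have "\<dots> \<le> 2 * C0 * (1 / ?R)\<^sup>2 * (LINT p:heis_ball ?R|lborel. decay (p :: 'n heis))"
      by (rule integral_Psi_le) simp
    also have "\<dots> \<le> 2 * C0 * (1 / ?R)\<^sup>2 * (J + real k * B)"
      unfolding J_def B_def by (rule mult_left_mono[OF decay_integral_growth]) (simp add: C0_nonneg)
    also have "(1 / ?R)\<^sup>2 = (1/4) ^ k"
    proof -
      have "(1 / ?R)\<^sup>2 = ((1/2)\<^sup>2) ^ k" by (simp only: power_one_over flip: power_mult) (simp only: mult.commute)
      then show ?thesis by (simp add: power2_eq_square)
    qed
    finally show ?thesis by (simp add: algebra_simps)
  qed
  have "(\<lambda>k. 2 * C0 * (J * (1/4) ^ k + B * (real k * (1/4) ^ k))) \<longlonglongrightarrow> 2 * C0 * (J * 0 + B * 0)"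
    by (intro tendsto_intros LIMSEQ_power_zero powser_times_n_limit_0) auto
  then have "(\<integral>p. Psi S p \<partial>lborel) \<le> 2 * C0 * (J * 0 + B * 0)"
    by (rule LIMSEQ_le_const) (use bound in blast)
  then have "Psi S p = 0"
    using S by (intro continuous_nonneg_integral_le_0[OF continuous_on_Psi integrable_Psi Psi_nonneg]) auto
  then show ?thesis using cp wv_pos[of p] by (simp add: Psi_def)
qed

lemma GV_zero: "GV a = 0" and EM_zero: "EM a b = 0" and DM_zero: "DM a b = 0"
proof -
  have *: "ev (GV a) p = 0 \<and> ev (EM a b) p = 0 \<and> ev (DM a b) p = 0" for p
  proof -
    let ?e = "(\<Sum>a\<in>UNIV. \<Sum>b\<in>UNIV. (cmod (ev (EM a b) p))\<^sup>2)"
    let ?d = "(\<Sum>a\<in>UNIV. \<Sum>b\<in>UNIV. (cmod (ev (DM a b) p))\<^sup>2)"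
    have "0 \<le> (\<Sum>a\<in>UNIV. \<Sum>b\<in>UNIV. \<Sum>k\<in>UNIV. (cmod (ev (DM a b * Q k + EM a k * P b) p))\<^sup>2)"
      by (intro sum_nonneg) auto
    moreover have e: "0 \<le> ?e" and d: "0 \<le> ?d" by (intro sum_nonneg; simp)+
    then have "0 \<le> (y p)\<^sup>2 * (?e + ?d)" by simp
    moreover have "0 \<le> (vnorm (\<lambda>a. GV a + DV a) p)\<^sup>2" "0 \<le> (vnorm (\<lambda>a. GV a - EV a) p)\<^sup>2" "0 \<le> (vnorm GV p)\<^sup>2"
      by simp_all
    ultimately have "(y p)\<^sup>2 * (?e + ?d) = 0" "(vnorm GV p)\<^sup>2 = 0"
      using m_eq_0[of p] unfolding m_def by linarith+
    then have "?e = 0" "?d = 0" "(\<Sum>a\<in>UNIV. (cmod (ev (GV a) p))\<^sup>2) = 0"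
      using y_pos[of p] e d by (auto simp: vnorm_sq add_nonneg_eq_0_iff)
    then show ?thesis by (simp add: sum_nonneg_eq_0_iff sum_nonneg)
  qed
  then show "GV a = 0" "EM a b = 0" "DM a b = 0" by (auto intro: smf_eqI)
qed

end

section \<open>From vanishing tensors to bubbles\<close>

text \<open>Once the t-derivative vanishes, sums and differences of Z and Zbar are the ordinary
  partial derivatives.\<close>

lemma smf_constant:
  fixes F :: "'n::finite smf"
  assumes Z: "\<And>a. dZ a F = 0" and W: "\<And>a. dZbar a F = 0" and T: "dT F = 0"
  shows "F = cc (ev F 0)"
proof (rule smf_eqI)
  fix p
  have T': "dd (0, 1) F = 0" using T by (simp add: dT_def)
  have x: "ev (dd (axis a 1, 0) F) q = 0" for a q
    using arg_cong[OF Z[of a], of "\<lambda>G. ev G q"] arg_cong[OF W[of a], of "\<lambda>G. ev G q"]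
    by (simp add: dZ_def dZbar_def T')
  have y: "ev (dd (axis a \<i>, 0) F) q = 0" for a q
    using arg_cong[OF Z[of a], of "\<lambda>G. ev G q"] x[of a q] by (simp add: dZ_def T')
  have "(ev F has_derivative (\<lambda>v. 0)) (at q)" for q
  proof -
    have D: "(ev F has_derivative (\<lambda>v. ddir v (ev F) q)) (at q)"
      by (rule has_derivative_ddir[OF smooth_differentiable[OF smooth_ev]])
    have "(\<lambda>v. ddir v (ev F) q) = (\<lambda>v. 0)"
    proof (rule linear_eq_stdbasis[OF has_derivative_linear[OF D] linear_zero])
      fix v :: "'n heis"
      assume "v \<in> Basis"
      then consider a where "v = (axis a 1, 0)" | a where "v = (axis a \<i>, 0)" | "v = (0, 1)"
        by (auto simp: Basis_prod_def Basis_vec_def Basis_complex_def)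
      then show "ddir v (ev F) q = 0"
        unfolding ev_dd[symmetric] using x y T' by cases auto
    qed
    with D show ?thesis by simp
  qed
  then obtain k where "\<And>q. ev F q = k"
    using has_derivative_zero_constant[of UNIV "ev F"] by auto
  then show "ev F p = ev (cc (ev F 0)) p" by simp
qed

text \<open>T is a multiple of the commutator of Z and Zbar.\<close>

lemma dT_0_if_dZ_dZbar_0:
  assumes "dZ a F = 0" "dZbar a F = 0"
  shows "dT F = 0"
proof (rule smf_eqI)
  fix p
  have "dZbar a (dZ a F) - dZ a (dZbar a F) = 2 * cc \<i> * dT F" by (simp add: dZ_dZbar)
  then have "2 * cc \<i> * dT F = 0" by (simp add: assms)
  from arg_cong[OF this, of "\<lambda>G. ev G p"] show "ev (dT F) p = ev 0 p" by simp
qed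

text \<open>The restriction of the last holomorphic coordinate to the boundary of the Siegel domain,
  where its imaginary part is |z|^2.\<close>

definition hol_coord :: "'n::finite smf" where
  "hol_coord = tt + cc \<i> * (\<Sum>b\<in>UNIV. zz b * cj (zz b))"

lemma ev_hol_coord: "ev hol_coord p = complex_of_real (snd p) + \<i> * complex_of_real ((norm (fst p))\<^sup>2)"
  unfolding hol_coord_def ev_simps(3,6,7,10) ev_sum_zz ..

lemma hol_coord_derivs: "dZ a hol_coord = 2 * cc \<i> * cj (zz a)" "dZbar a hol_coord = 0" "dT hol_coord = 1"
proof -
  have "dZ a (\<Sum>b\<in>UNIV. zz b * cj (zz b)) = (\<Sum>b\<in>UNIV. if a = b then cj (zz b) else 0)"
    unfolding D_sum D_mult cj_D(3)[symmetric] dZ_zz dZbar_zz by (rule sum.cong) auto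
  then show "dZ a hol_coord = 2 * cc \<i> * cj (zz a)"
    by (simp add: hol_coord_def D_add D_mult dZ_tt)
  have "dZbar a (\<Sum>b\<in>UNIV. zz b * cj (zz b)) = (\<Sum>b\<in>UNIV. if a = b then zz b else 0)"
    unfolding D_sum D_mult dZbar_zz cj_D(2)[symmetric] dZ_zz by (rule sum.cong) auto
  then show "dZbar a hol_coord = 0"
    by (simp add: hol_coord_def D_add D_mult dZbar_tt)
  show "dT hol_coord = 1"
    by (simp add: hol_coord_def D_add D_mult D_sum dT_tt dT_zz flip: cj_D(1))
qed

text \<open>The minimum of |z|^2 + Im(z.mu) is -|mu|^2/4. If Im lam were at most |mu|^2/4, moving
  one coordinate of the minimiser by s would make the imaginary part 0, and t could then cancel the
  real part.\<close>

lemma im_gt_if_nonvanishing: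
  fixes mu :: "complex ^ 'n::finite"
  assumes nz: "\<And>z t. complex_of_real t + \<i> * complex_of_real ((norm z)\<^sup>2) + (\<Sum>a\<in>UNIV. z $ a * mu $ a) + lam \<noteq> 0"
  shows "Im lam > (norm mu)\<^sup>2 / 4"
proof (rule ccontr)
  assume "\<not> Im lam > (norm mu)\<^sup>2 / 4"
  then have le: "(norm mu)\<^sup>2 / 4 - Im lam \<ge> 0" by simp
  define s where "s = sqrt ((norm mu)\<^sup>2 / 4 - Im lam)"
  have s2: "s\<^sup>2 = (norm mu)\<^sup>2 / 4 - Im lam" using le by (simp add: s_def)
  define b where "b = (SOME b::'n. True)"
  define \<omega> where "\<omega> a = (if a = b then complex_of_real s else 0)" for a
  define z :: "complex ^ 'n" where "z = (\<chi> a. \<omega> a - \<i> / 2 * cnj (mu $ a))"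
  \<comment> \<open>completing the square\<close>
  have sq: "(cmod (\<omega> - \<i> / 2 * cnj m))\<^sup>2 + Im ((\<omega> - \<i> / 2 * cnj m) * m) = (cmod \<omega>)\<^sup>2 - (cmod m)\<^sup>2 / 4" for \<omega> m :: complex
    unfolding cmod_power2 by (simp add: power2_eq_square field_simps)
  have "(norm z)\<^sup>2 + Im (\<Sum>a\<in>UNIV. z $ a * mu $ a) = (\<Sum>a\<in>UNIV. (cmod (\<omega> a))\<^sup>2 - (cmod (mu $ a))\<^sup>2 / 4)"
    unfolding norm_sq_vec Im_sum sum.distrib[symmetric] by (rule sum.cong[OF refl]) (simp only: z_def vec_lambda_beta sq)
  also have "\<dots> = (\<Sum>a\<in>UNIV. if a = b then s\<^sup>2 else 0) - (norm mu)\<^sup>2 / 4"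
    unfolding norm_sq_vec sum_subtractf sum_divide_distrib \<omega>_def
    by (intro arg_cong2[of _ _ _ _ "(-)"] sum.cong refl) auto
  also have "\<dots> = - Im lam" by (simp add: s2)
  finally have im: "(norm z)\<^sup>2 + Im (\<Sum>a\<in>UNIV. z $ a * mu $ a) + Im lam = 0" by simp
  define t where "t = - Re ((\<Sum>a\<in>UNIV. z $ a * mu $ a) + lam)"
  have "complex_of_real t + \<i> * complex_of_real ((norm z)\<^sup>2) + (\<Sum>a\<in>UNIV. z $ a * mu $ a) + lam = 0"
    using im by (simp add: complex_eq_iff t_def del: of_real_power)
  with nz show False by blast
qed

context jerison_lee
begin

text \<open>The ring has no division, so e^{-2f} is carried along as an element \<open>Yi\<close>
  with its defining relation.\<close>

context
  fixes Yi
  assumes GV0: "\<And>a. GV a = 0" and EM0: "\<And>a b. EM a b = 0" and DM0: "\<And>a b. DM a b = 0"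
    and Yi: "Yi * Y = 1"
begin

text \<open>For a bubble, $q$ is a multiple of $t + i|z|^2 + z\cdot\mu + \lambda$.\<close>

definition q where "q = (h + t) * Yi"

lemma DV_EV_zero: "DV a = 0" "EV a = 0"
  by (simp_all add: DV_def EV_def EM0 DM0)

lemma g_derivs: "dZ a g = 2 * g * P a" "dZbar a g = 0" "dZ a (h + t) = 0" "dZbar a (h + t) = 2 * (h + t) * Q a"
proof -
  show 1: "dZ a g = 2 * g * P a" by (simp add: dZ_g DV_EV_zero GV0)
  show 2: "dZbar a g = 0" by (simp add: dZbar_g DV_EV_zero GV0)
  show "dZ a (h + t) = 0" using arg_cong[OF 2, of cj] by (simp add: cj_D cj_rules)
  show "dZbar a (h + t) = 2 * (h + t) * Q a" using arg_cong[OF 1, of cj] by (simp add: cj_D cj_rules)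
qed

lemma Yi_deriv: "dZ a Yi = - 2 * Yi * P a" "dZbar a Yi = - 2 * Yi * Q a"
proof -
  have *: "D = - 2 * Yi * F" if "Yi * (2 * Y * F) + D * Y = 0" for D F
  proof -
    have "D = (D * Y) * Yi" using Yi by (simp add: mult_ac)
    also have "D * Y = - (Yi * (2 * Y * F))" using that by (simp add: eq_neg_iff_add_eq_0 add.commute)
    also have "- (Yi * (2 * Y * F)) * Yi = - 2 * (Yi * Y) * Yi * F" by (simp add: mult_ac)
    finally show ?thesis by (simp add: Yi)
  qed
  show "dZ a Yi = - 2 * Yi * P a"
    by (rule *) (use arg_cong[OF Yi, of "dZ a"] in \<open>simp add: D_mult dZ_Y P_def\<close>)
  show "dZbar a Yi = - 2 * Yi * Q a"
    by (rule *) (use arg_cong[OF Yi, of "dZbar a"] in \<open>simp add: D_mult dZbar_Y\<close>)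
qed

text \<open>The factor h + t has Zbar-derivative 2Q times itself, and \<open>Yi\<close> has -2Q
  times itself: division by Y is exactly what makes q CR holomorphic.\<close>

lemma q_derivs: "dZbar a q = 0" "dZ a q = - 2 * q * P a"
  unfolding q_def D_mult Yi_deriv g_derivs by (simp_all add: algebra_simps)

text \<open>The logarithmic Z-derivatives of q and g are -2P and 2P, and both functions are killed
  by Zbar.\<close>

lemma qg_constant: "q * g = cc (ev (q * g) 0)"
proof -
  have Z: "dZ a (q * g) = 0" and W: "dZbar a (q * g) = 0" for a
    by (simp_all add: D_mult q_derivs g_derivs algebra_simps)
  show ?thesis by (rule smf_constant[OF Z W dT_0_if_dZ_dZbar_0[OF Z W]])
qed

lemma q_form: "\<exists>k \<kappa>. \<forall>p. ev q p = - \<i> * ev (q * g) 0 * ev hol_coord p + (\<Sum>a\<in>UNIV. k a * fst p $ a) + \<kappa>"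
proof -
  define c0 where "c0 = ev (q * g) 0"
  have qg: "q * g = cc c0" unfolding c0_def by (rule qg_constant)
  have dTq: "dT q = - cc (\<i> * c0)"
  proof (rule smf_eqI)
    fix p
    define a where "a = (SOME a::'n. True)"
    \<comment> \<open>The commutator determines the t-derivative: as E vanishes, Zbar P is -g on the
      diagonal, so the left side is 2qg, a constant.\<close>
    have "dZbar a (dZ a q) - dZ a (dZbar a q) = 2 * cc \<i> * dT q" by (simp add: dZ_dZbar)
    moreover have "dZbar a (dZ a q) = 2 * (q * g)"
      by (simp add: q_derivs D_mult D_minus dZbar_P EM0)
    ultimately have "2 * (q * g) = 2 * cc \<i> * dT q" by (simp add: q_derivs)
    from arg_cong[OF this[unfolded qg], of "\<lambda>F. ev F p"]
    show "ev (dT q) p = ev (- cc (\<i> * c0)) p" by simp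
  qed
  \<comment> \<open>The term 2 P P built into D cancels the derivative of q here.\<close>
  have dZZq: "dZ b (dZ a q) = 0" for a b
    by (simp add: q_derivs D_mult D_minus dZ_P DM0 algebra_simps)
  \<comment> \<open>Subtracting the right multiple of the CR coordinate removes the t-derivative;
    what remains has constant Z-derivatives and is affine in z.\<close>
  define r where "r = q + cc (\<i> * c0) * hol_coord"
  have rW: "dZbar a r = 0" for a
    by (simp add: r_def D_add D_mult q_derivs hol_coord_derivs)
  have rT: "dT r = 0"
    by (simp add: r_def D_add D_mult dTq hol_coord_derivs)
  have rZZ: "dZ b (dZ a r) = 0" for a b
    by (simp add: r_def D_add D_mult dZZq hol_coord_derivs dZbar_zz flip: cj_D(3))
  have rWZ: "dZbar b (dZ a r) = 0" for a b
    using dZ_dZbar[of a b r] by (simp add: rW rT)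
  have rTZ: "dT (dZ a r) = 0" for a
    by (simp add: dT_dZ rT)
  define k where "k a = ev (dZ a r) 0" for a
  have k: "dZ a r = cc (k a)" for a
    unfolding k_def by (rule smf_constant[OF rZZ rWZ rTZ])
  define s where "s = r - (\<Sum>a\<in>UNIV. cc (k a) * zz a)"
  have sZ: "dZ a s = 0" for a
  proof -
    have "(\<Sum>b\<in>UNIV. cc (k b) * (if a = b then 1 else 0)) = (cc (k a) :: 'n smf)"
      by (simp add: if_distrib[of "\<lambda>x. _ * x"] cong: if_cong)
    then show ?thesis by (simp add: s_def D_diff D_sum D_mult k dZ_zz)
  qed
  have sW: "dZbar a s = 0" and sT: "dT s = 0" for a
    by (simp_all add: s_def D_diff D_sum D_mult dZbar_zz dT_zz rW rT)
  have s: "s = cc (ev s 0)" by (rule smf_constant[OF sZ sW sT])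
  have "ev q p = - \<i> * c0 * ev hol_coord p + (\<Sum>a\<in>UNIV. k a * fst p $ a) + ev s 0" for p
  proof -
    have "q = s + (\<Sum>a\<in>UNIV. cc (k a) * zz a) - cc (\<i> * c0) * hol_coord"
      by (simp add: s_def r_def)
    then have "ev q p = ev s p + (\<Sum>a\<in>UNIV. k a * fst p $ a) - \<i> * c0 * ev hol_coord p"
      by simp
    also have "ev s p = ev s 0" using arg_cong[OF s, of "\<lambda>F. ev F p"] by simp
    finally show ?thesis by simp
  qed
  then show ?thesis unfolding c0_def by blast
qed

end

end

context jerison_lee_decay
begin

theorem bubble:
  assumes Yi: "Yi * Y = 1"
  shows "\<exists>lam mu c. Im lam > (norm mu)\<^sup>2 / 4 \<and> c > 0 \<and> (\<forall>p. y p ^ CARD('n) = JL_bubble c lam mu p)"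
proof -
  note G = GV_zero EM_zero DM_zero Yi
  define qq where "qq = q Yi"
  have q_def': "qq = (h + t) * Yi" unfolding qq_def q_def[OF G] ..
  \<comment> \<open>The value at the origin of |h + t|^2 / Y, which is qg there; positive since y
    is.\<close>
  define c0 where "c0 = ((xv 0)\<^sup>2 + (y 0)\<^sup>2)\<^sup>2 / (y 0)\<^sup>2 + (tv 0)\<^sup>2 / (y 0)\<^sup>2"
  have c0: "c0 > 0" unfolding c0_def using y_pos[of 0]
    by (intro add_pos_nonneg divide_pos_pos zero_less_power add_nonneg_pos) auto
  have ev_Yi: "ev Yi p = complex_of_real (1 / (y p)\<^sup>2)" for p
    using arg_cong[OF Yi, of "\<lambda>F. ev F p"] y_pos[of p] unfolding ev_simps ev_Y by (simp add: field_simps)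
  have "ev (qq * g) 0 = complex_of_real c0"
    using y_pos[of 0] unfolding q_def' g_def ev_simps ev_h ev_t ev_Yi c0_def
    by (simp add: complex_eq_iff power2_eq_square field_simps)
  then have qg: "qq * g = cc (complex_of_real c0)" and ev0: "ev (qq * g) 0 = complex_of_real c0"
    using qg_constant[OF G] unfolding qq_def by simp_all
  \<comment> \<open>The conjugate of q is g times \<open>Yi\<close>, so |q|^2 equals qg / Y, and e^f
    is recovered from |q|.\<close>
  have normq: "cmod (ev qq p) = sqrt c0 / y p" for p
  proof -
    have "qq * cj qq = qq * g * cj Yi"
      by (simp add: q_def' cj_rules g_def algebra_simps)
    then have "ev (qq * cj qq) p = ev (cc (complex_of_real c0) * cj Yi) p"
      by (simp only: qg)
    also have "\<dots> = complex_of_real (c0 / (y p)\<^sup>2)"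
      by (simp add: ev_Yi)
    finally have "ev (qq * cj qq) p = complex_of_real (c0 / (y p)\<^sup>2)" .
    then have "(cmod (ev qq p))\<^sup>2 = c0 / (y p)\<^sup>2"
      unfolding ev_simps mult_cnj_cmod of_real_eq_iff .
    then have "cmod (ev qq p) = sqrt (c0 / (y p)\<^sup>2)" by (metis norm_ge_zero real_sqrt_unique)
    then show ?thesis using y_pos[of p] by (simp add: real_sqrt_divide)
  qed
  obtain k \<kappa> where k: "\<And>p. ev qq p = - \<i> * complex_of_real c0 * ev hol_coord p + (\<Sum>a\<in>UNIV. k a * fst p $ a) + \<kappa>"
    using q_form[OF G] unfolding qq_def[symmetric] ev0 by blast
  \<comment> \<open>The affine part of q is divided by the coefficient -i c0 of the CR
    coordinate.\<close>
  define mu :: "complex ^ 'n" where "mu = (\<chi> a. \<i> * k a / complex_of_real c0)"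
  define lam where "lam = \<i> * \<kappa> / complex_of_real c0"
  define W where "W p = complex_of_real (snd p) + \<i> * complex_of_real ((norm (fst p))\<^sup>2)
                + (\<Sum>a\<in>UNIV. (fst p $ a) * (mu $ a)) + lam" for p :: "'n heis"
  have qW: "ev qq p = - \<i> * complex_of_real c0 * W p" for p
  proof -
    have "- \<i> * complex_of_real c0 * (\<Sum>a\<in>UNIV. (fst p $ a) * (mu $ a)) = (\<Sum>a\<in>UNIV. k a * fst p $ a)"
      unfolding sum_distrib_left by (rule sum.cong[OF refl]) (use c0 in \<open>simp add: mu_def field_simps\<close>)
    moreover have "- \<i> * complex_of_real c0 * lam = \<kappa>" using c0 by (simp add: lam_def)
    ultimately show ?thesis unfolding k W_def ev_hol_coord distrib_left by simp
  qed
  have yW: "y p = 1 / (sqrt c0 * cmod (W p))" and W0: "W p \<noteq> 0" for p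
  proof -
    have "c0 * cmod (W p) = sqrt c0 / y p"
      using normq[of p] c0 unfolding qW by (simp add: norm_mult)
    then have e': "c0 * cmod (W p) * y p = sqrt c0"
      using y_pos[of p] by simp
    have "sqrt c0 * (sqrt c0 * cmod (W p) * y p) = (sqrt c0 * sqrt c0) * cmod (W p) * y p"
      by (simp only: mult.assoc)
    also have "\<dots> = sqrt c0 * 1" using e' c0 by simp
    finally have e: "sqrt c0 * (sqrt c0 * cmod (W p) * y p) = sqrt c0 * 1" .
    then have *: "sqrt c0 * cmod (W p) * y p = 1" using c0 by (simp only: mult_cancel_left real_sqrt_eq_zero_cancel_iff) simp
    then show "W p \<noteq> 0" by auto
    with * c0 show "y p = 1 / (sqrt c0 * cmod (W p))" by (simp add: field_simps)
  qed
  have "Im lam > (norm mu)\<^sup>2 / 4"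
    by (rule im_gt_if_nonvanishing) (use W0[unfolded W_def] in \<open>metis fst_conv snd_conv\<close>)
  moreover have "(1 / sqrt c0) ^ CARD('n) > 0" using c0 by simp
  moreover have "y p ^ CARD('n) = JL_bubble ((1 / sqrt c0) ^ CARD('n)) lam mu p" for p
    unfolding JL_bubble_def W_def[symmetric] yW by (simp add: power_divide power_mult_distrib)
  ultimately show ?thesis by blast
qed

end

section \<open>From the equation for u to the hypotheses on f\<close>

definition real_smf :: "('n::finite heis \<Rightarrow> real) \<Rightarrow> 'n smf" where
  "real_smf \<phi> = Smf (\<lambda>p. complex_of_real (\<phi> p))"

lemma ev_real_smf:
  assumes "smooth \<phi>"
  shows "ev (real_smf \<phi>) = (\<lambda>p. complex_of_real (\<phi> p))"
proof -
  have "smooth (\<lambda>p. complex_of_real (\<phi> p))" by (rule smooth_linear[OF bounded_linear_of_real assms])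
  then show ?thesis unfolding real_smf_def by (simp add: Smf_inverse)
qed

lemma cj_real_smf: "smooth \<phi> \<Longrightarrow> cj (real_smf \<phi>) = real_smf \<phi>"
  by (rule smf_eqI) (simp add: ev_real_smf)

lemma smooth_scale: "smooth \<phi> \<Longrightarrow> smooth (\<lambda>p. c * \<phi> p :: real)"
  by (intro smooth_mult smooth_const)

lemma dd_exp_smf:
  assumes \<phi>: "smooth \<phi>"
  shows "dd v (real_smf (\<lambda>p. exp (c * \<phi> p))) = cc (complex_of_real c) * real_smf (\<lambda>p. exp (c * \<phi> p)) * dd v (real_smf \<phi>)"
proof (rule smf_eqI)
  fix p
  note s = smooth_exp[OF smooth_scale[OF \<phi>, of c]]
  note lin = ddir_linear[OF smooth_differentiable bounded_linear_of_real]
  have "ddir v (\<lambda>p. exp (c * \<phi> p)) p = exp (c * \<phi> p) * ddir v (\<lambda>p. c * \<phi> p) p"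
    by (rule ddir_compose_real) (auto intro: DERIV_exp smooth_differentiable smooth_scale \<phi>)
  also have "ddir v (\<lambda>p. c * \<phi> p) p = c * ddir v \<phi> p"
    by (subst ddir_mult) (auto simp: ddir_const intro: smooth_differentiable \<phi>)
  finally show "ev (dd v (real_smf (\<lambda>p. exp (c * \<phi> p)))) p
      = ev (cc (complex_of_real c) * real_smf (\<lambda>p. exp (c * \<phi> p)) * dd v (real_smf \<phi>)) p"
    by (simp add: ev_dd ev_real_smf[OF s] ev_real_smf[OF \<phi>] lin[OF s] lin[OF \<phi>])
qed

lemma D_exp_smf:
  assumes \<phi>: "smooth \<phi>"
  defines "E \<equiv> \<lambda>c. real_smf (\<lambda>p. exp (c * \<phi> p))"
  shows "dT (E c) = cc (complex_of_real c) * E c * dT (real_smf \<phi>)"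
    "dZ a (E c) = cc (complex_of_real c) * E c * dZ a (real_smf \<phi>)"
    "dZbar a (E c) = cc (complex_of_real c) * E c * dZbar a (real_smf \<phi>)"
  unfolding E_def by (simp_all add: D_defs dd_exp_smf[OF \<phi>] algebra_simps)

lemma one_add_power_le:
  assumes "x \<ge> (0::real)"
  shows "(1 + x) ^ n \<le> 2 ^ n * (1 + x ^ n)"
proof -
  have "(1 + x) ^ n \<le> (2 * max 1 x) ^ n"
    using assms by (intro power_mono) auto
  also have "\<dots> = 2 ^ n * (max 1 x) ^ n" by (rule power_mult_distrib)
  also have "(max 1 x) ^ n \<le> 1 + x ^ n"
    using assms by (cases "x \<le> 1") (auto simp: max_def)
  finally show ?thesis by simp
qed

lemma cc_real_nat: "cc (complex_of_real (real k)) = of_nat k"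
  by (simp add: cc_of_nat)

text \<open>The constant \<open>C'\<close> is only asserted to exist, but it is the one for which
  the bubble solves the equation, because u equals the bubble and satisfies
  \<open>eq\<close>.\<close>

theorem theorem1p2:
  fixes u :: "'n::finite heis \<Rightarrow> real" and C :: real
  assumes n2: "CARD('n) \<ge> 2"
    and smooth_u: "smooth u"
    and pos: "\<And>p. u p > 0"
    and eq: "\<And>p. - sublap (\<lambda>q. complex_of_real (u q)) p
               = complex_of_real (2 * (real CARD('n))\<^sup>2 *
                   u p powr ((real (2 * CARD('n) + 2) + 2) / (real (2 * CARD('n) + 2) - 2)))"
    and Cpos: "C > 0"
    and bound: "\<And>\<xi>. u \<xi> \<le> C / (1 + heis_norm \<xi> powr ((real (2 * CARD('n) + 2) - 2) / 2))"
  shows "\<exists>lam mu C'. Im lam > (norm mu)\<^sup>2 / 4 \<and> C' > 0 \<and> u = JL_bubble C' lam mu"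
proof -
  let ?n = "CARD('n)"
  define \<phi> where "\<phi> p = inverse (real ?n) * ln (u p)" for p
  have \<phi>: "smooth \<phi>"
    unfolding \<phi>_def by (intro smooth_scale smooth_ln smooth_u pos)
  define E where "E c = real_smf (\<lambda>p. exp (c * \<phi> p))" for c
  define f where "f = real_smf \<phi>"
  have ev_E: "ev (E c) p = complex_of_real (exp (c * \<phi> p))" for c p
    unfolding E_def by (simp add: ev_real_smf[OF smooth_exp[OF smooth_scale[OF \<phi>]]])
  have cj_E: "cj (E c) = E c" for c
    unfolding E_def by (rule cj_real_smf[OF smooth_exp[OF smooth_scale[OF \<phi>]]])
  note DE = D_exp_smf[OF \<phi>, folded E_def f_def]
  have u: "u p = exp (real ?n * \<phi> p)" for p
    using pos[of p] n2 by (simp add: \<phi>_def mult.assoc[symmetric] del: mult.assoc)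
  define U where "U = E (real ?n)"
  define N :: "'n smf" where "N = of_nat ?n"
  define X where "X = (\<Sum>a\<in>UNIV. dZ a f * dZbar a f)"
  define S where "S = (\<Sum>a\<in>UNIV. dZbar a (dZ a f))"
  have DU: "dZ a U = N * U * dZ a f" "dZbar a U = N * U * dZbar a f" for a
    unfolding U_def DE N_def cc_real_nat by simp_all
  have DN: "dZ a N = 0" "dZbar a N = 0" for a
    by (simp_all add: N_def)
  have lap: "(\<Sum>a\<in>UNIV. dZbar a (dZ a U) + dZ a (dZbar a U)) = N * U * (2 * S - 2 * N * (cc \<i> * dT f) + 2 * N * X)"
  proof -
    have "dZbar a (dZ a U) + dZ a (dZbar a U)
       = N * U * (2 * dZbar a (dZ a f) - 2 * (cc \<i> * dT f) + 2 * N * (dZ a f * dZbar a f))" for a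
      unfolding DU D_mult DN dZ_dZbar[of a a f] by (simp add: algebra_simps)
    then have "(\<Sum>a\<in>UNIV. dZbar a (dZ a U) + dZ a (dZbar a U))
       = N * U * (\<Sum>a\<in>UNIV. 2 * dZbar a (dZ a f) - 2 * (cc \<i> * dT f) + 2 * N * (dZ a f * dZbar a f))"
      by (simp only: sum_distrib_left)
    also have "\<dots> = N * U * (2 * S - 2 * N * (cc \<i> * dT f) + 2 * N * X)"
      by (simp add: sum.distrib sum_subtractf S_def X_def N_def sum_distrib_left mult_ac)
    finally show ?thesis .
  qed
  have yamabe: "S = - N * (X + E 2 - cc \<i> * dT f)"
  proof (rule smf_eqI)
    fix p
    have "u p powr ((real (2 * ?n + 2) + 2) / (real (2 * ?n + 2) - 2)) = exp (real ?n * \<phi> p) * exp (2 * \<phi> p)"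
    proof -
      \<comment> \<open>The exponent (Q+2)/(Q-2) is 1 + 2/n, so the right side of the equation is a
        multiple of u e^{2f}.\<close>
      have "(real (2 * ?n + 2) + 2) / (real (2 * ?n + 2) - 2) * (real ?n * \<phi> p) = real ?n * \<phi> p + 2 * \<phi> p"
        using n2 by (simp add: field_simps)
      then show ?thesis unfolding powr_def using pos[of p] by (simp only: u ln_exp exp_add[symmetric]) simp
    qed
    moreover have evU: "ev U = (\<lambda>q. complex_of_real (u q))"
      by (rule ext) (simp add: U_def ev_E u)
    then have "sublap (\<lambda>q. complex_of_real (u q)) p = ev (\<Sum>a\<in>UNIV. dZbar a (dZ a U) + dZ a (dZbar a U)) p"
      by (simp add: sublap_def ev_dZ ev_dZbar)
    ultimately have "- ev (N * U * (2 * S - 2 * N * (cc \<i> * dT f) + 2 * N * X)) p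
        = complex_of_real (2 * (real ?n)\<^sup>2 * (exp (real ?n * \<phi> p) * exp (2 * \<phi> p)))"
      using eq[of p] unfolding lap by simp
    also have "\<dots> = ev (2 * N * N * U * E 2) p"
      by (simp add: N_def U_def ev_E power2_eq_square)
    finally have *: "ev (N * U * 2) p * ev S p = ev (N * U * 2) p * ev (- N * (X + E 2 - cc \<i> * dT f)) p"
      by (simp add: algebra_simps)
    \<comment> \<open>The ring of smooth functions has zero divisors, so the common factor is
      cancelled at each point.\<close>
    have "ev (N * U * 2) p \<noteq> 0" using n2 by (simp add: N_def U_def ev_E)
    from * show "ev S p = ev (- N * (X + E 2 - cc \<i> * dT f)) p"
      unfolding mult_left_cancel[OF \<open>ev (N * U * 2) p \<noteq> 0\<close>] .
  qed
  \<comment> \<open>The 2 comes from (1+x)^n being at most 2^n (1+x^n); the maximum with 1 ensures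
    that C is at most its n-th power.\<close>
  define c1 where "c1 = 2 * max 1 C"
  have y_le: "exp (\<phi> p) * (1 + heis_norm p) \<le> c1" for p
  proof -
    let ?h = "heis_norm p"
    have h: "?h \<ge> 0" by (rule heis_norm_nonneg)
    \<comment> \<open>At the origin both sides are 0, since \<open>powr\<close> with base 0 is 0 and
      n is positive.\<close>
    have "?h powr ((real (2 * ?n + 2) - 2) / 2) = ?h ^ ?n"
      using h n2 by (cases "?h = 0") (auto simp: powr_realpow)
    then have b: "u p * (1 + ?h ^ ?n) \<le> C"
      using bound[of p] h by (simp add: pos_le_divide_eq add_pos_nonneg)
    have "(exp (\<phi> p) * (1 + ?h)) ^ ?n = u p * (1 + ?h) ^ ?n"
      by (simp add: u power_mult_distrib exp_of_nat_mult)
    also have "\<dots> \<le> u p * (2 ^ ?n * (1 + ?h ^ ?n))"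
      using one_add_power_le[OF h] less_imp_le[OF pos[of p]] by (rule mult_left_mono)
    also have "\<dots> \<le> 2 ^ ?n * C" using b by simp
    also have "\<dots> \<le> 2 ^ ?n * max 1 C ^ ?n"
      using self_le_power[of "max 1 C" ?n] n2 by simp
    also have "\<dots> = c1 ^ ?n" by (simp add: c1_def power_mult_distrib)
    finally have "(exp (\<phi> p) * (1 + ?h)) ^ ?n \<le> c1 ^ ?n" .
    then show ?thesis
      by (rule power_mono_iff[THEN iffD1, rotated 3]) (use h n2 in \<open>auto simp: c1_def\<close>)
  qed
  interpret jerison_lee_decay f "E 2" "E (2 * (real ?n - 1))" "\<lambda>p. exp (\<phi> p)" c1
  proof
    show "cj f = f" unfolding f_def by (rule cj_real_smf[OF \<phi>])
    show "cj (E 2) = E 2" "cj (E (2 * (real ?n - 1))) = E (2 * (real ?n - 1))" by (rule cj_E)+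
    show "dZ a (E 2) = 2 * E 2 * dZ a f" for a
      unfolding DE by (simp add: cc_of_nat)
    show "dT (E 2) = 2 * E 2 * dT f"
      unfolding DE by (simp add: cc_of_nat)
    have "cc (complex_of_real (2 * (real ?n - 1))) = (2 * (of_nat ?n - 1) :: 'n smf)"
      by (rule smf_eqI) simp
    then show "dZ a (E (2 * (real ?n - 1))) = 2 * (of_nat ?n - 1) * E (2 * (real ?n - 1)) * dZ a f" for a
      unfolding DE by simp
    show "(\<Sum>a\<in>UNIV. dZbar a (dZ a f)) = - of_nat ?n * ((\<Sum>a\<in>UNIV. dZ a f * dZbar a f) + E 2 - cc \<i> * dT f)"
      using yamabe unfolding S_def X_def N_def .
    show "ev (E 2) p = complex_of_real ((exp (\<phi> p))\<^sup>2)" for p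
      unfolding ev_E by (simp add: power2_eq_square flip: exp_add)
    have "real (2 * (?n - 1)) = 2 * (real ?n - 1)" using n2 by (simp add: of_nat_diff)
    then show "ev (E (2 * (real ?n - 1))) p = complex_of_real (exp (\<phi> p) ^ (2 * (?n - 1)))" for p
      unfolding ev_E by (metis exp_of_nat_mult)
    show "exp (\<phi> p) > 0" "exp (\<phi> p) * (1 + heis_norm p) \<le> c1" for p
      using y_le by auto
    show "?n \<ge> 2" by (rule n2)
  qed
  have "E (-2) * E 2 = 1"
    by (rule smf_eqI) (simp add: ev_E flip: of_real_mult exp_add)
  from bubble[OF this] obtain lam mu c where *: "Im lam > (norm mu)\<^sup>2 / 4" "c > 0"
    "\<And>p. exp (\<phi> p) ^ ?n = JL_bubble c lam mu p" by blast
  have "u = JL_bubble c lam mu"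
    by (rule ext) (simp add: u exp_of_nat_mult flip: *(3))
  with * show ?thesis by blast
qed

end
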